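(* Let $\mathcal X$ be the GK curve, let $\bar m,\bar s>0$ be integers, and let $c_0=0,c_1,\ldots,c_{\bar s}$ be $\bar s+1$ distinct elements of $\Gamma_0$. Let $\bar{\mathcal G}=\bigcup_{i=0}^{\bar s}(\mathcal X\cap\zeta_{c_i})$, $\bar{\mathcal D}=\mathcal X(\mathbb F_{q^6})\setminus\bar{\mathcal G}$, $\bar G=\bar m\sum_{P\in\bar{\mathcal G}}P$, $\bar D=\sum_{P\in\bar{\mathcal D}}P$, and let $\bar k$ be the dimension over $\mathbb F_{q^6}$ of the functional AG code $\bar C=C_{\mathcal L}(\bar D,\bar G)$. If $$\frac{q^5-2q^3+q^2-1}{(\bar s+1)q^3+1}\le\bar m\le\frac{q^8-q^6+q^5-(\bar s+1)q^3-1}{(\bar s+1)q^3+1},$$ then $$\bar k=\bar m\left(1+(\bar s+1)q^3\right)-\frac12\left(q^5-2q^3+q^2-2\right).$$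
   Context: Let $q$ be a prime power. The GK curve $\mathcal X$ is the non-singular projective curve in $PG(3,\overline{\mathbb F}_q)$ defined by the affine equations $Y^{q+1}=X^q+X$, $Z^{q^2-q+1}=Y^{q^2}-Y$. It has a unique point at infinity $P_\infty$, which is $\mathbb F_{q^2}$-rational, genus $g=\frac{q^5-2q^3+q^2}{2}$, and $|\mathcal X(\mathbb F_{q^6})|=q^8-q^6+q^5+1$, where $\mathcal X(\mathbb F_{q^6})$ is the set of $\mathbb F_{q^6}$-rational points. For $c\in\mathbb F_{q^6}$, $\zeta_c$ is the plane with affine equation $Z=c$ (it contains $P_\infty$). $\Gamma=\{c\in\mathbb F_{q^6} : c^{(q^3+1)(q^2-1)}+c^{(q^3+1)(q^2-q)}+1=0\}$ and $\Gamma_0=\Gamma\cup\{0\}$; for $c\in\Gamma_0$ the set $\mathcal X\cap\zeta_c$ consists of $q^3+1$ $\mathbb F_{q^6}$-rational points, $P_\infty$ included. Thus $\deg\bar G=\bar m+\bar m(\bar s+1)q^3$ and $\deg\bar D=q^8-q^6+q^5-(\bar s+1)q^3$. Functional code: for an $\mathbb F_{q^6}$-rational divisor $G$, $\mathcal L(G)=\{f\in\mathbb F_{q^6}(\mathcal X)\setminus\{0\}: (f)+G\ge 0\}\cup\{0\}$. For $D=P_1+\cdots+P_n$ with distinct $\mathbb F_{q^6}$-rational $P_i$ not in $\mathrm{supp}(G)$, $C_{\mathcal L}(D,G)=\{(f(P_1),\ldots,f(P_n)) : f\in\mathcal L(G)\}\subseteq\mathbb F_{q^6}^n$. *)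

theory Defs
  imports
    "HOL-Analysis.Finite_Cartesian_Product"
    "HOL-Analysis.Cartesian_Space"
    "HOL-Algebra.Algebraic_Closure_Type"
    "HOL-Library.Poly_Mapping"
    "HOL-Library.Function_Algebras"
    "HOL-Number_Theory.Prime_Powers"
begin

section \<open>Projective varieties over an algebraically closed field\<close>

text \<open>
  A point of projective space is the set of its homogeneous coordinate vectors.  Polynomials in
  the variables indexed by \<open>'n\<close> are finitely supported maps from exponent vectors to
  coefficients, with the ring structure of \<open>Poly_Mapping\<close>.
\<close>

type_synonym ('k, 'n) ppoint = "('k ^ 'n) set"

type_synonym ('k, 'n) mpol = "('n \<Rightarrow>\<^sub>0 nat) \<Rightarrow>\<^sub>0 'k"

definition proj_point :: "('k::field ^ 'n::finite) \<Rightarrow> ('k, 'n) ppoint" where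
  "proj_point v = {a *s v | a. a \<noteq> 0}"

definition proj_space :: "('k::field, 'n::finite) ppoint set" where
  "proj_space = proj_point ` {v. v \<noteq> 0}"

definition mpol_eval :: "('k::field, 'n::finite) mpol \<Rightarrow> 'k ^ 'n \<Rightarrow> 'k" where
  "mpol_eval A v =
     (\<Sum>e\<in>Poly_Mapping.keys A. Poly_Mapping.lookup A e * (\<Prod>i\<in>UNIV. (v $ i) ^ Poly_Mapping.lookup e i))"

definition homogeneous :: "nat \<Rightarrow> ('k::field, 'n::finite) mpol \<Rightarrow> bool" where
  "homogeneous d A \<longleftrightarrow> (\<forall>e\<in>Poly_Mapping.keys A. (\<Sum>i\<in>UNIV. Poly_Mapping.lookup e i) = d)"

definition vanishes_at :: "('k::field, 'n::finite) mpol \<Rightarrow> ('k, 'n) ppoint \<Rightarrow> bool" where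
  "vanishes_at A P \<longleftrightarrow> (\<forall>v\<in>P. mpol_eval A v = 0)"

definition vanishes_on :: "('k::field, 'n::finite) mpol \<Rightarrow> ('k, 'n) ppoint set \<Rightarrow> bool" where
  "vanishes_on A V \<longleftrightarrow> (\<forall>P\<in>V. vanishes_at A P)"

definition zariski_closure :: "('k::field, 'n::finite) ppoint set \<Rightarrow> ('k, 'n) ppoint set" where
  "zariski_closure S =
     {P \<in> proj_space. \<forall>d A. homogeneous d A \<longrightarrow> vanishes_on A S \<longrightarrow> vanishes_at A P}"


section \<open>Function fields, local rings and valuations\<close>

text \<open>
  A rational function on an irreducible projective variety \<open>V\<close> is the class of a fraction
  \<open>A/B\<close> of homogeneous polynomials of equal degree with \<open>B\<close> not identically zero on \<open>V\<close>,
  where \<open>A/B = C/D\<close> iff \<open>A D - C B\<close> vanishes on \<open>V\<close>.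
\<close>

type_synonym ('k, 'n) ratfun = "(('k, 'n) mpol \<times> ('k, 'n) mpol) set"

definition fractions :: "('k::field, 'n::finite) ppoint set \<Rightarrow> (('k, 'n) mpol \<times> ('k, 'n) mpol) set" where
  "fractions V = {(A, B). (\<exists>d. homogeneous d A \<and> homogeneous d B) \<and> \<not> vanishes_on B V}"

definition fraction_rel ::
    "('k::field, 'n::finite) ppoint set
      \<Rightarrow> ((('k, 'n) mpol \<times> ('k, 'n) mpol) \<times> (('k, 'n) mpol \<times> ('k, 'n) mpol)) set" where
  "fraction_rel V = {((A, B), (C, D)). (A, B) \<in> fractions V \<and> (C, D) \<in> fractions V \<and>
                       vanishes_on (A * D - C * B) V}"

definition function_field :: "('k::field, 'n::finite) ppoint set \<Rightarrow> ('k, 'n) ratfun ring" where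
  "function_field V =
     \<lparr> carrier = fractions V // fraction_rel V,
       monoid.mult = (\<lambda>f g. \<Union>(A, B)\<in>f. \<Union>(C, D)\<in>g. fraction_rel V `` {(A * C, B * D)}),
       monoid.one = fraction_rel V `` {(1, 1)},
       ring.zero = fraction_rel V `` {(0, 1)},
       ring.add = (\<lambda>f g. \<Union>(A, B)\<in>f. \<Union>(C, D)\<in>g. fraction_rel V `` {(A * D + C * B, B * D)}) \<rparr>"

definition local_ring :: "('k::field, 'n::finite) ppoint set \<Rightarrow> ('k, 'n) ppoint \<Rightarrow> ('k, 'n) ratfun set" where
  "local_ring V P = {f \<in> carrier (function_field V). \<exists>(A, B)\<in>f. \<not> vanishes_at B P}"

definition local_max_ideal :: "('k::field, 'n::finite) ppoint set \<Rightarrow> ('k, 'n) ppoint \<Rightarrow> ('k, 'n) ratfun set" where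
  "local_max_ideal V P =
     {f \<in> carrier (function_field V). \<exists>(A, B)\<in>f. vanishes_at A P \<and> \<not> vanishes_at B P}"

definition uniformizer :: "('k::field, 'n::finite) ppoint set \<Rightarrow> ('k, 'n) ppoint \<Rightarrow> ('k, 'n) ratfun \<Rightarrow> bool" where
  "uniformizer V P t \<longleftrightarrow> t \<in> local_ring V P \<and>
     local_max_ideal V P = {t \<otimes>\<^bsub>function_field V\<^esub> u | u. u \<in> local_ring V P}"

text \<open>
  The valuation of a nonzero rational function at a non-singular point \<open>P\<close> of a curve \<open>V\<close>;
  the principal divisor \<open>(f)\<close> is \<open>P \<mapsto> ord_at V P f\<close>.
\<close>

definition ord_at :: "('k::field, 'n::finite) ppoint set \<Rightarrow> ('k, 'n) ppoint \<Rightarrow> ('k, 'n) ratfun \<Rightarrow> int" where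
  "ord_at V P f =
     (THE k :: int. \<exists>t u. uniformizer V P t \<and> u \<in> local_ring V P - local_max_ideal V P \<and>
                      f = (t [^]\<^bsub>function_field V\<^esub> k) \<otimes>\<^bsub>function_field V\<^esub> u)"


section \<open>Rationality over the base field and functional codes\<close>

text \<open>
  From here on the base field is the type \<open>'a\<close> itself, embedded by \<open>to_ac\<close> in its algebraic
  closure, over which varieties are taken.
\<close>

definition rational_points :: "('a::field alg_closure, 'n::finite) ppoint set \<Rightarrow> ('a alg_closure, 'n) ppoint set" where
  "rational_points V = {P \<in> V. \<exists>v\<in>P. \<forall>i. v $ i \<in> range to_ac}"

definition rational_mpol :: "('a::field alg_closure, 'n::finite) mpol \<Rightarrow> bool" where
  "rational_mpol A \<longleftrightarrow> (\<forall>e. Poly_Mapping.lookup A e \<in> range to_ac)"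

definition rational_functions :: "('a::field alg_closure, 'n::finite) ppoint set \<Rightarrow> ('a alg_closure, 'n) ratfun set" where
  "rational_functions V =
     {f \<in> carrier (function_field V). \<exists>(A, B)\<in>f. rational_mpol A \<and> rational_mpol B}"

type_synonym ('k, 'n) pdivisor = "('k, 'n) ppoint \<Rightarrow>\<^sub>0 int"

definition riemann_roch_space ::
    "('a::field alg_closure, 'n::finite) ppoint set \<Rightarrow> ('a alg_closure, 'n) pdivisor
      \<Rightarrow> ('a alg_closure, 'n) ratfun set" where
  "riemann_roch_space V G =
     {f \<in> rational_functions V. f \<noteq> \<zero>\<^bsub>function_field V\<^esub> \<and>
        (\<forall>P\<in>V. ord_at V P f + Poly_Mapping.lookup G P \<ge> 0)} \<union> {\<zero>\<^bsub>function_field V\<^esub>}"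

text \<open>
  The value at a rational point \<open>P\<close> of a function over the base field that is regular at \<open>P\<close>:
  it lies in \<open>range to_ac\<close> and is pulled back to \<open>'a\<close>.
\<close>

definition value_at :: "('a::field alg_closure, 'n::finite) ratfun \<Rightarrow> ('a alg_closure, 'n) ppoint \<Rightarrow> 'a" where
  "value_at f P = of_ac (THE b. \<exists>(A, B)\<in>f. \<exists>v\<in>P. mpol_eval B v \<noteq> 0 \<and> b = mpol_eval A v / mpol_eval B v)"

text \<open>
  For \<open>D = P\<^sub>1 + \<dots> + P\<^sub>n\<close> a word of length \<open>n\<close> is indexed by the points \<open>P\<^sub>i\<close> themselves
  instead of by \<open>1, \<dots>, n\<close>, and extended by zero to all other points.
\<close>

definition functional_code ::
    "('a::field alg_closure, 'n::finite) ppoint set \<Rightarrow> ('a alg_closure, 'n) pdivisor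
      \<Rightarrow> ('a alg_closure, 'n) pdivisor \<Rightarrow> (('a alg_closure, 'n) ppoint \<Rightarrow> 'a) set" where
  "functional_code V D G =
     {(\<lambda>P. if P \<in> Poly_Mapping.keys D then value_at f P else 0) | f. f \<in> riemann_roch_space V G}"

definition code_dim :: "('i \<Rightarrow> 'a::field) set \<Rightarrow> nat" where
  "code_dim C = vector_space.dim (\<lambda>(a::'a) w i. a * w i) C"

text \<open>The divisor \<open>m \<Sum>\<^bsub>P \<in> S\<^esub> P\<close>, for a finite set \<open>S\<close> of points.\<close>

definition sum_divisor :: "nat \<Rightarrow> ('k, 'n) ppoint set \<Rightarrow> ('k, 'n) pdivisor" where
  "sum_divisor m S = (\<Sum>P\<in>S. Poly_Mapping.single P (int m))"


section \<open>The GK curve\<close>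

text \<open>
  The homogeneous coordinates \<open>(X : Y : Z : T)\<close> of three-dimensional projective space are the
  components \<open>1, 2, 3, 4\<close>, and affine space is \<open>T = 1\<close>.  The curve is the projective closure of
  the affine one; merely homogenising the two affine equations would add the line
  \<open>Y = T = 0\<close> at infinity.
\<close>

definition GK_affine :: "nat \<Rightarrow> ('k::field, 4) ppoint set" where
  "GK_affine q = {proj_point v | v. v $ 4 = 1 \<and>
     (v $ 2) ^ (q + 1) = (v $ 1) ^ q + v $ 1 \<and>
     (v $ 3) ^ (q\<^sup>2 - q + 1) = (v $ 2) ^ (q\<^sup>2) - v $ 2}"

definition GK_curve :: "nat \<Rightarrow> ('k::field, 4) ppoint set" where
  "GK_curve q = zariski_closure (GK_affine q)"

definition zeta_plane :: "'a::field \<Rightarrow> ('a alg_closure, 4) ppoint set" where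
  "zeta_plane c = {proj_point v | v. v \<noteq> 0 \<and> v $ 3 = to_ac c * v $ 4}"

definition Gamma :: "nat \<Rightarrow> 'a::field set" where
  "Gamma q = {c. c ^ ((q ^ 3 + 1) * (q\<^sup>2 - 1)) + c ^ ((q ^ 3 + 1) * (q\<^sup>2 - q)) + 1 = 0}"

definition Gamma0 :: "nat \<Rightarrow> 'a::field set" where
  "Gamma0 q = Gamma q \<union> {0}"

end

theory Submission
  imports Defs "HOL-Number_Theory.Cong"
begin

text \<open>
  Write \<open>g\<close> for the genus, \<open>C\<close> for the affine curve and \<open>N = m (1 + (s + 1) q\<^sup>3)\<close>. The hypotheses on
  \<open>m\<close> say that \<open>2 g - 1 \<le> N\<close> and that \<open>N\<close> is less than the length of the code, so the asserted
  dimension is the \<open>N + 1 - g\<close> of the Riemann-Roch theorem. It can be counted directly, because the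
  divisor is equivalent to a multiple of the single point \<open>P\<^sub>\<infinity>\<close>, and the functions with poles only at
  \<open>P\<^sub>\<infinity>\<close> can be listed explicitly.

  Above every value of \<open>z\<close> the affine curve has exactly \<open>q\<^sup>3\<close> points (\<open>fibre_card\<close>), and \<open>z - z(P)\<close> has
  order one at each affine point \<open>P\<close>. Hence \<open>h = \<Prod> (z - c\<^sub>i)\<close> vanishes to first order exactly at the
  affine points of the divisor, and has a pole of order \<open>(s + 1) q\<^sup>3\<close> at \<open>P\<^sub>\<infinity>\<close>. Multiplication by
  \<open>h\<^sup>m\<close> turns the given Riemann-Roch space into that of \<open>N P\<^sub>\<infinity>\<close>. A rational function without
  affine poles is a polynomial function on \<open>C\<close> (\<open>regular_everywhere\<close>), and a Frobenius argument shows
  that its coefficients lie in the base field (\<open>rational_coefficients\<close>).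

  The pole orders of \<open>x\<close>, \<open>y\<close>, \<open>z\<close> at \<open>P\<^sub>\<infinity>\<close> are \<open>q\<^sup>3 + 1\<close>, \<open>q (q\<^sup>2 - q + 1)\<close> and \<open>q\<^sup>3\<close>; they are
  taken as weights. The monomials \<open>x\<^sup>i y\<^sup>j z\<^sup>k\<close> with \<open>i < q\<close> and \<open>j < q\<^sup>2\<close> form a basis of the polynomial
  functions on \<open>C\<close>. Their weights are pairwise distinct, since \<open>(i, j)\<close> runs through all residues modulo
  \<open>q\<^sup>3\<close>. So each function has a leading weight, leading weights add up under multiplication
  (\<open>lead_mult\<close>), and counting the basis monomials of weight at most \<open>N\<close> gives \<open>N + 1 - g\<close>
  (\<open>card_Red_below\<close>). The same count shows that a function of leading weight \<open>w\<close> has at most \<open>w\<close>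
  zeros on \<open>C\<close> (\<open>card_zeros_le\<close>).

  It remains to see that evaluation is injective, that is, that there are more than \<open>N\<close> evaluation
  points. The roots of the polynomial defining \<open>\<Gamma>\<close> are simple and lie in the base field
  (\<open>card_GammaK\<close>, \<open>GammaK_Fq6\<close>), and all \<open>q\<^sup>3\<close> points above an element of \<open>\<Gamma>\<^sub>0\<close> are rational
  (\<open>fibre_rational\<close>). This supplies \<open>(|\<Gamma>\<^sub>0| - (s + 1)) q\<^sup>3 > N\<close> points.

  What connects this with the definition of orders through local rings is that the multiplicity with
  respect to \<open>z - z(P)\<close> at an affine point \<open>P\<close> (\<open>valuation_aff\<close>), and minus the leading weight at
  \<open>P\<^sub>\<infinity>\<close> (\<open>valuation_pinf\<close>), describe the local rings there.
\<close>

section \<open>Roots of polynomials over an algebraically closed field\<close>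

text \<open>
  Splitting off a root \<open>a\<close> leaves a quotient that is again separable and does not vanish at \<open>a\<close>.
\<close>

lemma card_roots_separable:
  fixes p :: "'k::alg_closed_field poly"
  assumes "p \<noteq> 0" and "\<And>a. poly p a = 0 \<Longrightarrow> poly (pderiv p) a \<noteq> 0"
  shows "card {a. poly p a = 0} = degree p"
  using assms
proof (induction "degree p" arbitrary: p)
  case 0
  then obtain c where "p = [:c:]" "c \<noteq> 0"
    by (metis degree_eq_zeroE pCons_eq_0_iff)
  thus ?case by simp
next
  case (Suc n)
  obtain a where a: "poly p a = 0"
    using alg_closed_imp_poly_has_root[of p] Suc by auto
  then obtain r where r: "p = [:-a, 1:] * r"
    using poly_eq_0_iff_dvd[of p a] by (auto elim: dvdE)
  have r0: "r \<noteq> 0" using Suc.prems(1) r by auto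
  have deg: "degree p = Suc (degree r)"
    unfolding r using r0 by (subst degree_mult_eq) auto
  have pd: "poly (pderiv p) b = poly r b + (b - a) * poly (pderiv r) b" for b
    unfolding r pderiv_mult by (simp add: pderiv_pCons algebra_simps)
  have ra: "poly r a \<noteq> 0" using Suc.prems(2)[OF a] pd[of a] by simp
  have IH: "card {b. poly r b = 0} = degree r"
  proof (rule Suc.hyps(1))
    show "n = degree r" using Suc.hyps(2) deg by simp
    show "poly (pderiv r) b \<noteq> 0" if "poly r b = 0" for b
    proof
      assume "poly (pderiv r) b = 0"
      hence "poly (pderiv p) b = 0" using pd[of b] that by simp
      moreover have "poly p b = 0" using that r by simp
      ultimately show False using Suc.prems(2) by blast
    qed
  qed (rule r0)
  have "{b. poly p b = 0} = insert a {b. poly r b = 0}" using r by auto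
  moreover have "finite {b. poly r b = 0}" using r0 by (rule poly_roots_finite)
  ultimately show ?case using IH deg ra by simp
qed

lemma infinite_alg_closed: "infinite (UNIV :: 'k::alg_closed_field set)"
proof
  assume fin: "finite (UNIV :: 'k set)"
  let ?P = "\<Prod>a\<in>(UNIV::'k set). [:-a, 1:]"
  have d: "degree ?P = card (UNIV :: 'k set)"
    by (subst degree_prod_eq_sum_degree) auto
  have pos: "card (UNIV :: 'k set) > 0" using fin by (simp add: card_gt_0_iff)
  have "degree (?P + 1) > 0"
    using d pos by (subst degree_add_eq_left) auto
  then obtain x where "poly (?P + 1) x = 0" using alg_closed_imp_poly_has_root by blast
  moreover have "poly ?P x = 0" using fin by (auto simp: poly_prod)
  ultimately show False by simp
qed

lemma powers_independent:
  fixes a :: "nat \<Rightarrow> 'k::idom"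
  assumes "\<And>x. x \<in> A \<Longrightarrow> (\<Sum>i<n. a i * x ^ i) = 0" and A: "infinite A \<or> card A \<ge> n" and "i < n"
  shows "a i = 0"
proof -
  define p where "p = (\<Sum>i<n. monom (a i) i)"
  have c: "coeff p j = (if j < n then a j else 0)" for j
    unfolding p_def by (auto simp: coeff_sum if_distrib cong: if_cong)
  have "p = 0"
  proof (rule ccontr)
    assume p0: "p \<noteq> 0"
    have sub: "A \<subseteq> {x. poly p x = 0}"
      using assms(1) by (auto simp: p_def poly_sum poly_monom)
    have fin: "finite {x. poly p x = 0}" using p0 by (rule poly_roots_finite)
    have "card A \<le> degree p"
      using card_mono[OF fin sub] card_poly_roots_bound[OF p0] by linarith
    moreover have "degree p < n"
      using c assms(3) p0 by (metis leading_coeff_0_iff)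
    moreover have "finite A" using fin sub finite_subset by blast
    ultimately show False using A by auto
  qed
  thus ?thesis using c[of i] assms(3) by simp
qed

section \<open>The coordinate ring of the affine curve and its weight filtration\<close>

type_synonym 'k point = "'k \<times> 'k \<times> 'k"
type_synonym 'k point_fun = "'k point \<Rightarrow> 'k"

abbreviation (input) yc :: "'k point_fun" where "yc p \<equiv> fst (snd p)"
abbreviation (input) zc :: "'k point_fun" where "zc p \<equiv> snd (snd p)"

text \<open>
  Polynomial functions on affine space with coefficients from \<open>S\<close>. They are kept as functions on the
  whole space; the coordinate ring of the curve is obtained by comparing them on the points of the
  curve only.
\<close>

inductive_set polyfuns :: "'k::comm_ring_1 set \<Rightarrow> 'k point_fun set" for S where
  const: "c \<in> S \<Longrightarrow> (\<lambda>_. c) \<in> polyfuns S"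
| X: "(\<lambda>p. fst p) \<in> polyfuns S"
| Y: "(\<lambda>p. yc p) \<in> polyfuns S"
| Z: "(\<lambda>p. zc p) \<in> polyfuns S"
| add: "f \<in> polyfuns S \<Longrightarrow> g \<in> polyfuns S \<Longrightarrow> (\<lambda>p. f p + g p) \<in> polyfuns S"
| mult: "f \<in> polyfuns S \<Longrightarrow> g \<in> polyfuns S \<Longrightarrow> (\<lambda>p. f p * g p) \<in> polyfuns S"

fun mon :: "nat \<times> nat \<times> nat \<Rightarrow> 'k::comm_ring_1 point \<Rightarrow> 'k" where
  "mon (i, j, k) (x, y, z) = x ^ i * y ^ j * z ^ k"

lemma mon_altdef: "mon e p = fst p ^ fst e * yc p ^ fst (snd e) * zc p ^ snd (snd e)"
  by (cases e; cases p) auto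

lemma mon_0: "mon (0, 0, 0) p = 1" by (simp add: mon_altdef)

text \<open>
  The three assumptions are what the arguments over the algebraic closure use of \<open>q\<close> being a power of
  the characteristic.
\<close>

locale gk_curve =
  fixes q :: nat and K :: "'k::alg_closed_field itself"
  assumes q2: "q \<ge> 2"
    and char_q: "of_nat q = (0::'k)"
    and frob: "\<And>x y :: 'k. (x + y) ^ q = x ^ q + y ^ q"
begin

definition M :: nat where "M = q\<^sup>2 - q + 1"

lemma M_plus_q: "M + q = q\<^sup>2 + 1"
  using q2 by (simp add: M_def power2_eq_square)

lemma M_pos: "M > 0"
  by (simp add: M_def)

lemma M_factor: "(q + 1) * M = q ^ 3 + 1"
proof -
  have "(q + 1) * (M + q) = (q+1) * (q\<^sup>2 + 1)" by (simp only: M_plus_q)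
  thus ?thesis by (simp add: algebra_simps power2_eq_square power3_eq_cube)
qed

definition C :: "'k point set" where
  "C = {(x, y, z). y ^ (q + 1) = x ^ q + x \<and> z ^ M = y ^ (q\<^sup>2) - y}"

lemma frob_diff: "(x - y :: 'k) ^ q = x ^ q - y ^ q"
  using frob[of "x - y" y] by (simp add: algebra_simps)

lemma frob2_diff: "(x - y :: 'k) ^ (q\<^sup>2) = x ^ (q\<^sup>2) - y ^ (q\<^sup>2)"
  by (simp add: power2_eq_square power_mult frob_diff)

text \<open>
  The derivative of \<open>X\<^sup>q + X - a\<close> is the constant 1.
\<close>

lemma card_x: "card {x::'k. x ^ q + x = a} = q"
proof -
  let ?p = "monom 1 q + monom 1 1 - [:a:] :: 'k poly"
  have deg: "degree ?p = q"
    using q2 by (intro antisym degree_le le_degree) (auto simp: coeff_pCons split: nat.splits)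
  have "card {x. poly ?p x = 0} = degree ?p"
  proof (rule card_roots_separable)
    show "?p \<noteq> 0" using deg q2 by (metis degree_0 not_numeral_le_zero)
    show "poly (pderiv ?p) x \<noteq> 0" for x
      using char_q by (simp add: pderiv_diff pderiv_add pderiv_monom pderiv_pCons)
  qed
  moreover have "{x. poly ?p x = 0} = {x. x ^ q + x = a}"
    by (simp add: poly_monom)
  ultimately show ?thesis using deg by simp
qed

lemma card_y: "card {y::'k. y ^ (q\<^sup>2) - y = b} = q\<^sup>2"
proof -
  let ?p = "monom 1 (q\<^sup>2) - monom 1 1 - [:b:] :: 'k poly"
  have "q\<^sup>2 > 1" using q2 one_less_power[of q 2] by simp
  hence deg: "degree ?p = q\<^sup>2"
    by (intro antisym degree_le le_degree) (auto simp: coeff_pCons split: nat.splits)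
  have "card {x. poly ?p x = 0} = degree ?p"
  proof (rule card_roots_separable)
    show "?p \<noteq> 0" using deg q2 by (metis degree_0 not_numeral_le_zero power_not_zero zero_eq_power2)
    show "poly (pderiv ?p) x \<noteq> 0" for x
      using char_q by (simp add: pderiv_diff pderiv_add pderiv_monom pderiv_pCons of_nat_power q2)
  qed
  moreover have "{x. poly ?p x = 0} = {y. y ^ (q\<^sup>2) - y = b}"
    by (simp add: poly_monom)
  ultimately show ?thesis using deg by simp
qed

text \<open>
  The weights of \<open>x\<close>, \<open>y\<close>, \<open>z\<close> are their pole orders at the point at infinity.
\<close>

definition wt :: "nat \<times> nat \<times> nat \<Rightarrow> nat" where
  "wt e = fst e * (q ^ 3 + 1) + fst (snd e) * (q * M) + snd (snd e) * q ^ 3"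

text \<open>
  Exponents of a vector space basis of the coordinate ring; the monomials \<open>x\<^sup>i y\<^sup>j\<close> that occur form a
  basis over the polynomials in \<open>z\<close>.
\<close>

definition Reduced :: "(nat \<times> nat \<times> nat) set" where
  "Reduced = {(i, j, k). i < q \<and> j < q\<^sup>2}"

definition Red_below :: "nat \<Rightarrow> (nat \<times> nat \<times> nat) set" where
  "Red_below T = {e \<in> Reduced. wt e < T}"

text \<open>
  The functions that agree on the curve with a combination of reduced monomials of weight less than
  \<open>T\<close>; the strict bound makes \<open>Filt 0\<close> the functions vanishing on the curve.
\<close>

definition Filt :: "nat \<Rightarrow> 'k point_fun set" where
  "Filt T = {f. \<exists>c. \<forall>p\<in>C. f p = (\<Sum>e\<in>Red_below T. c e * mon e p)}"

lemma finite_Red_below [simp, intro]: "finite (Red_below T)"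
proof -
  have "Red_below T \<subseteq> {..<q} \<times> {..<q\<^sup>2} \<times> {..<T}"
  proof
    fix e assume e: "e \<in> Red_below T"
    obtain i j k where ijk: "e = (i,j,k)" by (cases e)
    have "k * 1 \<le> k * q^3" using q2 by (intro mult_le_mono2) simp
    also have "\<dots> < T" using e by (simp add: ijk Red_below_def wt_def)
    finally show "e \<in> {..<q} \<times> {..<q\<^sup>2} \<times> {..<T}"
      using e by (simp add: ijk Red_below_def Reduced_def)
  qed
  thus ?thesis by (rule finite_subset) simp
qed

lemma wt_add: "wt (i + i', j + j', k + k') = wt (i, j, k) + wt (i', j', k')"
  by (simp add: wt_def algebra_simps)

text \<open>
  Modulo \<open>q\<^sup>3\<close> the weight is \<open>i - j q (q - 1)\<close>, which determines \<open>i\<close> modulo \<open>q\<close> and then, as \<open>q - 1\<close>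
  is a unit, \<open>j\<close> modulo \<open>q\<^sup>2\<close>.
\<close>

lemma weight_residue_inj:
  assumes "i < q" "j < q\<^sup>2" "i' < q" "j' < q\<^sup>2"
    and "[i * (q ^ 3 + 1) + j * (q * M) = i' * (q ^ 3 + 1) + j' * (q * M)] (mod q ^ 3)"
  shows "i = i' \<and> j = j'"
proof -
  have "[int i * (q ^ 3 + 1) + j * (q * M) = int i' * (q ^ 3 + 1) + j' * (q * M)] (mod (int q) ^ 3)"
    using assms(5) by (simp flip: cong_int_iff add: algebra_simps)
  hence 1: "(int q) ^ 3 dvd (int i - int i') * (q ^ 3 + 1) + (int j - int j') * (q * M)"
    by (simp add: cong_iff_dvd_diff algebra_simps)
  have MM: "int M = (int q)\<^sup>2 - int q + 1" using arg_cong[OF M_plus_q, of int] by simp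
  have 2: "(int q) ^ 3 dvd (int i - int i') - (int j - int j') * (int q * (int q - 1))"
  proof -
    have "(int i - int i') * (q ^ 3 + 1) + (int j - int j') * (q * M)
       = ((int i - int i') - (int j - int j') * (int q * (int q - 1)))
        + (int q) ^ 3 * ((int i - int i') + (int j - int j'))"
      by (simp add: MM algebra_simps power2_eq_square power3_eq_cube)
    thus ?thesis using 1 by (simp only: dvd_add_left_iff[OF dvd_triv_left])
  qed
  have "int q dvd int q ^ 3" by simp
  hence "int q dvd (int i - int i') - (int j - int j') * (int q * (int q - 1))"
    using 2 dvd_trans by blast
  moreover have "int q dvd (int j - int j') * (int q * (int q - 1))" by simp
  ultimately have "int q dvd (int i - int i' - (int j - int j') * (int q * (int q - 1)))
      + (int j - int j') * (int q * (int q - 1))" by (rule dvd_add)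
  hence "int q dvd (int i - int i')" by simp
  hence i: "i = i'" using assms(1,3) dvd_imp_le_int[of "int i - int i'" "int q"] by linarith
  hence "(int q) * (int q)\<^sup>2 dvd int q * ((int j - int j') * (int q - 1))"
    using 2 by (simp add: power2_eq_square power3_eq_cube algebra_simps dvd_diff_commute)
  hence "(int q)\<^sup>2 dvd (int j - int j') * (int q - 1)" using q2 by simp
  moreover have "coprime ((int q)\<^sup>2) (int q - 1)"
    by (metis coprime_commute coprime_diff_one_left coprime_power_right_iff)
  ultimately have "(int q)\<^sup>2 dvd (int j - int j')" by (simp add: coprime_dvd_mult_left_iff)
  hence "int (q\<^sup>2) dvd (int j - int j')" by simp
  hence "j = j'" using assms(2,4) dvd_imp_le_int[of "int j - int j'" "int (q\<^sup>2)"] by linarith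
  with i show ?thesis by simp
qed

lemma wt_inj: "e \<in> Reduced \<Longrightarrow> e' \<in> Reduced \<Longrightarrow> wt e = wt e' \<Longrightarrow> e = e'"
proof -
  assume e: "e \<in> Reduced" "e' \<in> Reduced" "wt e = wt e'"
  obtain i j k i' j' k' where [simp]: "e = (i,j,k)" "e' = (i',j',k')" by (cases e; cases e')
  have "[i * (q ^ 3 + 1) + j * (q * M) + k * q^3 = i' * (q ^ 3 + 1) + j' * (q * M) + k' * q^3] (mod q ^ 3)"
    using e(3) by (simp add: wt_def)
  hence "[i * (q ^ 3 + 1) + j * (q * M) = i' * (q ^ 3 + 1) + j' * (q * M)] (mod q ^ 3)"
    by (simp only: cong_def mod_mult_self3 mod_mult_self1)
  hence "i = i' \<and> j = j'" using e by (intro weight_residue_inj) (auto simp: Reduced_def)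
  thus "e = e'" using e(3) q2 by (simp add: wt_def)
qed

text \<open>
  For each of the \<open>q\<^sup>2\<close> admissible values of \<open>y\<close> there are \<open>q\<close> values of \<open>x\<close>, so the degrees in \<open>x\<close>
  and \<open>y\<close> are too small for a nontrivial relation on a fibre.
\<close>

lemma box_zero:
  assumes "\<And>x y. (x, y, z) \<in> C \<Longrightarrow> (\<Sum>i<q. (\<Sum>j<q\<^sup>2. d i j * y ^ j) * x ^ i) = (0::'k)" "i < q" "j < q\<^sup>2"
  shows "d i j = 0"
proof (rule powers_independent[where A = "{y. y ^ (q\<^sup>2) - y = z ^ M}" and n = "q\<^sup>2" and i = j and a = "d i"])
  fix y assume y: "y \<in> {y. y ^ (q\<^sup>2) - y = z ^ M}"
  show "(\<Sum>j<q\<^sup>2. d i j * y ^ j) = 0"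
    by (rule powers_independent[where A = "{x. x ^ q + x = y ^ (q+1)}" and n = q and i = i and a = "\<lambda>i. \<Sum>j<q\<^sup>2. d i j * y ^ j"])
      (use y assms card_x[of "y ^ (q+1)"] in \<open>auto simp: C_def\<close>)
qed (use assms card_y[of "z ^ M"] in auto)

lemma mon_independent:
  assumes S: "finite S" "S \<subseteq> Reduced" and z: "\<And>p. p \<in> C \<Longrightarrow> (\<Sum>e\<in>S. c e * mon e p) = (0::'k)" and e: "e \<in> S"
  shows "c e = 0"
proof -
  define c' where "c' i j k = (if (i,j,k) \<in> S then c (i,j,k) else 0)" for i j k
  obtain N where N: "\<And>i j k. (i,j,k) \<in> S \<Longrightarrow> k < N"
  proof -
    have "finite ((snd \<circ> snd) ` S)" using S by simp
    then obtain N where "\<forall>n\<in>(snd \<circ> snd) ` S. n < N"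
      using finite_nat_set_iff_bounded by metis
    thus ?thesis using that by force
  qed
  have sum: "(\<Sum>i<q. (\<Sum>j<q\<^sup>2. (\<Sum>k<N. c' i j k * z ^ k) * y ^ j) * x ^ i) = 0"
    if "z ^ M = y ^ (q\<^sup>2) - y" "x ^ q + x = y ^ (q+1)" for x y z :: 'k
  proof -
    have p: "(x,y,z) \<in> C" using that by (simp add: C_def)
    have "(\<Sum>i<q. (\<Sum>j<q\<^sup>2. (\<Sum>k<N. c' i j k * z ^ k) * y ^ j) * x ^ i)
        = (\<Sum>i<q. \<Sum>j<q\<^sup>2. \<Sum>k<N. c' i j k * (x ^ i * y ^ j * z ^ k))"
      by (simp add: sum_distrib_right sum_distrib_left mult_ac)
    also have "\<dots> = (\<Sum>(i,j,k)\<in>{..<q}\<times>{..<q\<^sup>2}\<times>{..<N}. c' i j k * (x ^ i * y ^ j * z ^ k))"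
      by (simp add: sum.cartesian_product)
    also have "\<dots> = (\<Sum>e\<in>S. c e * mon e (x,y,z))"
    proof (rule sum.mono_neutral_cong_right)
      show "S \<subseteq> {..<q}\<times>{..<q\<^sup>2}\<times>{..<N}" using S(2) N by (auto simp: Reduced_def)
    qed (auto simp: c'_def)
    finally show ?thesis using z[OF p] by simp
  qed
  have 2: "(\<Sum>k<N. c' i j k * z ^ k) = 0" if "i < q" "j < q\<^sup>2" for i j z
  proof (rule box_zero[where d = "\<lambda>i j. \<Sum>k<N. c' i j k * z ^ k" and z = z, OF _ that])
    fix x y assume "(x, y, z) \<in> C"
    hence "z ^ M = y ^ (q\<^sup>2) - y" "x ^ q + x = y ^ (q+1)" by (auto simp: C_def)
    thus "(\<Sum>i<q. (\<Sum>j<q\<^sup>2. (\<Sum>k<N. c' i j k * z ^ k) * y ^ j) * x ^ i) = 0" by (rule sum)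
  qed
  have 3: "c' i j k = 0" if "i < q" "j < q\<^sup>2" "k < N" for i j k
    by (rule powers_independent[where A = "UNIV :: 'k set" and n = N and i = k and a = "\<lambda>k. c' i j k"])
      (use that 2 infinite_alg_closed[where ?'k='k] in auto)
  obtain i j k where e': "e = (i,j,k)" by (cases e)
  have "c' i j k = 0" using e e' S(2) N by (intro 3) (auto simp: Reduced_def)
  thus ?thesis using e e' by (simp add: c'_def)
qed

lemma Filt_cong: "f \<in> Filt T \<Longrightarrow> (\<And>p. p \<in> C \<Longrightarrow> g p = f p) \<Longrightarrow> g \<in> Filt T"
  unfolding Filt_def by auto

lemma Red_below_mono: "S \<le> T \<Longrightarrow> Red_below S \<subseteq> Red_below T"
  by (auto simp: Red_below_def)

lemma Filt_mono: "S \<le> T \<Longrightarrow> f \<in> Filt S \<Longrightarrow> f \<in> Filt T"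
proof -
  assume ST: "S \<le> T" and "f \<in> Filt S"
  then obtain c where c: "\<forall>p\<in>C. f p = (\<Sum>e\<in>Red_below S. c e * mon e p)" by (auto simp: Filt_def)
  have "(\<Sum>e\<in>Red_below S. c e * mon e p) = (\<Sum>e\<in>Red_below T. (if e \<in> Red_below S then c e else 0) * mon e p)" for p
    using Red_below_mono[OF ST] by (intro sum.mono_neutral_cong_left) auto
  thus "f \<in> Filt T" using c unfolding Filt_def by (intro CollectI exI[of _ "\<lambda>e. if e \<in> Red_below S then c e else 0"]) simp
qed

lemma Filt_0: "(\<lambda>p. 0) \<in> Filt T"
  unfolding Filt_def by (auto intro!: exI[of _ "\<lambda>_. 0"])

lemma Filt_add: "f \<in> Filt T \<Longrightarrow> g \<in> Filt T \<Longrightarrow> (\<lambda>p. f p + g p) \<in> Filt T"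
proof -
  assume "f \<in> Filt T" "g \<in> Filt T"
  then obtain c d where "\<forall>p\<in>C. f p = (\<Sum>e\<in>Red_below T. c e * mon e p)" "\<forall>p\<in>C. g p = (\<Sum>e\<in>Red_below T. d e * mon e p)"
    by (auto simp: Filt_def)
  thus ?thesis unfolding Filt_def
    by (intro CollectI exI[of _ "\<lambda>e. c e + d e"]) (simp add: sum.distrib distrib_right)
qed

lemma Filt_scale: "f \<in> Filt T \<Longrightarrow> (\<lambda>p. a * f p) \<in> Filt T"
proof -
  assume "f \<in> Filt T"
  then obtain c where "\<forall>p\<in>C. f p = (\<Sum>e\<in>Red_below T. c e * mon e p)"
    by (auto simp: Filt_def)
  thus ?thesis unfolding Filt_def
    by (intro CollectI exI[of _ "\<lambda>e. a * c e"]) (simp add: sum_distrib_left mult.assoc)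
qed

lemma Filt_diff: "f \<in> Filt T \<Longrightarrow> g \<in> Filt T \<Longrightarrow> (\<lambda>p. f p - g p) \<in> Filt T"
  using Filt_add[OF _ Filt_scale[of g T "-1"]] by simp

lemma Filt_sum: "(\<And>i. i \<in> I \<Longrightarrow> f i \<in> Filt T) \<Longrightarrow> (\<lambda>p. \<Sum>i\<in>I. f i p) \<in> Filt T"
  by (induction I rule: infinite_finite_induct) (auto simp: Filt_0 intro: Filt_add)

lemma mon_Filt_Red: "e \<in> Red_below T \<Longrightarrow> mon e \<in> Filt T"
  unfolding Filt_def by (intro CollectI exI[of _ "\<lambda>e'. if e' = e then 1 else 0"])
    (auto simp: if_distrib[of "\<lambda>c. c * _"] cong: if_cong)

text \<open>
  On the curve \<open>x\<^sup>q = y\<^sup>q\<^sup>+\<^sup>1 - x\<close> and \<open>y\<^bsup>q\<^sup>2\<^esup> = z\<^sup>M + y\<close>, and in both equations the first term on the right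
  has the weight of the left hand side and the second one a smaller weight. Rewriting with the first
  equation lowers the exponent of \<open>x\<close>, and with the second one the exponent of \<open>y\<close> while keeping that
  of \<open>x\<close>.
\<close>

lemma mon_reduce: "\<exists>e0\<in>Reduced. wt e0 = wt e \<and> (\<lambda>p. mon e p - mon e0 p) \<in> Filt (wt e)"
proof -
  have lower: "f \<in> Filt T" if "e0 \<in> Reduced" "wt e0 = w" "(\<lambda>p. f p - mon e0 p) \<in> Filt w" "w < T" for f e0 w T
  proof -
    have "(\<lambda>p. (f p - mon e0 p) + mon e0 p) \<in> Filt T"
      using that by (intro Filt_add Filt_mono[OF _ that(3)] mon_Filt_Red) (auto simp: Red_below_def)
    thus ?thesis by simp
  qed
  have "\<exists>e0\<in>Reduced. wt e0 = wt (i,j,k) \<and> (\<lambda>p. mon (i,j,k) p - mon e0 p) \<in> Filt (wt (i,j,k))" for i j k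
  proof (induction i arbitrary: j k rule: less_induct)
    case (less i)
    note IHi = less.IH
    show ?case
    proof (cases "i < q")
      case False
      then obtain i' where i: "i = i' + q" using le_Suc_ex by (metis add.commute not_less)
      have w1: "wt (i', j + (q + 1), k) = wt (i,j,k)"
      proof -
        have "(q + 1) * (q * M) = q * (q ^ 3 + 1)" by (simp only: M_factor[symmetric] mult_ac)
        thus ?thesis by (simp only: wt_def i add_mult_distrib fst_conv snd_conv)
      qed
      have w2: "wt (i' + 1, j, k) < wt (i,j,k)"
      proof -
        have "(i' + 1) * (q ^ 3 + 1) < (i' + q) * (q ^ 3 + 1)"
          using q2 by (intro mult_strict_right_mono) auto
        thus ?thesis by (simp add: wt_def i del: mult_Suc)
      qed
      obtain e0 where e0: "e0 \<in> Reduced" "wt e0 = wt (i,j,k)"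
          "(\<lambda>p. mon (i', j + (q + 1), k) p - mon e0 p) \<in> Filt (wt (i,j,k))"
        using IHi[of i' "j + (q+1)" k] w1 q2 i by auto
      have "\<exists>e1\<in>Reduced. wt e1 = wt (i'+1,j,k) \<and> (\<lambda>p. mon (i'+1,j,k) p - mon e1 p) \<in> Filt (wt (i'+1,j,k))"
        using IHi[of "i'+1" j k] q2 i by auto
      hence m1: "mon (i'+1, j, k) \<in> Filt (wt (i,j,k))" using lower w2 by blast
      have "(\<lambda>p. (mon (i', j + (q + 1), k) p - mon e0 p) - mon (i'+1, j, k) p) \<in> Filt (wt (i,j,k))"
        using e0(3) m1 by (rule Filt_diff)
      hence "(\<lambda>p. mon (i,j,k) p - mon e0 p) \<in> Filt (wt (i,j,k))"
      proof (rule Filt_cong)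
        fix p :: "'k point" assume p: "p \<in> C"
        obtain x y z where xyz: "p = (x,y,z)" by (cases p)
        have "y ^ (q+1) = x ^ q + x" using p xyz by (simp add: C_def)
        hence "x ^ i' * y ^ j * y ^ (q+1) * z ^ k = x ^ i' * y ^ j * (x ^ q + x) * z ^ k" by simp
        thus "mon (i, j, k) p - mon e0 p = mon (i', j + (q + 1), k) p - mon e0 p - mon (i' + 1, j, k) p"
          by (simp add: xyz i power_add algebra_simps)
      qed
      with e0 show ?thesis by blast
    next
      case iq: True
      show ?thesis
      proof (induction j arbitrary: k rule: less_induct)
        case (less j)
        note IHj = less.IH
        show ?case
        proof (cases "j < q\<^sup>2")
          case True
          with iq show ?thesis by (intro bexI[of _ "(i,j,k)"]) (auto simp: Reduced_def Filt_0)
        next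
          case False
          then obtain j' where j: "j = j' + q\<^sup>2" using le_Suc_ex by (metis add.commute not_less)
          have qq: "q\<^sup>2 > 1" using q2 one_less_power[of q 2] by simp
          have w1: "wt (i, j', k + M) = wt (i,j,k)"
            by (simp add: wt_def j algebra_simps power2_eq_square power3_eq_cube)
          have w2: "wt (i, j' + 1, k) < wt (i,j,k)"
          proof -
            have "(j' + 1) * (q * M) < (j' + q\<^sup>2) * (q * M)" using qq q2 M_pos by (intro mult_strict_right_mono) auto
            thus ?thesis by (simp add: wt_def j del: mult_Suc)
          qed
          obtain e0 where e0: "e0 \<in> Reduced" "wt e0 = wt (i,j,k)"
              "(\<lambda>p. mon (i, j', k + M) p - mon e0 p) \<in> Filt (wt (i,j,k))"
            using IHj[of j' "k + M"] w1 q2 j by auto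
          have "\<exists>e1\<in>Reduced. wt e1 = wt (i,j'+1,k) \<and> (\<lambda>p. mon (i,j'+1,k) p - mon e1 p) \<in> Filt (wt (i,j'+1,k))"
            using IHj[of "j'+1" k] qq j by (simp del: One_nat_def)
          hence m1: "mon (i, j'+1, k) \<in> Filt (wt (i,j,k))" using lower w2 by blast
          have "(\<lambda>p. (mon (i, j', k + M) p - mon e0 p) + mon (i, j'+1, k) p) \<in> Filt (wt (i,j,k))"
            using e0(3) m1 by (rule Filt_add)
          hence "(\<lambda>p. mon (i,j,k) p - mon e0 p) \<in> Filt (wt (i,j,k))"
          proof (rule Filt_cong)
            fix p :: "'k point" assume p: "p \<in> C"
            obtain x y z where xyz: "p = (x,y,z)" by (cases p)
            have "z ^ M = y ^ (q\<^sup>2) - y" using p xyz by (simp add: C_def)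
            hence "x ^ i * y ^ j' * z ^ k * z ^ M = x ^ i * y ^ j' * z ^ k * (y ^ (q\<^sup>2) - y)" by simp
            thus "mon (i, j, k) p - mon e0 p = mon (i, j', k + M) p - mon e0 p + mon (i, j' + 1, k) p"
              by (simp add: xyz j power_add algebra_simps)
          qed
          with e0 show ?thesis by blast
        qed
      qed
    qed
  qed
  from this[of "fst e" "fst (snd e)" "snd (snd e)"] show ?thesis by simp
qed

lemma mon_Filt: "wt e < T \<Longrightarrow> mon e \<in> Filt T"
proof -
  assume T: "wt e < T"
  obtain e0 where e0: "e0 \<in> Reduced" "wt e0 = wt e" "(\<lambda>p. mon e p - mon e0 p) \<in> Filt (wt e)"
    using mon_reduce by blast
  have "(\<lambda>p. (mon e p - mon e0 p) + mon e0 p) \<in> Filt T"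
    using e0 T by (intro Filt_add Filt_mono[OF _ e0(3)] mon_Filt_Red) (auto simp: Red_below_def)
  thus ?thesis by simp
qed

lemma Filt_mult:
  assumes "f \<in> Filt (Suc S)" "g \<in> Filt T"
  shows "(\<lambda>p. f p * g p) \<in> Filt (S + T)"
proof -
  obtain c d where c: "\<And>p. p \<in> C \<Longrightarrow> f p = (\<Sum>e\<in>Red_below (Suc S). c e * mon e p)"
    and d: "\<And>p. p \<in> C \<Longrightarrow> g p = (\<Sum>e\<in>Red_below T. d e * mon e p)"
    using assms by (auto simp: Filt_def)
  define pl where "pl e e' = (fst e + fst e', fst (snd e) + fst (snd e'), snd (snd e) + snd (snd e'))" 
    for e e' :: "nat \<times> nat \<times> nat"
  have pl: "mon (pl e e') p = mon e p * mon e' p" for e e' and p :: "'k point"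
    by (simp add: pl_def mon_altdef power_add algebra_simps)
  have "(\<lambda>p. \<Sum>e\<in>Red_below (Suc S). \<Sum>e'\<in>Red_below T. (c e * d e') * mon (pl e e') p) \<in> Filt (S + T)"
  proof (intro Filt_sum Filt_scale mon_Filt)
    fix e e' assume "e \<in> Red_below (Suc S)" "e' \<in> Red_below T"
    thus "wt (pl e e') < S + T" by (auto simp: Red_below_def pl_def wt_add)
  qed
  thus ?thesis
  proof (rule Filt_cong)
    fix p assume p: "p \<in> C"
    show "f p * g p = (\<Sum>e\<in>Red_below (Suc S). \<Sum>e'\<in>Red_below T. (c e * d e') * mon (pl e e') p)"
      unfolding c[OF p] d[OF p] sum_product by (simp add: pl mult_ac)
  qed
qed

lemma polyfuns_Filt:
  assumes "f \<in> polyfuns UNIV" shows "\<exists>T. f \<in> Filt T"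
  using assms
proof induction
  case (const c)
  have "(\<lambda>p. c * mon (0,0,0) p) \<in> Filt (Suc (wt (0,0,0)))" by (intro Filt_scale mon_Filt) simp
  thus ?case by (auto simp: mon_0)
next
  case X
  have "(\<lambda>p. fst p) \<in> Filt (Suc (wt (1,0,0)))"
    by (rule Filt_cong[OF mon_Filt[of "(1,0,0)"]]) (simp_all add: mon_altdef)
  thus ?case by (rule exI)
next
  case Y
  have "(\<lambda>p. yc p) \<in> Filt (Suc (wt (0,1,0)))"
    by (rule Filt_cong[OF mon_Filt[of "(0,1,0)"]]) (simp_all add: mon_altdef)
  thus ?case by (rule exI)
next
  case Z
  have "(\<lambda>p. zc p) \<in> Filt (Suc (wt (0,0,1)))"
    by (rule Filt_cong[OF mon_Filt[of "(0,0,1)"]]) (simp_all add: mon_altdef)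
  thus ?case by (rule exI)
next
  case (add f g)
  then obtain S T where "f \<in> Filt S" "g \<in> Filt T" by blast
  hence "f \<in> Filt (max S T)" "g \<in> Filt (max S T)" using Filt_mono by (metis max.cobounded1, metis max.cobounded2)
  thus ?case using Filt_add by blast
next
  case (mult f g)
  then obtain S T where "f \<in> Filt S" "g \<in> Filt T" by blast
  hence "f \<in> Filt (Suc S)" "g \<in> Filt T" using Filt_mono[of S "Suc S"] by auto
  thus ?case using Filt_mult by blast
qed

end

section \<open>Leading weights and dimension counts\<close>

text \<open>
  Gaussian elimination: with a pivot in column \<open>j0\<close>, clear that column and remove the pivot row.
\<close>

lemma exists_dependency:
  fixes a :: "'i \<Rightarrow> 'j \<Rightarrow> 'k::field"
  assumes "finite J" "finite I" "card J < card I"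
  shows "\<exists>u. (\<exists>i\<in>I. u i \<noteq> 0) \<and> (\<forall>j\<in>J. (\<Sum>i\<in>I. u i * a i j) = 0)"
  using assms
proof (induction J arbitrary: I a rule: finite_induct)
  case empty
  then obtain i where "i \<in> I" by (metis card.empty less_irrefl all_not_in_conv)
  thus ?case by (intro exI[of _ "\<lambda>_. 1"]) auto
next
  case (insert j0 J)
  show ?case
  proof (cases "\<forall>i\<in>I. a i j0 = 0")
    case True
    have "card J < card I" using insert by simp
    from insert.IH[OF insert.prems(1) this, of a] True show ?thesis by auto
  next
    case False
    then obtain i0 where i0: "i0 \<in> I" "a i0 j0 \<noteq> 0" by auto
    define t where "t i = a i j0 / a i0 j0" for i
    have "card J < card (I - {i0})" using insert i0 by simp
    with insert.IH[of "I - {i0}" "\<lambda>i j. a i j - t i * a i0 j"] insert.prems(1)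
    obtain u where u: "\<exists>i\<in>I - {i0}. u i \<noteq> 0"
       "\<And>j. j \<in> J \<Longrightarrow> (\<Sum>i\<in>I - {i0}. u i * (a i j - t i * a i0 j)) = 0" by auto
    define u' where "u' i = (if i = i0 then - (\<Sum>i\<in>I - {i0}. u i * t i) else u i)" for i
    have eq: "(\<Sum>i\<in>I. u' i * a i j) = (\<Sum>i\<in>I - {i0}. u i * (a i j - t i * a i0 j))" for j
    proof -
      have "(\<Sum>i\<in>I. u' i * a i j) = u' i0 * a i0 j + (\<Sum>i\<in>I - {i0}. u' i * a i j)"
        using insert.prems(1) i0(1) by (rule sum.remove)
      also have "(\<Sum>i\<in>I - {i0}. u' i * a i j) = (\<Sum>i\<in>I - {i0}. u i * a i j)"
        by (intro sum.cong) (auto simp: u'_def)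
      finally show ?thesis
        by (simp add: u'_def sum_distrib_right right_diff_distrib sum_subtractf mult.assoc)
    qed
    have "(\<Sum>i\<in>I. u' i * a i j) = 0" if "j \<in> insert j0 J" for j
    proof (cases "j = j0")
      case True
      thus ?thesis unfolding eq using i0(2) by (intro sum.neutral) (auto simp: t_def)
    next
      case False
      thus ?thesis using that u(2) by (simp add: eq)
    qed
    moreover have "\<exists>i\<in>I. u' i \<noteq> 0" using u(1) by (auto simp: u'_def)
    ultimately show ?thesis by blast
  qed
qed

lemma polyfuns_sum: "0 \<in> S \<Longrightarrow> (\<And>i. i \<in> I \<Longrightarrow> f i \<in> polyfuns S) \<Longrightarrow> (\<lambda>p. \<Sum>i\<in>I. f i p) \<in> polyfuns S"
  by (induction I rule: infinite_finite_induct) (auto intro: polyfuns.intros)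

lemma polyfuns_prod: "1 \<in> S \<Longrightarrow> (\<And>i. i \<in> I \<Longrightarrow> f i \<in> polyfuns S) \<Longrightarrow> (\<lambda>p. \<Prod>i\<in>I. f i p) \<in> polyfuns S"
  by (induction I rule: infinite_finite_induct) (auto intro: polyfuns.intros)

lemma polyfuns_power: "1 \<in> S \<Longrightarrow> f \<in> polyfuns S \<Longrightarrow> (\<lambda>p. f p ^ n) \<in> polyfuns S"
  by (induction n) (auto intro: polyfuns.intros)

lemma polyfuns_diff: "-1 \<in> S \<Longrightarrow> f \<in> polyfuns S \<Longrightarrow> g \<in> polyfuns S \<Longrightarrow> (\<lambda>p. f p - g p) \<in> polyfuns S"
  using polyfuns.add[OF _ polyfuns.mult[OF polyfuns.const[of "-1" S]], of f g] by simp

lemma polyfuns_mon: "1 \<in> S \<Longrightarrow> mon e \<in> polyfuns S"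
proof -
  assume "1 \<in> S"
  hence "(\<lambda>p. fst p ^ fst e * yc p ^ fst (snd e) * zc p ^ snd (snd e)) \<in> polyfuns S"
    by (intro polyfuns.mult polyfuns_power polyfuns.X polyfuns.Y polyfuns.Z)
  thus ?thesis by (simp add: mon_altdef[abs_def])
qed

lemma polyfuns_poly: "(\<lambda>P. poly p (zc P)) \<in> polyfuns UNIV"
proof (induction p)
  case 0 show ?case by (auto intro: polyfuns.const)
next
  case (pCons a p)
  have "(\<lambda>P. a + zc P * poly p (zc P)) \<in> polyfuns UNIV"
    using pCons by (intro polyfuns.intros) auto
  thus ?case by simp
qed

text \<open>
  A product of affine-linear functions in one coordinate, one for each other point.
\<close>

lemma interpolator_exists:
  fixes P :: "'k::field point"
  assumes "finite S"
  shows "\<exists>E\<in>polyfuns UNIV. E P = 1 \<and> (\<forall>Q\<in>S - {P}. E Q = 0)"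
proof -
  have "\<exists>l\<in>polyfuns UNIV. l P = 1 \<and> l Q = 0" if "Q \<noteq> P" for Q
  proof -
    have lin: "\<exists>l\<in>polyfuns UNIV. l P = 1 \<and> l Q = 0" if "g \<in> polyfuns UNIV" "g P \<noteq> g Q" for g
    proof (intro bexI conjI)
      show "(\<lambda>p. inverse (g P - g Q) * (g p - g Q)) \<in> polyfuns UNIV"
        by (intro polyfuns.mult polyfuns_diff polyfuns.const that(1)) auto
    qed (use that in auto)
    have "fst P \<noteq> fst Q \<or> yc P \<noteq> yc Q \<or> zc P \<noteq> zc Q"
      using that by (auto simp: prod_eq_iff)
    thus ?thesis using lin[OF polyfuns.X] lin[OF polyfuns.Y] lin[OF polyfuns.Z] by blast
  qed
  then obtain l where l: "\<And>Q. Q \<noteq> P \<Longrightarrow> l Q \<in> polyfuns UNIV \<and> l Q P = 1 \<and> l Q Q = 0" by metis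
  show ?thesis
  proof (intro bexI conjI ballI)
    show "(\<lambda>p. \<Prod>Q\<in>S - {P}. l Q p) \<in> polyfuns UNIV" using l by (intro polyfuns_prod) auto
    show "(\<Prod>Q\<in>S - {P}. l Q P) = 1" using l by simp
    show "(\<Prod>Q\<in>S - {P}. l Q R) = 0" if "R \<in> S - {P}" for R
      using that l[of R] assms by (intro prod_zero bexI[of _ R]) auto
  qed
qed

context gk_curve
begin

abbreviation R :: "'k point_fun set" where "R \<equiv> polyfuns UNIV"

text \<open>
  Being nonzero in the coordinate ring.
\<close>

definition nz :: "'k point_fun \<Rightarrow> bool" where
  "nz f \<longleftrightarrow> (\<exists>p\<in>C. f p \<noteq> 0)"

text \<open>
  For a polynomial function \<open>f\<close>, \<open>w\<close> turns out to be the pole order at the point at infinity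
  (\<open>valuation_pinf\<close>).
\<close>

definition lead :: "'k point_fun \<Rightarrow> nat \<Rightarrow> bool" where
  "lead f w \<longleftrightarrow> (\<exists>a e. a \<noteq> 0 \<and> e \<in> Reduced \<and> wt e = w \<and> (\<lambda>p. f p - a * mon e p) \<in> Filt w)"

lemma lead_exists:
  assumes "f \<in> Filt T" "nz f"
  shows "\<exists>w<T. lead f w"
proof -
  obtain c where c: "\<And>p. p \<in> C \<Longrightarrow> f p = (\<Sum>e\<in>Red_below T. c e * mon e p)"
    using assms by (auto simp: Filt_def)
  let ?S = "{e \<in> Red_below T. c e \<noteq> 0}"
  have ne: "?S \<noteq> {}"
  proof
    assume "?S = {}"
    hence "\<And>p. p \<in> C \<Longrightarrow> f p = 0" using c by (auto intro!: sum.neutral)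
    thus False using assms(2) by (auto simp: nz_def)
  qed
  have fin: "finite ?S" by simp
  obtain e where e: "e \<in> ?S" "\<And>e'. e' \<in> ?S \<Longrightarrow> wt e' \<le> wt e"
  proof -
    have "Max (wt ` ?S) \<in> wt ` ?S" using ne fin by (intro Max_in) blast+
    then obtain e where "e \<in> ?S" "wt e = Max (wt ` ?S)" by auto
    thus ?thesis using that fin by simp
  qed
  have "(\<lambda>p. f p - c e * mon e p) \<in> Filt (wt e)"
  proof -
    have "(\<lambda>p. \<Sum>e'\<in>?S - {e}. c e' * mon e' p) \<in> Filt (wt e)"
    proof (intro Filt_sum Filt_scale mon_Filt)
      fix e' assume e': "e' \<in> ?S - {e}"
      hence "wt e' \<le> wt e" using e by auto
      moreover have "wt e' \<noteq> wt e" using wt_inj[of e' e] e' e(1) by (auto simp: Red_below_def)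
      ultimately show "wt e' < wt e" by simp
    qed
    thus ?thesis
    proof (rule Filt_cong)
      fix p assume p: "p \<in> C"
      have "f p = (\<Sum>e\<in>?S. c e * mon e p)"
        unfolding c[OF p] by (intro sum.mono_neutral_right) auto
      also have "\<dots> = c e * mon e p + (\<Sum>e'\<in>?S - {e}. c e' * mon e' p)"
        using fin e(1) by (rule sum.remove)
      finally show "f p - c e * mon e p = (\<Sum>e'\<in>?S - {e}. c e' * mon e' p)" by simp
    qed
  qed
  thus ?thesis using e(1) unfolding lead_def Red_below_def by blast
qed

lemma mon_notin_Filt:
  assumes "e \<in> Reduced" "a \<noteq> 0" shows "(\<lambda>p. a * mon e p) \<notin> Filt (wt e)"
proof
  assume "(\<lambda>p. a * mon e p) \<in> Filt (wt e)"
  then obtain c where c: "\<And>p. p \<in> C \<Longrightarrow> a * mon e p = (\<Sum>e'\<in>Red_below (wt e). c e' * mon e' p)"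
    by (auto simp: Filt_def)
  let ?d = "\<lambda>e'. if e' = e then - a else c e'"
  have e: "e \<notin> Red_below (wt e)" by (simp add: Red_below_def)
  have "?d e = 0"
  proof (rule mon_independent[where S = "insert e (Red_below (wt e))" and c = ?d])
    show "finite (insert e (Red_below (wt e)))" by simp
    show "insert e (Red_below (wt e)) \<subseteq> Reduced" using assms by (auto simp: Red_below_def)
    fix p assume p: "p \<in> C"
    have "(\<Sum>e'\<in>Red_below (wt e). ?d e' * mon e' p) = (\<Sum>e'\<in>Red_below (wt e). c e' * mon e' p)"
      using e by (intro sum.cong) auto
    thus "(\<Sum>e'\<in>insert e (Red_below (wt e)). ?d e' * mon e' p) = 0" using c[OF p] e by simp
  qed simp
  thus False using assms by simp
qed

lemma lead_notin_Filt:
  assumes "lead f w" shows "f \<notin> Filt w"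
proof
  assume f: "f \<in> Filt w"
  from assms obtain a e where a: "a \<noteq> 0" "e \<in> Reduced" "wt e = w" "(\<lambda>p. f p - a * mon e p) \<in> Filt w"
    by (auto simp: lead_def)
  have "(\<lambda>p. f p - (f p - a * mon e p)) \<in> Filt w" using f a(4) by (rule Filt_diff)
  thus False using mon_notin_Filt[of e a] a by simp
qed

lemma lead_in_Filt: "lead f w \<Longrightarrow> w < T \<Longrightarrow> f \<in> Filt T"
proof -
  assume "lead f w" and w: "w < T"
  then obtain a e where a: "a \<noteq> 0" "e \<in> Reduced" "wt e = w" "(\<lambda>p. f p - a * mon e p) \<in> Filt w"
    by (auto simp: lead_def)
  have "(\<lambda>p. (f p - a * mon e p) + a * mon e p) \<in> Filt T"
    using w a(3) by (intro Filt_add Filt_scale mon_Filt Filt_mono[OF _ a(4)]) auto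
  thus ?thesis by simp
qed

lemma lead_Filt_iff: "lead f w \<Longrightarrow> f \<in> Filt T \<longleftrightarrow> w < T"
  using lead_in_Filt[of f w T] lead_notin_Filt[of f w] Filt_mono[of T w f] by linarith

lemma lead_unique: "lead f w \<Longrightarrow> lead f w' \<Longrightarrow> w = w'"
  using lead_Filt_iff[of f w "Suc w"] lead_Filt_iff[of f w' "Suc w"] lead_Filt_iff[of f w "Suc w'"] lead_Filt_iff[of f w' "Suc w'"]
  by simp

lemma lead_nz: assumes "lead f w" shows "nz f"
proof (rule ccontr)
  assume f: "\<not> nz f"
  have "f \<in> Filt w" by (rule Filt_cong[OF Filt_0]) (use f in \<open>auto simp: nz_def\<close>)
  thus False using assms lead_notin_Filt by blast
qed

lemma lead_cong:
  assumes "lead f w" "\<And>p. p \<in> C \<Longrightarrow> g p = f p"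
  shows "lead g w"
proof -
  obtain a e where a: "a \<noteq> 0" "e \<in> Reduced" "wt e = w" "(\<lambda>p. f p - a * mon e p) \<in> Filt w"
    using assms(1) by (auto simp: lead_def)
  have "(\<lambda>p. g p - a * mon e p) \<in> Filt w"
    using a(4) by (rule Filt_cong) (simp add: assms(2))
  with a show ?thesis unfolding lead_def by blast
qed

text \<open>
  The product of the two leading monomials reduces to a single reduced monomial of the same weight
  plus lower terms, so leading terms cannot cancel. In particular the coordinate ring is a domain.
\<close>

lemma lead_mult:
  assumes "lead f w" "lead g w'"
  shows "lead (\<lambda>p. f p * g p) (w + w')"
proof -
  obtain a e where a: "a \<noteq> 0" "e \<in> Reduced" "wt e = w" and f: "(\<lambda>p. f p - a * mon e p) \<in> Filt w"
    using assms(1) by (auto simp: lead_def)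
  obtain b e' where b: "b \<noteq> 0" "e' \<in> Reduced" "wt e' = w'" and g: "(\<lambda>p. g p - b * mon e' p) \<in> Filt w'"
    using assms(2) by (auto simp: lead_def)
  define d where "d = (fst e + fst e', fst (snd e) + fst (snd e'), snd (snd e) + snd (snd e'))"
  have d: "mon d p = mon e p * mon e' p" for p :: "'k point"
    by (simp add: d_def mon_altdef power_add algebra_simps)
  have wd: "wt d = w + w'" using a b by (simp add: d_def wt_add)
  obtain e0 where e0: "e0 \<in> Reduced" "wt e0 = w + w'" "(\<lambda>p. mon d p - mon e0 p) \<in> Filt (w + w')"
    using mon_reduce[of d] wd by auto
  have 1: "(\<lambda>p. (a * mon e p) * (g p - b * mon e' p)) \<in> Filt (w + w')"
    using a(3) g by (intro Filt_mult Filt_scale mon_Filt) auto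
  have 2: "(\<lambda>p. g p * (f p - a * mon e p)) \<in> Filt (w' + w)"
    using assms(2) f by (intro Filt_mult lead_in_Filt[of g w']) auto
  have "(\<lambda>p. (a * b) * (mon d p - mon e0 p) + ((a * mon e p) * (g p - b * mon e' p) + g p * (f p - a * mon e p))) \<in> Filt (w + w')"
    using 1 2 e0(3) by (intro Filt_add Filt_scale) (simp_all add: add.commute)
  hence "(\<lambda>p. f p * g p - (a * b) * mon e0 p) \<in> Filt (w + w')"
    by (rule Filt_cong) (simp add: d algebra_simps)
  thus ?thesis unfolding lead_def using a b e0
    by (intro exI[of _ "a * b"] exI[of _ e0]) auto
qed

lemma nz_lead: "f \<in> R \<Longrightarrow> nz f \<Longrightarrow> \<exists>w. lead f w"
  using polyfuns_Filt lead_exists by blast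

lemma nz_mult: "f \<in> R \<Longrightarrow> g \<in> R \<Longrightarrow> nz f \<Longrightarrow> nz g \<Longrightarrow> nz (\<lambda>p. f p * g p)"
  using nz_lead[of f] nz_lead[of g] lead_mult lead_nz by blast

lemma nz_cancel:
  assumes "f \<in> R" "g \<in> R" "h \<in> R" "nz h" "\<And>p. p \<in> C \<Longrightarrow> h p * f p = h p * g p" "p \<in> C"
  shows "f p = g p"
proof (rule ccontr)
  assume "f p \<noteq> g p"
  hence "nz (\<lambda>p. f p - g p)" using assms(6) by (auto simp: nz_def)
  hence "nz (\<lambda>p. h p * (f p - g p))" using assms by (intro nz_mult polyfuns_diff) auto
  thus False using assms(5) by (auto simp: nz_def right_diff_distrib)
qed

text \<open>
  The number of reduced monomials with weight less than \<open>T\<close> is \<open>T - g\<close> with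
  \<open>2 g = q\<^sup>5 - 2 q\<^sup>3 + q\<^sup>2\<close>, once \<open>T \<ge> 2 g\<close>. For fixed \<open>i\<close>, \<open>j\<close> the number of exponents \<open>k\<close> is the
  integer part of \<open>n / q\<^sup>3\<close> with \<open>n\<close> as below; since the remainders run through all residues, their sum
  is known and the integer parts can be summed.
\<close>

lemma card_Red_below:
  assumes T: "q ^ 5 + q\<^sup>2 \<le> T + 2 * q ^ 3"
  shows "2 * card (Red_below T) + q ^ 5 + q\<^sup>2 = 2 * T + 2 * q ^ 3"
proof -
  define a where "a p = fst p * (q ^ 3 + 1) + snd p * (q * M)" for p :: "nat \<times> nat"
  let ?I = "{..<q} \<times> {..<q\<^sup>2}" and ?Q = "q ^ 3"
  \<comment> \<open>Chosen so that \<open>a p + k q\<^sup>3 < T\<close> iff \<open>k < n p div q\<^sup>3\<close>; the bound on \<open>T\<close> makes \<open>n p\<close> nonnegative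
    without truncation.\<close>
  define n where "n p = T + ?Q - 1 - a p" for p
  have Q0: "?Q > 0" using q2 by simp
  have MM: "int M = (int q)\<^sup>2 - int q + 1" using arg_cong[OF M_plus_q, of int] by simp
  have a_le: "a p + 1 \<le> T + ?Q" if "p \<in> ?I" for p
  proof -
    have "a p \<le> (q - 1) * (q ^ 3 + 1) + (q\<^sup>2 - 1) * (q * M)"
      using that unfolding a_def by (intro add_mono mult_right_mono) auto
    hence "int (a p) \<le> int ((q - 1) * (q ^ 3 + 1) + (q\<^sup>2 - 1) * (q * M))" by (simp only: of_nat_le_iff)
    also have "\<dots> = int q ^ 5 - int q ^ 3 + (int q)\<^sup>2 - 1"
    proof -
      have "int (q - 1) = int q - 1" "int (q\<^sup>2 - 1) = (int q)\<^sup>2 - 1"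
        using q2 by (simp_all add: of_nat_diff)
      thus ?thesis unfolding of_nat_add of_nat_mult of_nat_power MM
        by (simp add: algebra_simps power2_eq_square power3_eq_cube eval_nat_numeral)
    qed
    also have "\<dots> \<le> int T + int q ^ 3 - 1"
    proof -
      have "int (q ^ 5 + q\<^sup>2) \<le> int (T + 2 * q ^ 3)" using T by (simp only: of_nat_le_iff)
      thus ?thesis by simp
    qed
    finally have "int (a p + 1) \<le> int (T + ?Q)" by simp
    thus ?thesis by (simp only: of_nat_le_iff)
  qed
  have fib: "{k. a p + k * ?Q < T} = {..<n p div ?Q}" if "p \<in> ?I" for p
  proof -
    have "k < n p div ?Q \<longleftrightarrow> a p + k * ?Q < T" for k
    proof -
      have "k < n p div ?Q \<longleftrightarrow> Suc k * ?Q \<le> n p"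
        using less_eq_div_iff_mult_less_eq[of ?Q "Suc k" "n p"] Q0 by (simp add: Suc_le_eq)
      also have "\<dots> \<longleftrightarrow> a p + k * ?Q < T"
        using a_le[OF that] Q0 by (auto simp: n_def)
      finally show ?thesis .
    qed
    thus ?thesis by auto
  qed
  have "Red_below T = (\<lambda>(p, k). (fst p, snd p, k)) ` (SIGMA p:?I. {k. a p + k * ?Q < T})"
    by (auto simp: Red_below_def Reduced_def wt_def a_def image_iff)
  also have "card \<dots> = card (SIGMA p:?I. {k. a p + k * ?Q < T})"
    by (rule card_image) (auto simp: inj_on_def)
  also have "\<dots> = (\<Sum>p\<in>?I. card {k. a p + k * ?Q < T})"
    by (subst card_SigmaI) (auto simp: fib)
  also have "\<dots> = (\<Sum>p\<in>?I. n p div ?Q)" by (intro sum.cong) (auto simp: fib)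
  finally have card: "card (Red_below T) = (\<Sum>p\<in>?I. n p div ?Q)" .
  have inj: "inj_on (\<lambda>p. n p mod ?Q) ?I"
  proof (rule inj_onI)
    fix p p' assume p: "p \<in> ?I" "p' \<in> ?I" "n p mod ?Q = n p' mod ?Q"
    have "[n p + (a p + a p') = n p' + (a p + a p')] (mod ?Q)"
      using p(3) by (intro cong_add) (auto simp: cong_def)
    moreover have "n p + (a p + a p') = T + ?Q - 1 + a p'" "n p' + (a p + a p') = T + ?Q - 1 + a p"
      using a_le[OF p(1)] a_le[OF p(2)] by (auto simp: n_def)
    ultimately have "[a p = a p'] (mod ?Q)" by (simp only: cong_add_lcancel_nat cong_sym_eq)
    thus "p = p'" using weight_residue_inj[of "fst p" "snd p" "fst p'" "snd p'"] p by (auto simp: a_def prod_eq_iff)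
  qed
  have "(\<lambda>p. n p mod ?Q) ` ?I = {..<?Q}"
  proof (rule card_subset_eq)
    show "card ((\<lambda>p. n p mod ?Q) ` ?I) = card {..<?Q}"
      unfolding card_image[OF inj] by (simp add: power2_eq_square power3_eq_cube)
  qed (use Q0 in auto)
  hence mods: "(\<Sum>p\<in>?I. n p mod ?Q) = (\<Sum>r<?Q. r)"
    using sum.reindex[OF inj, of "\<lambda>r. r"] by simp
  have gauss: "2 * (\<Sum>r<m. int r) = int m * (int m - 1)" for m
    by (induction m) (auto simp: algebra_simps)
  have sa: "2 * (\<Sum>p\<in>?I. int (a p)) = int q ^ 3 * ((int q - 1) * (int q ^ 3 + 1) + ((int q)\<^sup>2 - 1) * (int q * int M))"
  proof -
    have "(\<Sum>p\<in>?I. int (a p)) = (\<Sum>i<q. \<Sum>j<q\<^sup>2. int i * (int q ^ 3 + 1) + int j * (int q * int M))"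
      by (simp add: a_def sum.cartesian_product case_prod_beta algebra_simps)
    also have "\<dots> = (int q)\<^sup>2 * (int q ^ 3 + 1) * (\<Sum>i<q. int i) + int q * (int q * int M) * (\<Sum>j<q\<^sup>2. int j)"
      by (simp add: sum.distrib sum_distrib_left sum_distrib_right mult_ac)
    finally have "2 * (\<Sum>p\<in>?I. int (a p)) = (int q)\<^sup>2 * (int q ^ 3 + 1) * (2 * (\<Sum>i<q. int i)) + int q * (int q * int M) * (2 * (\<Sum>j<q\<^sup>2. int j))"
      by simp
    thus ?thesis unfolding gauss by (simp add: algebra_simps power2_eq_square power3_eq_cube)
  qed
  have "int ?Q * int (card (Red_below T)) + (\<Sum>p\<in>?I. int (n p mod ?Q)) = (\<Sum>p\<in>?I. int (n p))"
  proof -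
    have "(\<Sum>p\<in>?I. n p) = (\<Sum>p\<in>?I. ?Q * (n p div ?Q) + n p mod ?Q)" by simp
    also have "\<dots> = ?Q * card (Red_below T) + (\<Sum>p\<in>?I. n p mod ?Q)"
      by (simp only: sum.distrib card sum_distrib_left)
    finally have "int (\<Sum>p\<in>?I. n p) = int (?Q * card (Red_below T) + (\<Sum>p\<in>?I. n p mod ?Q))" by (rule arg_cong)
    thus ?thesis by (simp only: of_nat_sum of_nat_mult of_nat_add)
  qed
  also have "(\<Sum>p\<in>?I. int (n p)) = (\<Sum>p\<in>?I. int (T + ?Q - 1) - int (a p))"
  proof (intro sum.cong refl)
    fix p assume "p \<in> ?I"
    from a_le[OF this] show "int (n p) = int (T + ?Q - 1) - int (a p)" by (simp add: n_def)
  qed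
  also have "\<dots> = int ?Q * (int T + int ?Q - 1) - (\<Sum>p\<in>?I. int (a p))"
  proof -
    have "int (T + ?Q - 1) = int T + int ?Q - 1" using Q0 by linarith
    moreover have "card ?I = ?Q" by (simp add: power2_eq_square power3_eq_cube)
    ultimately show ?thesis unfolding sum_subtractf sum_constant by simp
  qed
  also have "(\<Sum>p\<in>?I. int (n p mod ?Q)) = (\<Sum>r<?Q. int r)"
    using arg_cong[OF mods, of int] by (simp only: of_nat_sum)
  finally have "2 * (int ?Q * int (card (Red_below T))) + int ?Q * (int ?Q - 1) = 2 * (int ?Q * (int T + int ?Q - 1)) - 2 * (\<Sum>p\<in>?I. int (a p))"
    unfolding gauss[symmetric] by simp
  hence "int ?Q * (2 * int (card (Red_below T)) + int ?Q - 1) =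
     int ?Q * (2 * (int T + int ?Q - 1) - ((int q - 1) * (int q ^ 3 + 1) + ((int q)\<^sup>2 - 1) * (int q * int M)))"
    unfolding sa by (simp add: algebra_simps)
  hence "2 * int (card (Red_below T)) + int ?Q - 1 =
     2 * (int T + int ?Q - 1) - ((int q - 1) * (int q ^ 3 + 1) + ((int q)\<^sup>2 - 1) * (int q * int M))"
    using q2 by simp
  hence "2 * int (card (Red_below T)) + int q ^ 5 + (int q)\<^sup>2 = 2 * int T + 2 * int q ^ 3"
    unfolding MM by (simp add: algebra_simps power2_eq_square power3_eq_cube eval_nat_numeral)
  hence "int (2 * card (Red_below T) + q ^ 5 + q\<^sup>2) = int (2 * T + 2 * q ^ 3)" by simp
  thus ?thesis by (simp only: of_nat_eq_iff)
qed


lemma Filt_dependency: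
  assumes I: "finite I" "card (Red_below T) < card I" and f: "\<And>i. i \<in> I \<Longrightarrow> f i \<in> Filt T"
  shows "\<exists>u. (\<exists>i\<in>I. u i \<noteq> 0) \<and> (\<forall>p\<in>C. (\<Sum>i\<in>I. u i * f i p) = 0)"
proof -
  have "\<exists>c. \<forall>p\<in>C. f i p = (\<Sum>e\<in>Red_below T. c e * mon e p)" if "i \<in> I" for i
    using f[OF that] by (simp add: Filt_def)
  then obtain c where c: "\<And>i p. i \<in> I \<Longrightarrow> p \<in> C \<Longrightarrow> f i p = (\<Sum>e\<in>Red_below T. c i e * mon e p)"
    by metis
  obtain u where u: "\<exists>i\<in>I. u i \<noteq> 0" "\<And>e. e \<in> Red_below T \<Longrightarrow> (\<Sum>i\<in>I. u i * c i e) = 0"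
    using exists_dependency[OF finite_Red_below I, of c] by blast
  have "(\<Sum>i\<in>I. u i * f i p) = 0" if p: "p \<in> C" for p
  proof -
    have "(\<Sum>i\<in>I. u i * f i p) = (\<Sum>i\<in>I. \<Sum>e\<in>Red_below T. u i * c i e * mon e p)"
      using c p by (simp add: sum_distrib_left mult.assoc)
    also have "\<dots> = (\<Sum>e\<in>Red_below T. (\<Sum>i\<in>I. u i * c i e) * mon e p)"
      by (subst sum.swap) (simp add: sum_distrib_right)
    also have "\<dots> = 0" using u(2) by simp
    finally show ?thesis .
  qed
  with u(1) show ?thesis by blast
qed

text \<open>
  The multiples of \<open>f\<close> have codimension at most \<open>w\<close> in the coordinate ring: multiplication by \<open>f\<close> shifts
  weights by \<open>w\<close>, and far enough up the filtration gains one dimension per step. So more than \<open>w\<close>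
  functions have a nontrivial combination that is a multiple of \<open>f\<close>.
\<close>

lemma multiple_in_span:
  assumes f: "lead f w" and J: "finite J" "w < card J" "\<And>j. j \<in> J \<Longrightarrow> E j \<in> R"
  shows "\<exists>g\<in>R. \<exists>u. (\<exists>j\<in>J. u j \<noteq> 0) \<and> (\<forall>p\<in>C. f p * g p = (\<Sum>j\<in>J. u j * E j p))"
proof -
  have "\<exists>T. \<forall>j\<in>J. E j \<in> Filt T"
  proof -
    have "\<exists>T. E j \<in> Filt T" if "j \<in> J" for j using polyfuns_Filt J(3) that by blast
    then obtain T where T: "\<And>j. j \<in> J \<Longrightarrow> E j \<in> Filt (T j)" by metis
    have "E j \<in> Filt (Max (T ` J))" if "j \<in> J" for j
      using T[OF that] J(1) that by (intro Filt_mono[OF Max_ge]) auto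
    thus ?thesis by blast
  qed
  then obtain T0 where T0: "\<And>j. j \<in> J \<Longrightarrow> E j \<in> Filt T0" by blast
  \<comment> \<open>Large enough for the exact count at both \<open>T\<close> and \<open>w + T\<close>.\<close>
  define T where "T = T0 + q ^ 5 + q\<^sup>2"
  define I :: "(nat \<times> nat \<times> nat + 'a) set" where "I = Red_below T <+> J"
  define F where "F i = (case i of Inl e \<Rightarrow> (\<lambda>p. f p * mon e p) | Inr j \<Rightarrow> E j)" for i
  have "\<exists>u. (\<exists>i\<in>I. u i \<noteq> 0) \<and> (\<forall>p\<in>C. (\<Sum>i\<in>I. u i * F i p) = 0)"
  proof (rule Filt_dependency)
    show "finite I" using J by (simp add: I_def)
    have "card I = card (Red_below T) + card J" using J by (simp add: I_def card_Plus)
    moreover have "2 * card (Red_below T) + q ^ 5 + q\<^sup>2 = 2 * T + 2 * q ^ 3"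
      by (rule card_Red_below) (simp add: T_def)
    moreover have "2 * card (Red_below (w + T)) + q ^ 5 + q\<^sup>2 = 2 * (w + T) + 2 * q ^ 3"
      by (rule card_Red_below) (simp add: T_def)
    moreover have "d < a" if "a = b + c" "2 * b + x + y = 2 * t + z" "2 * d + x + y = 2 * (w + t) + z" "w < c"
      for a b c d t x y z w :: nat using that by presburger
    ultimately show "card (Red_below (w + T)) < card I" using J(2) by blast
    fix i assume i: "i \<in> I"
    show "F i \<in> Filt (w + T)"
    proof (cases i)
      case (Inl e)
      hence "e \<in> Red_below T" using i by (auto simp: I_def)
      hence "(\<lambda>p. f p * mon e p) \<in> Filt (w + T)"
        using f by (intro Filt_mult lead_in_Filt[of f w] mon_Filt) (auto simp: Red_below_def)
      thus ?thesis by (simp add: F_def Inl)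
    next
      case (Inr j)
      hence "j \<in> J" using i by (auto simp: I_def)
      have "E j \<in> Filt (w + T)" by (rule Filt_mono[OF _ T0[OF \<open>j \<in> J\<close>]]) (simp add: T_def)
      thus ?thesis by (simp add: F_def Inr)
    qed
  qed
  then obtain u where u: "\<exists>i\<in>I. u i \<noteq> 0" "\<And>p. p \<in> C \<Longrightarrow> (\<Sum>i\<in>I. u i * F i p) = 0" by blast
  define g where "g p = (\<Sum>e\<in>Red_below T. - u (Inl e) * mon e p)" for p
  have g: "g \<in> R" unfolding g_def[abs_def]
    by (intro polyfuns_sum polyfuns.mult polyfuns.const polyfuns_mon) auto
  have eq: "f p * g p = (\<Sum>j\<in>J. u (Inr j) * E j p)" if "p \<in> C" for p
  proof -
    have "(\<Sum>i\<in>I. u i * F i p) = (\<Sum>e\<in>Red_below T. u (Inl e) * (f p * mon e p)) + (\<Sum>j\<in>J. u (Inr j) * E j p)"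
      unfolding I_def using J(1) by (subst sum.Plus) (auto simp: F_def)
    also have "(\<Sum>e\<in>Red_below T. u (Inl e) * (f p * mon e p)) = - (f p * g p)"
      by (simp add: g_def sum_distrib_left sum_negf mult_ac)
    finally show ?thesis using u(2)[OF that] by simp
  qed
  have "\<exists>j\<in>J. u (Inr j) \<noteq> 0"
  proof (rule ccontr)
    assume no: "\<not> (\<exists>j\<in>J. u (Inr j) \<noteq> 0)"
    hence fg: "f p * g p = 0" if "p \<in> C" for p using eq[OF that] by simp
    obtain e where e: "e \<in> Red_below T" "u (Inl e) \<noteq> 0" using u(1) no by (auto simp: I_def)
    have "nz g"
    proof (rule ccontr)
      assume "\<not> nz g"
      hence "- u (Inl e) = 0"
        using e(1) by (intro mon_independent[where S = "Red_below T" and c = "\<lambda>e. - u (Inl e)"])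
          (auto simp: Red_below_def[of T] nz_def g_def simp del: finite_Red_below intro: finite_Red_below[unfolded Red_below_def])
      thus False using e by simp
    qed
    then obtain w' where "lead g w'" using nz_lead g by blast
    hence "nz (\<lambda>p. f p * g p)" using f lead_mult lead_nz by blast
    thus False using fg by (auto simp: nz_def)
  qed
  with g eq show ?thesis by (intro bexI[of _ g] exI[of _ "\<lambda>j. u (Inr j)"]) auto
qed

text \<open>
  A substitute for the norm to the polynomials in \<open>z\<close>: the powers of \<open>z\<close> are dependent modulo the
  multiples of \<open>f\<close>.
\<close>

lemma norm_multiple:
  assumes "f \<in> R" "nz f"
  shows "\<exists>g\<in>R. \<exists>p. p \<noteq> 0 \<and> (\<forall>P\<in>C. f P * g P = poly p (zc P))"
proof -
  obtain w where w: "lead f w" using assms nz_lead by blast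
  have "\<exists>g\<in>R. \<exists>u. (\<exists>j\<in>{..w}. u j \<noteq> 0) \<and> (\<forall>p\<in>C. f p * g p = (\<Sum>j\<in>{..w}. u j * (zc p) ^ j))"
    using w by (intro multiple_in_span) (auto intro!: polyfuns_power polyfuns.Z)
  then obtain g u j where g: "g \<in> R" "j \<le> w" "u j \<noteq> 0" "\<And>p. p \<in> C \<Longrightarrow> f p * g p = (\<Sum>j\<le>w. u j * (zc p) ^ j)"
    by auto
  define p where "p = (\<Sum>j\<le>w. monom (u j) j)"
  have "coeff p j = u j" using g(2) by (simp add: p_def coeff_sum if_distrib cong: if_cong)
  hence "p \<noteq> 0" using g(3) by auto
  moreover have "poly p z = (\<Sum>j\<le>w. u j * z ^ j)" for z by (simp add: p_def poly_sum poly_monom)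
  ultimately show ?thesis using g(1,4) by (intro bexI[of _ g] exI[of _ p]) auto
qed

text \<open>
  If there were more zeros than \<open>w\<close>, then some nontrivial combination of interpolating functions at the
  zeros would be a multiple of \<open>f\<close>; but its value at one of the zeros is not 0.
\<close>

lemma card_zeros_le:
  assumes f: "lead f w" and S: "finite S" "S \<subseteq> C" "\<And>P. P \<in> S \<Longrightarrow> f P = 0"
  shows "card S \<le> w"
proof (rule ccontr)
  assume "\<not> card S \<le> w"
  obtain E where E: "\<And>P. E P \<in> R \<and> E P P = 1 \<and> (\<forall>Q\<in>S - {P}. E P Q = 0)"
    using interpolator_exists[OF S(1)] by metis
  have "\<exists>g\<in>R. \<exists>u. (\<exists>j\<in>S. u j \<noteq> 0) \<and> (\<forall>p\<in>C. f p * g p = (\<Sum>j\<in>S. u j * E j p))"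
    using f S(1) \<open>\<not> card S \<le> w\<close> E by (intro multiple_in_span) auto
  then obtain g u P where g: "P \<in> S" "u P \<noteq> 0" "\<And>p. p \<in> C \<Longrightarrow> f p * g p = (\<Sum>j\<in>S. u j * E j p)"
    by blast
  have "(\<Sum>j\<in>S. u j * E j P) = (\<Sum>j\<in>S. if j = P then u P else 0)"
    using E g(1) by (intro sum.cong) auto
  also have "\<dots> = u P" using S(1) g(1) by simp
  finally show False using g S(2) S(3)[of P] g(3)[of P] by auto
qed

section \<open>Fibres of the function z and functions regular on the affine curve\<close>

lemma fibre_card: "card {P \<in> C. zc P = z} = q ^ 3"
proof -
  have eq: "{P \<in> C. zc P = z} = (\<lambda>(y, x). (x, y, z)) ` (SIGMA y:{y. y ^ (q\<^sup>2) - y = z ^ M}. {x. x ^ q + x = y ^ (q + 1)})"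
    by (auto simp: C_def image_iff)
  have "card {P \<in> C. zc P = z} = card (SIGMA y:{y::'k. y ^ (q\<^sup>2) - y = z ^ M}. {x. x ^ q + x = y ^ (q + 1)})"
    unfolding eq by (rule card_image) (auto simp: inj_on_def)
  also have "\<dots> = q ^ 3"
  proof (subst card_SigmaI)
    have "card {y::'k. y ^ (q\<^sup>2) - y = z ^ M} > 0" using card_y[of "z ^ M"] q2 by simp
    thus "finite {y::'k. y ^ (q\<^sup>2) - y = z ^ M}" by (simp add: card_gt_0_iff)
    show "\<forall>y\<in>{y::'k. y ^ (q\<^sup>2) - y = z ^ M}. finite {x. x ^ q + x = y ^ (q + 1)}"
    proof
      fix y :: 'k show "finite {x. x ^ q + x = y ^ (q + 1)}"
        using card_x[of "y ^ (q+1)"] q2 card.infinite by fastforce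
    qed
    show "(\<Sum>y\<in>{y::'k. y ^ (q\<^sup>2) - y = z ^ M}. card {x. x ^ q + x = y ^ (q + 1)}) = q ^ 3"
      unfolding card_x sum_constant card_y by (simp add: power2_eq_square power3_eq_cube)
  qed
  finally show ?thesis .
qed

lemma fibre_finite: "finite {P \<in> C. zc P = z}"
  using fibre_card[of z] q2 card_gt_0_iff[of "{P \<in> C. zc P = z}"] by simp

lemma Filt_box:
  assumes "f \<in> Filt T"
  shows "\<exists>p. \<forall>P\<in>C. f P = (\<Sum>i<q. (\<Sum>j<q\<^sup>2. poly (p i j) (zc P) * yc P ^ j) * fst P ^ i)"
proof -
  obtain c where c: "\<And>P. P \<in> C \<Longrightarrow> f P = (\<Sum>e\<in>Red_below T. c e * mon e P)"
    using assms by (auto simp: Filt_def)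
  define p where "p i j = (\<Sum>k\<in>{k. (i,j,k) \<in> Red_below T}. monom (c (i,j,k)) k)" for i j
  have fin: "finite {k. (i,j,k) \<in> Red_below T}" for i j
    by (rule finite_subset[of _ "(snd \<circ> snd) ` Red_below T"]) (force simp: image_iff)+
  have "Red_below T = (\<lambda>((i,j),k). (i,j,k)) ` (SIGMA (i,j):{..<q}\<times>{..<q\<^sup>2}. {k. (i,j,k) \<in> Red_below T})"
    by (force simp: Red_below_def Reduced_def image_iff)
  hence "(\<Sum>e\<in>Red_below T. c e * mon e P) = (\<Sum>e\<in>(\<lambda>((i,j),k). (i,j,k)) ` (SIGMA (i,j):{..<q}\<times>{..<q\<^sup>2}. {k. (i,j,k) \<in> Red_below T}). c e * mon e P)" for P
    by simp
  also have "\<dots> P = (\<Sum>((i,j),k)\<in>(SIGMA (i,j):{..<q}\<times>{..<q\<^sup>2}. {k. (i,j,k) \<in> Red_below T}). c (i,j,k) * mon (i,j,k) P)" for P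
    by (subst sum.reindex) (auto simp: inj_on_def case_prod_unfold)
  also have "\<dots> P = (\<Sum>(i,j)\<in>{..<q}\<times>{..<q\<^sup>2}. \<Sum>k\<in>{k. (i,j,k) \<in> Red_below T}. c (i,j,k) * mon (i,j,k) P)" for P
    using fin by (subst sum.Sigma[symmetric]) (auto simp: case_prod_unfold)
  also have "\<dots> P = (\<Sum>(i,j)\<in>{..<q}\<times>{..<q\<^sup>2}. poly (p i j) (zc P) * yc P ^ j * fst P ^ i)" for P
    by (intro sum.cong) (auto simp: p_def poly_sum poly_monom mon_altdef sum_distrib_right sum_distrib_left mult_ac)
  also have "\<dots> P = (\<Sum>i<q. (\<Sum>j<q\<^sup>2. poly (p i j) (zc P) * yc P ^ j) * fst P ^ i)" for P
    by (simp add: sum.cartesian_product sum_distrib_right)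
  finally show ?thesis using c by auto
qed

text \<open>
  Modulo \<open>z - z\<^sub>0\<close> a function is a combination of the \<open>q\<^sup>3\<close> monomials \<open>x\<^sup>i y\<^sup>j\<close>, and these are independent
  on the fibre: fibres are reduced.
\<close>

lemma fibre_division:
  assumes f: "f \<in> R" and z: "\<And>P. P \<in> C \<Longrightarrow> zc P = z \<Longrightarrow> f P = 0"
  shows "\<exists>g\<in>R. \<forall>P\<in>C. f P = (zc P - z) * g P"
proof -
  obtain T where "f \<in> Filt T" using polyfuns_Filt f by blast
  from Filt_box[OF this] obtain p where p: 
    "\<And>P. P \<in> C \<Longrightarrow> f P = (\<Sum>i<q. (\<Sum>j<q\<^sup>2. poly (p i j) (zc P) * yc P ^ j) * fst P ^ i)" by blast
  have "poly (p i j) z = 0" if "i < q" "j < q\<^sup>2" for i j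
  proof (rule box_zero[OF _ that])
    fix x y assume xy: "(x, y, z) \<in> C"
    show "(\<Sum>i<q. (\<Sum>j<q\<^sup>2. poly (p i j) z * y ^ j) * x ^ i) = 0"
      using p[OF xy] z[OF xy] by simp
  qed
  hence "[:-z, 1:] dvd p i j" if "i < q" "j < q\<^sup>2" for i j using that by (simp add: poly_eq_0_iff_dvd)
  hence "\<exists>r. p i j = [:-z, 1:] * r" if "i < q" "j < q\<^sup>2" for i j using that by (meson dvdE)
  then obtain r where r: "\<And>i j. i < q \<Longrightarrow> j < q\<^sup>2 \<Longrightarrow> p i j = [:-z, 1:] * r i j" by metis
  define g where "g P = (\<Sum>i<q. (\<Sum>j<q\<^sup>2. poly (r i j) (zc P) * yc P ^ j) * fst P ^ i)" for P :: "'k point"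
  have "g \<in> R" unfolding g_def[abs_def]
    by (intro polyfuns_sum polyfuns.mult polyfuns_power polyfuns_poly polyfuns.X polyfuns.Y) auto
  moreover have "f P = (zc P - z) * g P" if "P \<in> C" for P
  proof -
    have "f P = (\<Sum>i<q. (\<Sum>j<q\<^sup>2. (zc P - z) * poly (r i j) (zc P) * yc P ^ j) * fst P ^ i)"
      unfolding p[OF that] by (intro sum.cong refl arg_cong2[where f = "(*)"]) (auto simp: r algebra_simps)
    thus ?thesis by (simp add: g_def sum_distrib_left sum_distrib_right mult.assoc)
  qed
  ultimately show ?thesis by blast
qed

text \<open>
  The denominators of \<open>a / b\<close> form an ideal \<open>J\<close> that contains a nonzero polynomial in \<open>z\<close>. One of least
  degree is constant: at a root, a combination of local denominators is congruent to 1 on the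
  whole fibre, so the root can be divided out.
\<close>

lemma regular_everywhere:
  assumes a: "a \<in> R" and b: "b \<in> R" "nz b"
    and reg: "\<And>P. P \<in> C \<Longrightarrow> \<exists>u\<in>R. \<exists>v\<in>R. v P \<noteq> 0 \<and> (\<forall>Q\<in>C. a Q * v Q = u Q * b Q)"
  shows "\<exists>f\<in>R. \<forall>Q\<in>C. a Q = f Q * b Q"
proof -
  define J where "J = {v \<in> R. \<exists>u\<in>R. \<forall>Q\<in>C. a Q * v Q = u Q * b Q}"
  have J_add: "(\<lambda>Q. v Q + w Q) \<in> J" if "v \<in> J" "w \<in> J" for v w
  proof -
    from that(1) obtain u where "u \<in> R" "\<forall>Q\<in>C. a Q * v Q = u Q * b Q"
      unfolding J_def by blast
    moreover from that(2) obtain u' where "u' \<in> R" "\<forall>Q\<in>C. a Q * w Q = u' Q * b Q"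
      unfolding J_def by blast
    ultimately show ?thesis using that unfolding J_def
      by (auto intro!: polyfuns.add bexI[of _ "\<lambda>Q. u Q + u' Q"] simp: algebra_simps)
  qed
  have J_mult: "(\<lambda>Q. w Q * v Q) \<in> J" if "v \<in> J" "w \<in> R" for v w
  proof -
    from that(1) obtain u where "u \<in> R" "\<forall>Q\<in>C. a Q * v Q = u Q * b Q" unfolding J_def by blast
    thus ?thesis using that unfolding J_def
      by (auto intro!: polyfuns.mult bexI[of _ "\<lambda>Q. w Q * u Q"] simp: algebra_simps)
  qed
  have J_cong: "w \<in> J" if "v \<in> J" "w \<in> R" "\<And>Q. Q \<in> C \<Longrightarrow> w Q = v Q" for v w
    using that by (auto simp: J_def)
  have J_0: "(\<lambda>Q. 0) \<in> J" unfolding J_def by (auto intro!: polyfuns.const bexI[of _ "\<lambda>_. 0"])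
  have J_sum: "(\<lambda>Q. \<Sum>i\<in>I. v i Q) \<in> J" if "\<And>i. i \<in> I \<Longrightarrow> v i \<in> J" for v and I :: "'k point set"
    using that by (induction I rule: infinite_finite_induct) (auto simp: J_0 intro: J_add)
  have J_b: "b \<in> J" using a b by (auto simp: J_def)
  define PJ where "PJ = {p. p \<noteq> 0 \<and> (\<lambda>Q. poly p (zc Q)) \<in> J}"
  obtain b' p0 where b': "b' \<in> R" "p0 \<noteq> 0" "\<And>P. P \<in> C \<Longrightarrow> b P * b' P = poly p0 (zc P)"
    using norm_multiple[OF b] by blast
  have "p0 \<in> PJ" unfolding PJ_def using b' J_cong[OF J_mult[OF J_b b'(1)] polyfuns_poly] by (simp add: mult.commute)
  then obtain p where p: "p \<in> PJ" "\<And>p'. p' \<in> PJ \<Longrightarrow> degree p \<le> degree p'"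
    using ex_has_least_nat[of "\<lambda>p. p \<in> PJ" p0 degree] by blast
  have "degree p = 0"
  proof (rule ccontr)
    assume "degree p \<noteq> 0"
    then obtain z where "poly p z = 0" using alg_closed_imp_poly_has_root[of p] by auto
    then obtain p1 where p1: "p = [:-z, 1:] * p1" using poly_eq_0_iff_dvd[of p z] by (auto elim: dvdE)
    have p1_0: "p1 \<noteq> 0" using p(1) p1 by (auto simp: PJ_def)
    define S where "S = {P \<in> C. zc P = z}"
    have finS: "finite S" unfolding S_def by (rule fibre_finite)
    obtain E where E: "\<And>P. E P \<in> R \<and> E P P = 1 \<and> (\<forall>Q\<in>S - {P}. E P Q = 0)"
      using interpolator_exists[OF finS] by metis
    have "\<exists>v\<in>J. v P \<noteq> 0" if "P \<in> C" for P using reg[OF that] by (auto simp: J_def)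
    then obtain v where v: "\<And>P. P \<in> C \<Longrightarrow> v P \<in> J \<and> v P P \<noteq> 0" by metis
    define w where "w Q = (\<Sum>P\<in>S. (inverse (v P P) * E P Q) * v P Q)" for Q
    have w: "w \<in> J" unfolding w_def[abs_def]
      using v E by (intro J_sum J_mult polyfuns.mult polyfuns.const) (auto simp: S_def)
    hence wR: "w \<in> R" by (simp add: J_def)
    have w1: "w P = 1" if P: "P \<in> C" "zc P = z" for P
    proof -
      have "w P = (\<Sum>P'\<in>S. if P' = P then 1 else 0)"
        unfolding w_def using E P v by (intro sum.cong) (auto simp: S_def)
      also have "\<dots> = 1" using P finS by (simp add: S_def)
      finally show ?thesis .
    qed
    have "\<exists>g\<in>R. \<forall>P\<in>C. 1 - w P = (zc P - z) * g P"
      using w1 wR by (intro fibre_division polyfuns_diff polyfuns.const) auto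
    then obtain g where g: "g \<in> R" "\<And>P. P \<in> C \<Longrightarrow> 1 - w P = (zc P - z) * g P" by blast
    have pJ: "(\<lambda>Q. poly p (zc Q)) \<in> J" using p(1) by (simp add: PJ_def)
    \<comment> \<open>With \<open>1 - w = (z - z\<^sub>0) g\<close> and \<open>p = (z - z\<^sub>0) p1\<close> this combination is \<open>p1\<close> on the curve.\<close>
    have "(\<lambda>Q. poly p1 (zc Q) * w Q + g Q * poly p (zc Q)) \<in> J"
      by (intro J_add J_mult w pJ g(1) polyfuns_poly)
    hence "(\<lambda>Q. poly p1 (zc Q)) \<in> J"
    proof (rule J_cong[OF _ polyfuns_poly])
      fix Q assume Q: "Q \<in> C"
      have "poly p1 (zc Q) * w Q + g Q * poly p (zc Q)
        = poly p1 (zc Q) * (w Q + (zc Q - z) * g Q)"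
        by (simp add: p1 algebra_simps)
      thus "poly p1 (zc Q) = poly p1 (zc Q) * w Q + g Q * poly p (zc Q)"
        using g(2)[OF Q] by (metis add_diff_cancel_left' diff_add_cancel mult.right_neutral add.commute)
    qed
    hence "p1 \<in> PJ" using p1_0 by (simp add: PJ_def)
    hence "degree p \<le> degree p1" by (rule p(2))
    moreover have "degree p = Suc (degree p1)" unfolding p1 using p1_0 by (subst degree_mult_eq) auto
    ultimately show False by simp
  qed
  then obtain c where c: "p = [:c:]" by (rule degree_eq_zeroE)
  hence c0: "c \<noteq> 0" using p(1) by (auto simp: PJ_def)
  have "(\<lambda>Q. c) \<in> J" using p(1) c by (simp add: PJ_def)
  then obtain u where u: "u \<in> R" "\<And>Q. Q \<in> C \<Longrightarrow> a Q * c = u Q * b Q" by (auto simp: J_def)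
  show ?thesis
  proof (intro bexI ballI)
    show "(\<lambda>Q. inverse c * u Q) \<in> R" using u by (intro polyfuns.mult polyfuns.const) auto
    show "a Q = inverse c * u Q * b Q" if "Q \<in> C" for Q
      using u(2)[OF that] c0 by (simp add: field_simps)
  qed
qed

end

section \<open>Homogeneous polynomials on projective space\<close>

definition monv :: "('n::finite \<Rightarrow>\<^sub>0 nat) \<Rightarrow> 'k::field ^ 'n \<Rightarrow> 'k" where
  "monv e v = (\<Prod>i\<in>UNIV. (v $ i) ^ Poly_Mapping.lookup e i)"

lemma monv_add: "monv (e + f) v = monv e v * monv f v"
  by (simp add: monv_def lookup_add power_add prod.distrib)

lemma mpol_eval_superset:
  assumes "finite S" "Poly_Mapping.keys A \<subseteq> S"
  shows "mpol_eval A v = (\<Sum>e\<in>S. Poly_Mapping.lookup A e * monv e v)"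
  unfolding mpol_eval_def monv_def
  using assms by (intro sum.mono_neutral_left) (auto simp: in_keys_iff)

lemma mpol_eval_add: "mpol_eval (A + B) v = mpol_eval A v + mpol_eval B v"
  by (subst (1 2 3) mpol_eval_superset[of "Poly_Mapping.keys A \<union> Poly_Mapping.keys B"])
    (auto simp: lookup_add distrib_right sum.distrib dest: keys_add[THEN subsetD])

lemma mpol_eval_single: "mpol_eval (Poly_Mapping.single e a) v = a * monv e v"
  by (subst mpol_eval_superset[of "{e}"]) auto

lemma mpol_eval_0: "mpol_eval 0 v = 0"
  by (simp add: mpol_eval_def)

lemma mpol_eval_sum: "mpol_eval (\<Sum>i\<in>I. f i) v = (\<Sum>i\<in>I. mpol_eval (f i) v)"
  by (induction I rule: infinite_finite_induct) (auto simp: mpol_eval_0 mpol_eval_add)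

lemma mpol_expand: "A = (\<Sum>e\<in>Poly_Mapping.keys A. Poly_Mapping.single e (Poly_Mapping.lookup A e))"
  by (rule poly_mapping_eqI)
    (auto simp: lookup_sum lookup_single when_def in_keys_iff)

lemma mpol_mult_expand: "A * B = (\<Sum>e\<in>Poly_Mapping.keys A. \<Sum>f\<in>Poly_Mapping.keys B.
    Poly_Mapping.single (e + f) (Poly_Mapping.lookup A e * Poly_Mapping.lookup B f))"
  by (subst mpol_expand[of A], subst mpol_expand[of B]) (simp add: sum_product mult_single)

lemma mpol_eval_mult: "mpol_eval (A * B) v = mpol_eval A v * mpol_eval B v"
proof -
  have "mpol_eval A v * mpol_eval B v = (\<Sum>e\<in>Poly_Mapping.keys A. \<Sum>f\<in>Poly_Mapping.keys B.
      (Poly_Mapping.lookup A e * monv e v) * (Poly_Mapping.lookup B f * monv f v))"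
    by (simp add: mpol_eval_def monv_def[symmetric] sum_product)
  thus ?thesis
    by (subst mpol_mult_expand) (simp add: mpol_eval_sum mpol_eval_single monv_add mult_ac)
qed

lemma mpol_eval_1: "mpol_eval 1 v = 1"
  by (subst single_one[symmetric], subst mpol_eval_single) (simp add: monv_def)

lemma mpol_eval_diff: "mpol_eval (A - B) v = mpol_eval A v - mpol_eval B v"
  using mpol_eval_add[of "A - B" B v] by simp

lemma mpol_eval_power: "mpol_eval (A ^ n) v = mpol_eval A v ^ n"
  by (induction n) (auto simp: mpol_eval_1 mpol_eval_mult)

lemma mpol_eval_scale:
  assumes "homogeneous d A" shows "mpol_eval A (a *s v) = a ^ d * mpol_eval A v"
proof -
  have "monv e (a *s v) = a ^ d * monv e v" if "e \<in> Poly_Mapping.keys A" for e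
  proof -
    have "(\<Sum>i\<in>UNIV. Poly_Mapping.lookup e i) = d" using assms that by (auto simp: homogeneous_def)
    thus ?thesis by (auto simp: monv_def power_mult_distrib prod.distrib power_sum)
  qed
  thus ?thesis unfolding mpol_eval_def monv_def[symmetric] sum_distrib_left
    by (intro sum.cong) (auto simp: mult_ac)
qed

definition coefs_in :: "'k::field set \<Rightarrow> ('k, 'n::finite) mpol \<Rightarrow> bool" where
  "coefs_in S A \<longleftrightarrow> (\<forall>e. Poly_Mapping.lookup A e \<in> S)"

definition subring_set :: "'k::field set \<Rightarrow> bool" where
  "subring_set S \<longleftrightarrow> 0 \<in> S \<and> 1 \<in> S \<and> -1 \<in> S \<and> (\<forall>a\<in>S. \<forall>b\<in>S. a + b \<in> S \<and> a * b \<in> S)"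

lemma subring_set_UNIV: "subring_set UNIV"
  by (simp add: subring_set_def)

lemma subring_set_sum: "subring_set S \<Longrightarrow> (\<And>i. i \<in> I \<Longrightarrow> f i \<in> S) \<Longrightarrow> (\<Sum>i\<in>I. f i) \<in> S"
  by (induction I rule: infinite_finite_induct) (auto simp: subring_set_def)

lemma coefs_in_add: "subring_set S \<Longrightarrow> coefs_in S A \<Longrightarrow> coefs_in S B \<Longrightarrow> coefs_in S (A + B)"
  by (auto simp: coefs_in_def subring_set_def lookup_add)

lemma coefs_in_single: "subring_set S \<Longrightarrow> a \<in> S \<Longrightarrow> coefs_in S (Poly_Mapping.single e a)"
  by (auto simp: coefs_in_def subring_set_def lookup_single when_def)

lemma coefs_in_mult: "subring_set S \<Longrightarrow> coefs_in S A \<Longrightarrow> coefs_in S B \<Longrightarrow> coefs_in S (A * B)"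
  by (subst mpol_mult_expand) (auto simp: coefs_in_def lookup_sum lookup_single when_def subring_set_def
    intro!: subring_set_sum)

lemma homogeneous_add: "homogeneous d A \<Longrightarrow> homogeneous d B \<Longrightarrow> homogeneous d (A + B)"
  unfolding homogeneous_def using keys_add[of A B] by blast

lemma homogeneous_diff: "homogeneous d A \<Longrightarrow> homogeneous d B \<Longrightarrow> homogeneous d (A - B)"
  unfolding homogeneous_def by (force simp: in_keys_iff lookup_minus)

lemma homogeneous_0: "homogeneous d 0"
  by (simp add: homogeneous_def)

lemma homogeneous_sum: "(\<And>i. i \<in> I \<Longrightarrow> homogeneous d (f i)) \<Longrightarrow> homogeneous d (\<Sum>i\<in>I. f i)"
  by (induction I rule: infinite_finite_induct) (auto intro: homogeneous_0 homogeneous_add)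

lemma homogeneous_mult: "homogeneous d A \<Longrightarrow> homogeneous d' B \<Longrightarrow> homogeneous (d + d') (A * B)"
  unfolding homogeneous_def using keys_mult[of A B]
  by (fastforce simp: lookup_add sum.distrib)

lemma homogeneous_1: "homogeneous 0 1"
  by (simp add: homogeneous_def)

lemma homogeneous_power: "homogeneous d A \<Longrightarrow> homogeneous (n * d) (A ^ n)"
  by (induction n) (auto intro: homogeneous_1 homogeneous_mult)

definition mvar :: "'n \<Rightarrow> ('k::field, 'n::finite) mpol" where
  "mvar i = Poly_Mapping.single (Poly_Mapping.single i 1) 1"

lemma homogeneous_mvar: "homogeneous 1 (mvar i)"
  by (auto simp: homogeneous_def mvar_def lookup_single when_def)

lemma homogeneous_const: "homogeneous 0 (Poly_Mapping.single 0 c)"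
  by (auto simp: homogeneous_def)

lemma mpol_eval_const: "mpol_eval (Poly_Mapping.single 0 c) v = c"
  by (simp add: mpol_eval_single monv_def)

lemma mpol_eval_mvar: "mpol_eval (mvar i) v = v $ i"
proof -
  have "(v $ j) ^ Poly_Mapping.lookup (Poly_Mapping.single i 1) j = (if j = i then v $ j else 1)" for j
    by (simp add: lookup_single when_def)
  thus ?thesis by (simp add: mvar_def mpol_eval_single monv_def)
qed

lemma coefs_in_mvar: "subring_set S \<Longrightarrow> coefs_in S (mvar i)"
  unfolding mvar_def by (rule coefs_in_single) (auto simp: subring_set_def)

lemma coefs_in_power: "subring_set S \<Longrightarrow> coefs_in S A \<Longrightarrow> coefs_in S (A ^ n)"
proof (induction n)
  case 0 thus ?case using coefs_in_single[of S 1 0] by (simp add: subring_set_def)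
qed (auto intro: coefs_in_mult)

lemmas mpol_eval_simps = mpol_eval_add mpol_eval_diff mpol_eval_mult mpol_eval_power mpol_eval_1
  mpol_eval_0 mpol_eval_const mpol_eval_mvar mpol_eval_sum

definition pt :: "'k::field point \<Rightarrow> 'k ^ 4" where
  "pt p = vector [fst p, yc p, zc p, 1]"

lemma pt_nth [simp]:
  "pt p $ 1 = fst p" "pt p $ 2 = yc p" "pt p $ 3 = zc p" "pt p $ 4 = 1"
  unfolding pt_def vector_def by simp_all

text \<open>
  Dehomogenisation: evaluation at the points with last coordinate 1.
\<close>

abbreviation ev :: "('k::field, 4) mpol \<Rightarrow> 'k point \<Rightarrow> 'k" where
  "ev A p \<equiv> mpol_eval A (pt p)"

lemma homogeneous_mvar_power: "homogeneous n (mvar i ^ n)"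
  using homogeneous_power[OF homogeneous_mvar, of n i] by simp

lemma raise_degree:
  assumes "subring_set S" "homogeneous d A" "coefs_in S A"
  shows "homogeneous (d + n) (A * mvar 4 ^ n)" "coefs_in S (A * mvar 4 ^ n)" "ev (A * mvar 4 ^ n) p = ev A p"
  using assms by (auto intro: homogeneous_mult homogeneous_mvar_power coefs_in_mult coefs_in_power coefs_in_mvar
    simp: mpol_eval_simps)

text \<open>
  Degrees are equalised by powers of the last coordinate, which is 1 on the affine part.
\<close>

lemma polyfuns_homogenize:
  assumes S: "subring_set S" and f: "f \<in> polyfuns S"
  shows "\<exists>d A. homogeneous d A \<and> coefs_in S A \<and> (\<forall>p. ev A p = f p)"
  using f
proof induction
  case (const c)
  thus ?case using S
    by (intro exI[of _ 0] exI[of _ "Poly_Mapping.single 0 c"])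
      (auto intro: homogeneous_const coefs_in_single simp: mpol_eval_simps)
next
  case X
  thus ?case using S by (intro exI[of _ 1] exI[of _ "mvar 1"])
      (auto intro: homogeneous_mvar[simplified] coefs_in_mvar simp: mpol_eval_simps)
next
  case Y
  thus ?case using S by (intro exI[of _ 1] exI[of _ "mvar 2"])
      (auto intro: homogeneous_mvar[simplified] coefs_in_mvar simp: mpol_eval_simps)
next
  case Z
  thus ?case using S by (intro exI[of _ 1] exI[of _ "mvar 3"])
      (auto intro: homogeneous_mvar[simplified] coefs_in_mvar simp: mpol_eval_simps)
next
  case (add f g)
  then obtain d A d' B where "homogeneous d A" "coefs_in S A" "\<forall>p. ev A p = f p"
      "homogeneous d' B" "coefs_in S B" "\<forall>p. ev B p = g p" by blast
  note AB = this
  have "homogeneous (d + d') (A * mvar 4 ^ d' + B * mvar 4 ^ d)"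
    using raise_degree(1)[OF S AB(1,2), of d'] raise_degree(1)[OF S AB(4,5), of d]
    by (simp add: homogeneous_add add.commute)
  moreover have "coefs_in S (A * mvar 4 ^ d' + B * mvar 4 ^ d)"
    using AB S by (intro coefs_in_add raise_degree(2))
  moreover have "ev (A * mvar 4 ^ d' + B * mvar 4 ^ d) p = f p + g p" for p
    using AB(3,6) by (simp only: mpol_eval_simps pt_nth power_one mult_1_right)
  ultimately show ?case by blast
next
  case (mult f g)
  then obtain d A d' B where "homogeneous d A" "coefs_in S A" "\<forall>p. ev A p = f p"
      "homogeneous d' B" "coefs_in S B" "\<forall>p. ev B p = g p" by blast
  hence "homogeneous (d + d') (A * B)" "coefs_in S (A * B)" "ev (A * B) p = f p * g p" for p
    using S by (simp_all only: homogeneous_mult coefs_in_mult mpol_eval_mult)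
  thus ?case by blast
qed

lemma homogenize_pair:
  assumes S: "subring_set S" and "a \<in> polyfuns S" "b \<in> polyfuns S"
  shows "\<exists>d A B. homogeneous d A \<and> homogeneous d B \<and> coefs_in S A \<and> coefs_in S B \<and>
    (\<forall>p. ev A p = a p) \<and> (\<forall>p. ev B p = b p)"
proof -
  obtain d A d' B where AB: "homogeneous d A" "coefs_in S A" "\<forall>p. ev A p = a p"
      "homogeneous d' B" "coefs_in S B" "\<forall>p. ev B p = b p" using polyfuns_homogenize[OF S] assms(2,3) by meson
  note AB = this
  have "homogeneous (d + d') (A * mvar 4 ^ d')" by (rule raise_degree(1)[OF S AB(1,2)])
  moreover have "homogeneous (d + d') (B * mvar 4 ^ d)"
    using raise_degree(1)[OF S AB(4,5), of d] by (simp add: add.commute)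
  moreover have "coefs_in S (A * mvar 4 ^ d')" "coefs_in S (B * mvar 4 ^ d)"
    using AB S by (auto intro: raise_degree(2))
  moreover have "ev (A * mvar 4 ^ d') p = a p" "ev (B * mvar 4 ^ d) p = b p" for p
    using AB(3,6) by (simp_all only: mpol_eval_simps pt_nth power_one mult_1_right)
  ultimately show ?thesis by blast
qed

lemma prod_UNIV_4: "prod f (UNIV::4 set) = f 1 * f 2 * f 3 * (f 4 :: 'k::comm_monoid_mult)"
  unfolding UNIV_4 by (simp add: ac_simps)

lemma ev_polyfuns: "subring_set S \<Longrightarrow> coefs_in S A \<Longrightarrow> ev A \<in> polyfuns S"
proof -
  assume S: "subring_set S" "coefs_in S A"
  have "ev A = (\<lambda>p. \<Sum>e\<in>Poly_Mapping.keys A. Poly_Mapping.lookup A e *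
     (fst p ^ Poly_Mapping.lookup e 1 * yc p ^ Poly_Mapping.lookup e 2 * zc p ^ Poly_Mapping.lookup e 3))"
    by (simp add: mpol_eval_def prod_UNIV_4)
  also have "\<dots> \<in> polyfuns S" using S
    by (intro polyfuns_sum polyfuns.mult polyfuns.const polyfuns_power polyfuns.X polyfuns.Y polyfuns.Z)
      (auto simp: subring_set_def coefs_in_def)
  finally show ?thesis .
qed

lemma ev_R: "ev A \<in> polyfuns UNIV"
  by (rule ev_polyfuns) (auto simp: subring_set_def coefs_in_def)

definition aff :: "'k::field point \<Rightarrow> ('k, 4) ppoint" where
  "aff p = proj_point (pt p)"

definition pinf :: "('k::field, 4) ppoint" where
  "pinf = proj_point (axis 1 1)"

lemma vanishes_at_proj_point:
  assumes "homogeneous d A"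
  shows "vanishes_at A (proj_point v) \<longleftrightarrow> mpol_eval A v = 0"
proof
  assume "vanishes_at A (proj_point v)"
  moreover have "1 *s v \<in> proj_point v" unfolding proj_point_def by (intro CollectI exI[of _ 1]) auto
  ultimately show "mpol_eval A v = 0" by (simp add: vanishes_at_def)
qed (auto simp: vanishes_at_def proj_point_def mpol_eval_scale[OF assms])

lemma vanishes_at_aff: "homogeneous d A \<Longrightarrow> vanishes_at A (aff p) \<longleftrightarrow> ev A p = 0"
  unfolding aff_def by (rule vanishes_at_proj_point)

section \<open>The function field\<close>

context gk_curve
begin

definition V :: "('k, 4) ppoint set" where "V = GK_curve q"

lemma origin_C: "(0, 0, 0) \<in> C"
  using q2 M_pos by (simp add: C_def zero_power)

lemma GK_affine_eq: "GK_affine q = aff ` C"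
proof (intro equalityI subsetI)
  fix P :: "('k, 4) ppoint" assume "P \<in> GK_affine q"
  then obtain v :: "'k ^ 4" where v: "P = proj_point v" "v $ 4 = 1" "(v $ 2) ^ (q + 1) = (v $ 1) ^ q + v $ 1"
     "(v $ 3) ^ (q\<^sup>2 - q + 1) = (v $ 2) ^ (q\<^sup>2) - v $ 2" unfolding GK_affine_def by blast
  have "pt (v $ 1, v $ 2, v $ 3) = v" using v(2) by (simp add: vec_eq_iff forall_4)
  hence "P = aff (v $ 1, v $ 2, v $ 3)" using v(1) by (simp add: aff_def)
  moreover have "(v $ 1, v $ 2, v $ 3) \<in> C" using v by (simp add: C_def M_def)
  ultimately show "P \<in> aff ` C" by blast
next
  fix P :: "('k, 4) ppoint" assume "P \<in> aff ` C"
  then obtain x y z where "(x,y,z) \<in> C" "P = proj_point (pt (x,y,z))" by (auto simp: aff_def)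
  thus "P \<in> GK_affine q" unfolding GK_affine_def
    by (intro CollectI exI[of _ "pt (x,y,z)"]) (auto simp: C_def M_def)
qed

lemma aff_in_V: "p \<in> C \<Longrightarrow> aff p \<in> V"
proof -
  assume p: "p \<in> C"
  have "pt p \<noteq> 0" by (metis pt_nth(4) zero_index zero_neq_one)
  hence "aff p \<in> proj_space" by (simp add: proj_space_def aff_def)
  thus ?thesis using p by (auto simp: V_def GK_curve_def zariski_closure_def GK_affine_eq vanishes_on_def)
qed

text \<open>
  The affine part is dense by construction.
\<close>

lemma vanishes_on_V:
  assumes A: "homogeneous d A" shows "vanishes_on A V \<longleftrightarrow> (\<forall>p\<in>C. ev A p = 0)"
proof
  assume "vanishes_on A V"
  thus "\<forall>p\<in>C. ev A p = 0" using aff_in_V vanishes_at_aff[OF A] unfolding vanishes_on_def by blast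
next
  assume "\<forall>p\<in>C. ev A p = 0"
  hence "vanishes_on A (GK_affine q)"
    using vanishes_at_aff[OF A] by (auto simp: vanishes_on_def GK_affine_eq)
  thus "vanishes_on A V"
    using A by (auto simp: vanishes_on_def V_def GK_curve_def zariski_closure_def)
qed

lemma nz_ev: "homogeneous d A \<Longrightarrow> \<not> vanishes_on A V \<longleftrightarrow> nz (ev A)"
  by (auto simp: vanishes_on_V nz_def)

abbreviation FF :: "('k, 4) ratfun ring" where "FF \<equiv> function_field V"

text \<open>
  The rational function \<open>a / b\<close> for polynomial functions \<open>a\<close>, \<open>b\<close> on the affine curve.
\<close>

definition fr :: "'k point_fun \<Rightarrow> 'k point_fun \<Rightarrow> ('k, 4) ratfun" where
  "fr a b = {(A, B) \<in> fractions V. \<forall>p\<in>C. ev A p * b p = a p * ev B p}"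

lemma fractions_iff: "(A, B) \<in> fractions V \<longleftrightarrow> (\<exists>d. homogeneous d A \<and> homogeneous d B) \<and> nz (ev B)"
  unfolding fractions_def using nz_ev by blast

lemma fraction_rel_class: "(A, B) \<in> fractions V \<Longrightarrow> fraction_rel V `` {(A, B)} = fr (ev A) (ev B)"
proof -
  assume AB: "(A, B) \<in> fractions V"
  then obtain d where d: "homogeneous d A" "homogeneous d B" by (auto simp: fractions_iff)
  have "vanishes_on (A * D' - C' * B) V \<longleftrightarrow> (\<forall>p\<in>C. ev C' p * ev B p = ev A p * ev D' p)"
    if CD: "(C', D') \<in> fractions V" for C' D'
  proof -
    obtain d' where d': "homogeneous d' C'" "homogeneous d' D'" using CD unfolding fractions_iff by blast
    have "homogeneous (d + d') (A * D' - C' * B)"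
      using homogeneous_mult[OF d(1) d'(2)] homogeneous_mult[OF d'(1) d(2)]
      by (intro homogeneous_diff) (simp_all add: add.commute)
    from vanishes_on_V[OF this] show ?thesis by (auto simp: mpol_eval_simps)
  qed
  thus ?thesis using AB unfolding fraction_rel_def fr_def by auto
qed

lemma fr_rep:
  assumes S: "subring_set S" and "a \<in> polyfuns S" "b \<in> polyfuns S" "nz b"
  shows "\<exists>A B. (A, B) \<in> fractions V \<and> coefs_in S A \<and> coefs_in S B \<and> ev A = a \<and> ev B = b"
proof -
  from homogenize_pair[OF assms(1-3)] obtain d A B where AB: "homogeneous d A" "homogeneous d B"
    "coefs_in S A" "coefs_in S B" "ev A = a" "ev B = b" by (auto simp: fun_eq_iff)
  hence "(A, B) \<in> fractions V" using assms(4) by (auto simp: fractions_iff)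
  with AB show ?thesis by blast
qed

lemma fr_rep':
  assumes "a \<in> R" "b \<in> R" "nz b"
  obtains A B where "(A, B) \<in> fractions V" "ev A = a" "ev B = b"
  using fr_rep[OF subring_set_UNIV assms] by blast

lemma fr_eqI:
  assumes R: "a \<in> R" "b \<in> R" "c \<in> R" "d \<in> R" and nz: "nz b" "nz d"
    and eq: "\<And>p. p \<in> C \<Longrightarrow> a p * d p = c p * b p"
  shows "fr a b = fr c d"
proof -
  have sub: "fr a b \<subseteq> fr c d" if R: "a \<in> R" "b \<in> R" "c \<in> R" "d \<in> R" and nz: "nz b" "nz d"
    and eq: "\<And>p. p \<in> C \<Longrightarrow> a p * d p = c p * b p" for a b c d
  proof (clarsimp simp: fr_def)
    fix A B x y z assume AB: "(A, B) \<in> fractions V" "\<forall>p\<in>C. ev A p * b p = a p * ev B p" and p: "(x, y, z) \<in> C"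
    show "ev A (x,y,z) * d (x,y,z) = c (x,y,z) * ev B (x,y,z)"
    proof (rule nz_cancel[where h = b and p = "(x,y,z)" and f = "\<lambda>p. ev A p * d p" and g = "\<lambda>p. c p * ev B p"])
      show "(\<lambda>p. ev A p * d p) \<in> R" "(\<lambda>p. c p * ev B p) \<in> R" using R by (auto intro!: polyfuns.mult ev_R)
      fix p assume p: "p \<in> C"
      have "b p * (ev A p * d p) = (ev A p * b p) * d p" by simp
      also have "\<dots> = (a p * d p) * ev B p" using AB(2) p by simp
      also have "\<dots> = b p * (c p * ev B p)" using eq[OF p] by simp
      finally show "b p * (ev A p * d p) = b p * (c p * ev B p)" .
    qed (use R nz p in auto)
  qed
  show ?thesis
    using sub[OF R nz eq] sub[OF R(3,4,1,2) nz(2,1) eq[symmetric]] by blast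
qed

lemma fr_eqD:
  assumes R: "a \<in> R" "b \<in> R" "c \<in> R" "d \<in> R" and nz: "nz b" "nz d"
    and eq: "fr a b = fr c d" and p: "p \<in> C"
  shows "a p * d p = c p * b p"
proof -
  obtain A B where AB: "(A, B) \<in> fractions V" "ev A = a" "ev B = b" using fr_rep' R nz by blast
  hence "(A, B) \<in> fr a b" by (auto simp: fr_def)
  hence "(A, B) \<in> fr c d" using eq by simp
  thus ?thesis using AB p by (auto simp: fr_def)
qed

lemma fr_carrier:
  assumes "a \<in> R" "b \<in> R" "nz b" shows "fr a b \<in> carrier FF"
proof -
  obtain A B where AB: "(A, B) \<in> fractions V" "ev A = a" "ev B = b" using fr_rep' assms by blast
  thus ?thesis using fraction_rel_class[OF AB(1)] by (auto simp: function_field_def quotient_def)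
qed

lemma carrierE:
  assumes "f \<in> carrier FF" "(A, B) \<in> f"
  shows "(A, B) \<in> fractions V" "f = fr (ev A) (ev B)"
proof -
  obtain C' D where CD: "(C', D) \<in> fractions V" "f = fraction_rel V `` {(C', D)}"
    using assms(1) by (auto simp: function_field_def quotient_def)
  hence f: "f = fr (ev C') (ev D)" using fraction_rel_class by simp
  thus AB: "(A, B) \<in> fractions V" using assms(2) by (simp add: fr_def)
  show "f = fr (ev A) (ev B)" unfolding f
    by (rule fr_eqI) (use f assms(2) AB CD in \<open>auto simp: fractions_iff ev_R fr_def\<close>)
qed

lemma carrier_fr: "f \<in> carrier FF \<Longrightarrow> \<exists>a\<in>R. \<exists>b\<in>R. nz b \<and> f = fr a b"
proof -
  assume "f \<in> carrier FF"
  then obtain C' D where CD: "(C', D) \<in> fractions V" "f = fraction_rel V `` {(C', D)}"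
    by (auto simp: function_field_def quotient_def)
  thus ?thesis using fraction_rel_class[OF CD(1)] ev_R by (auto simp: fractions_iff)
qed

lemma fr_self: "(A, B) \<in> fractions V \<Longrightarrow> (A, B) \<in> fr (ev A) (ev B)"
  by (simp add: fr_def)

lemma fr_mult:
  assumes R: "a \<in> R" "b \<in> R" "c \<in> R" "d \<in> R" and nz: "nz b" "nz d"
  shows "fr a b \<otimes>\<^bsub>FF\<^esub> fr c d = fr (\<lambda>p. a p * c p) (\<lambda>p. b p * d p)"
proof -
  have cls: "fraction_rel V `` {(A * C', B * D)} = fr (\<lambda>p. a p * c p) (\<lambda>p. b p * d p)"
    if "(A, B) \<in> fr a b" "(C', D) \<in> fr c d" for A B C' D
  proof -
    have fr: "(A, B) \<in> fractions V" "(C', D) \<in> fractions V" using that by (auto simp: fr_def)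
    have ACBD: "(A * C', B * D) \<in> fractions V"
    proof -
      obtain e e' where "homogeneous e A" "homogeneous e B" "homogeneous e' C'" "homogeneous e' D"
        using fr unfolding fractions_iff by blast
      hence "homogeneous (e + e') (A * C')" "homogeneous (e + e') (B * D)" by (auto intro: homogeneous_mult)
      moreover have "nz (\<lambda>p. ev B p * ev D p)" using fr by (intro nz_mult ev_R) (auto simp: fractions_iff)
      ultimately show ?thesis by (auto simp: fractions_iff mpol_eval_simps)
    qed
    have cross: "ev A p * b p = a p * ev B p" "ev C' p * d p = c p * ev D p" if "p \<in> C" for p
      using \<open>(A, B) \<in> fr a b\<close> \<open>(C', D) \<in> fr c d\<close> that by (auto simp: fr_def)
    have eq: "ev (A * C') p * (b p * d p) = a p * c p * ev (B * D) p" if p: "p \<in> C" for p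
    proof -
      have "ev (A * C') p * (b p * d p) = (ev A p * b p) * (ev C' p * d p)"
        by (simp only: mpol_eval_mult mult_ac)
      also have "\<dots> = a p * c p * ev (B * D) p" unfolding cross[OF p] by (simp only: mpol_eval_mult mult_ac)
      finally show ?thesis .
    qed
    have "fr (ev (A * C')) (ev (B * D)) = fr (\<lambda>p. a p * c p) (\<lambda>p. b p * d p)"
      using R nz ACBD by (intro fr_eqI ev_R polyfuns.mult nz_mult eq) (auto simp: fractions_iff)
    thus ?thesis using fraction_rel_class[OF ACBD] by simp
  qed
  obtain A B where "(A, B) \<in> fr a b" using fr_rep'[OF R(1,2) nz(1)] fr_self by metis
  moreover obtain C' D where "(C', D) \<in> fr c d" using fr_rep'[OF R(3,4) nz(2)] fr_self by metis
  ultimately have "(\<Union>(A, B)\<in>fr a b. \<Union>(C, D)\<in>fr c d. fraction_rel V `` {(A * C, B * D)}) = fr (\<lambda>p. a p * c p) (\<lambda>p. b p * d p)"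
    using cls by fastforce
  thus ?thesis by (simp add: function_field_def)
qed

lemma nz_1: "nz (\<lambda>_. 1)"
  using origin_C by (auto simp: nz_def)

lemma R_const: "(\<lambda>_. c) \<in> R"
  by (simp add: polyfuns.const)

lemma ev_01: "ev 0 = (\<lambda>_. 0)" "ev 1 = (\<lambda>_. 1)"
  by (auto simp: mpol_eval_simps)

lemma fr_one: "\<one>\<^bsub>FF\<^esub> = fr (\<lambda>_. 1) (\<lambda>_. 1)"
proof -
  have "(1, 1) \<in> fractions V" using nz_1 homogeneous_1 by (auto simp: fractions_iff ev_01)
  from fraction_rel_class[OF this] show ?thesis by (simp add: function_field_def ev_01)
qed

lemma fr_zero: "\<zero>\<^bsub>FF\<^esub> = fr (\<lambda>_. 0) (\<lambda>_. 1)"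
proof -
  have "(0, 1) \<in> fractions V" using nz_1 homogeneous_1 homogeneous_0 by (auto simp: fractions_iff ev_01)
  from fraction_rel_class[OF this] show ?thesis by (simp add: function_field_def ev_01)
qed

lemma fr_eq_zero_iff: "a \<in> R \<Longrightarrow> b \<in> R \<Longrightarrow> nz b \<Longrightarrow> fr a b = \<zero>\<^bsub>FF\<^esub> \<longleftrightarrow> \<not> nz a"
proof
  assume ab: "a \<in> R" "b \<in> R" "nz b" "fr a b = \<zero>\<^bsub>FF\<^esub>"
  hence "a p * 1 = 0 * b p" if "p \<in> C" for p
    by (intro fr_eqD[OF _ _ _ _ _ _ _ that]) (auto simp: fr_zero R_const nz_1)
  thus "\<not> nz a" by (auto simp: nz_def)
next
  assume "a \<in> R" "b \<in> R" "nz b" "\<not> nz a"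
  thus "fr a b = \<zero>\<^bsub>FF\<^esub>" unfolding fr_zero
    by (intro fr_eqI) (auto simp: R_const nz_1 nz_def)
qed

lemma R_power: "a \<in> R \<Longrightarrow> (\<lambda>p. a p ^ n) \<in> R"
  by (rule polyfuns_power) auto

lemma nz_power: "a \<in> R \<Longrightarrow> nz a \<Longrightarrow> nz (\<lambda>p. a p ^ n)"
  by (induction n) (auto intro!: nz_mult R_power simp: nz_1)

lemma fr_nat_pow:
  assumes "a \<in> R" "b \<in> R" "nz b"
  shows "fr a b [^]\<^bsub>FF\<^esub> (n::nat) = fr (\<lambda>p. a p ^ n) (\<lambda>p. b p ^ n)"
proof (induction n)
  case (Suc n)
  show ?case using assms by (simp add: Suc.IH fr_mult R_power nz_power mult.commute)
qed (simp add: fr_one)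

lemma fr_inv:
  assumes "a \<in> R" "b \<in> R" "nz a" "nz b"
  shows "inv\<^bsub>FF\<^esub> (fr a b) = fr b a"
proof -
  have 1: "fr a b \<otimes>\<^bsub>FF\<^esub> fr b a = \<one>\<^bsub>FF\<^esub>" "fr b a \<otimes>\<^bsub>FF\<^esub> fr a b = \<one>\<^bsub>FF\<^esub>"
    unfolding fr_one fr_mult[OF assms(1,2,2,1,4,3)] fr_mult[OF assms(2,1,1,2,3,4)]
    by (rule fr_eqI; use assms in \<open>auto intro!: polyfuns.mult nz_mult R_const nz_1\<close>)+
  have uniq: "y = fr b a" if y: "y \<in> carrier FF" "fr a b \<otimes>\<^bsub>FF\<^esub> y = \<one>\<^bsub>FF\<^esub>" for y
  proof -
    obtain c d where cd: "c \<in> R" "d \<in> R" "nz d" "y = fr c d" using carrier_fr y(1) by blast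
    have "fr (\<lambda>p. a p * c p) (\<lambda>p. b p * d p) = fr (\<lambda>_. 1) (\<lambda>_. 1)"
      using y(2) cd assms by (simp add: fr_mult fr_one)
    hence "(a p * c p) * 1 = 1 * (b p * d p)" if "p \<in> C" for p
      using that cd assms by (intro fr_eqD[where a = "\<lambda>p. a p * c p"]) (auto intro: polyfuns.mult nz_mult R_const nz_1)
    thus ?thesis unfolding cd(4) using cd assms by (intro fr_eqI) (auto simp: mult.commute)
  qed
  show ?thesis unfolding m_inv_def
    by (rule the_equality) (use 1 uniq fr_carrier assms in auto)
qed

lemma fr_int_pow:
  assumes "a \<in> R" "b \<in> R" "nz a" "nz b"
  shows "fr a b [^]\<^bsub>FF\<^esub> (k::int) =
    fr (\<lambda>p. a p ^ nat k * b p ^ nat (-k)) (\<lambda>p. b p ^ nat k * a p ^ nat (-k))"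
proof (cases "k \<ge> 0")
  case True
  hence "fr a b [^]\<^bsub>FF\<^esub> k = fr a b [^]\<^bsub>FF\<^esub> nat k" by (simp add: pow_nat)
  also have "\<dots> = fr (\<lambda>p. a p ^ nat k) (\<lambda>p. b p ^ nat k)" using assms by (intro fr_nat_pow)
  finally show ?thesis using True by simp
next
  case False
  hence "fr a b [^]\<^bsub>FF\<^esub> k = inv\<^bsub>FF\<^esub> (fr a b [^]\<^bsub>FF\<^esub> nat (-k))"
    by (simp add: int_pow_def nat_pow_def)
  also have "\<dots> = fr (\<lambda>p. b p ^ nat (-k)) (\<lambda>p. a p ^ nat (-k))"
    using assms by (simp add: fr_nat_pow fr_inv R_power nz_power)
  finally show ?thesis using False by simp
qed

end

section \<open>Orders of rational functions\<close>

text \<open>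
  An additive \<open>w\<close> that describes the local ring and its maximal ideal at \<open>P\<close> and attains 1 computes
  \<open>ord_at\<close>. Here \<open>w\<close> is given on the coordinate ring, and the order of \<open>a / b\<close> is \<open>w a - w b\<close>. The
  affine points use a multiplicity for \<open>w\<close>, the point at infinity minus the leading weight.
\<close>

locale gk_valuation = gk_curve q K for q and K :: "'k::alg_closed_field itself" +
  fixes P :: "('k, 4) ppoint" and w :: "'k point_fun \<Rightarrow> int"
  assumes w_mult: "\<And>a b. a \<in> R \<Longrightarrow> b \<in> R \<Longrightarrow> nz a \<Longrightarrow> nz b \<Longrightarrow> w (\<lambda>p. a p * b p) = w a + w b"
    and w_cong: "\<And>a b. a \<in> R \<Longrightarrow> b \<in> R \<Longrightarrow> nz a \<Longrightarrow> (\<And>p. p \<in> C \<Longrightarrow> a p = b p) \<Longrightarrow> w a = w b"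
    and local_ring: "\<And>a b. a \<in> R \<Longrightarrow> b \<in> R \<Longrightarrow> nz b \<Longrightarrow> fr a b \<in> local_ring V P \<longleftrightarrow> (nz a \<longrightarrow> w b \<le> w a)"
    and local_max_ideal: "\<And>a b. a \<in> R \<Longrightarrow> b \<in> R \<Longrightarrow> nz b \<Longrightarrow> fr a b \<in> local_max_ideal V P \<longleftrightarrow> (nz a \<longrightarrow> w b < w a)"
    and w_unif: "\<exists>s\<in>R. \<exists>t\<in>R. nz s \<and> nz t \<and> w s - w t = 1"
begin

lemma w_1: "w (\<lambda>_. 1) = 0"
  using w_mult[OF R_const R_const nz_1 nz_1] by simp

lemma w_power: "a \<in> R \<Longrightarrow> nz a \<Longrightarrow> w (\<lambda>p. a p ^ n) = int n * w a"
  by (induction n) (auto simp: w_1 w_mult R_power nz_power algebra_simps)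

lemma w_eq:
  assumes "a \<in> R" "b \<in> R" "c \<in> R" "d \<in> R" "nz a" "nz b" "nz d" "fr a b = fr c d"
  shows "nz c" "w a - w b = w c - w d"
proof -
  have eq: "a p * d p = c p * b p" if "p \<in> C" for p using assms that by (intro fr_eqD) auto
  have 1: "nz (\<lambda>p. a p * d p)" using assms by (intro nz_mult)
  hence "nz (\<lambda>p. c p * b p)" using eq by (auto simp: nz_def)
  thus c: "nz c" by (auto simp: nz_def)
  have "w (\<lambda>p. a p * d p) = w (\<lambda>p. c p * b p)" using assms eq 1 by (intro w_cong polyfuns.mult)
  thus "w a - w b = w c - w d" using assms c by (simp add: w_mult)
qed

lemma in_local_ring_carrier: "f \<in> local_ring V P \<Longrightarrow> f \<in> carrier FF"
  by (simp add: local_ring_def)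

text \<open>
  If \<open>a / b\<close> generates the maximal ideal, it divides an element of value 1 with a quotient of value
  \<open>\<ge> 0\<close>, while its own value is at least 1.
\<close>

lemma uniformizer_iff:
  assumes ab: "a \<in> R" "b \<in> R" "nz b"
  shows "uniformizer V P (fr a b) \<longleftrightarrow> nz a \<and> w a - w b = 1"
proof
  assume u: "uniformizer V P (fr a b)"
  hence lr: "fr a b \<in> local_ring V P"
    and lm: "local_max_ideal V P = {fr a b \<otimes>\<^bsub>FF\<^esub> u | u. u \<in> local_ring V P}"
    by (auto simp: uniformizer_def)
  obtain s t where st: "s \<in> R" "t \<in> R" "nz s" "nz t" "w s - w t = 1" using w_unif by blast
  hence "fr s t \<in> local_max_ideal V P" by (simp add: local_max_ideal)
  then obtain u where u: "u \<in> local_ring V P" "fr s t = fr a b \<otimes>\<^bsub>FF\<^esub> u" using lm by auto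
  obtain c d where cd: "c \<in> R" "d \<in> R" "nz d" "u = fr c d"
    using carrier_fr[OF in_local_ring_carrier[OF u(1)]] by blast
  have eq: "fr s t = fr (\<lambda>p. a p * c p) (\<lambda>p. b p * d p)" using u(2) ab cd by (simp add: fr_mult)
  have acbd: "(\<lambda>p. a p * c p) \<in> R" "(\<lambda>p. b p * d p) \<in> R" "nz (\<lambda>p. b p * d p)"
    using ab cd by (auto intro!: polyfuns.mult nz_mult)
  have "nz (\<lambda>p. a p * c p)" "w s - w t = w (\<lambda>p. a p * c p) - w (\<lambda>p. b p * d p)"
    using w_eq[OF st(1,2) acbd(1,2) st(3,4) acbd(3) eq] by auto
  moreover from this(1) have "nz a" "nz c" by (auto simp: nz_def)
  ultimately have 1: "nz a" "(w a - w b) + (w c - w d) = 1" "w d \<le> w c"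
    using st ab cd u(1) by (auto simp: w_mult local_ring)
  have "fr (\<lambda>_. 1) (\<lambda>_. 1) \<in> local_ring V P" by (simp add: local_ring R_const nz_1)
  hence "fr a b \<otimes>\<^bsub>FF\<^esub> fr (\<lambda>_. 1) (\<lambda>_. 1) \<in> local_max_ideal V P" using lm by blast
  hence "fr a b \<in> local_max_ideal V P" using ab by (simp add: fr_mult R_const nz_1)
  hence "w b < w a" using ab 1 by (simp add: local_max_ideal)
  with 1 show "nz a \<and> w a - w b = 1" by linarith
next
  assume a: "nz a \<and> w a - w b = 1"
  have lr: "fr a b \<in> local_ring V P" using a ab by (simp add: local_ring)
  have "fr a b \<otimes>\<^bsub>FF\<^esub> u \<in> local_max_ideal V P" if u: "u \<in> local_ring V P" for u
  proof -
    obtain c d where cd: "c \<in> R" "d \<in> R" "nz d" "u = fr c d"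
      using carrier_fr in_local_ring_carrier[OF u] by blast
    have "nz c \<longrightarrow> w d \<le> w c" using u cd by (simp add: local_ring)
    moreover have "nz c" if "nz (\<lambda>p. a p * c p)" using that by (auto simp: nz_def)
    ultimately show ?thesis using ab cd a
      by (auto simp: fr_mult local_max_ideal polyfuns.mult nz_mult w_mult)
  qed
  moreover have "\<exists>u\<in>local_ring V P. f = fr a b \<otimes>\<^bsub>FF\<^esub> u" if "f \<in> local_max_ideal V P" for f
  proof -
    have "f \<in> carrier FF" using that by (simp add: local_max_ideal_def)
    then obtain c d where cd: "c \<in> R" "d \<in> R" "nz d" "f = fr c d" using carrier_fr by blast
    have "nz c \<longrightarrow> w d < w c" using that cd by (simp add: local_max_ideal)
    moreover have "nz c" if "nz (\<lambda>p. c p * b p)" using that by (auto simp: nz_def)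
    ultimately have "fr (\<lambda>p. c p * b p) (\<lambda>p. d p * a p) \<in> local_ring V P"
      using ab cd a by (auto simp: local_ring polyfuns.mult nz_mult w_mult)
    moreover have "f = fr a b \<otimes>\<^bsub>FF\<^esub> fr (\<lambda>p. c p * b p) (\<lambda>p. d p * a p)"
    proof -
      have 1: "(\<lambda>p. c p * b p) \<in> R" "(\<lambda>p. d p * a p) \<in> R" "nz (\<lambda>p. d p * a p)"
        using ab cd a by (auto intro!: polyfuns.mult nz_mult)
      show ?thesis unfolding cd(4) fr_mult[OF ab(1,2) 1(1,2) ab(3) 1(3)]
        by (rule fr_eqI) (use ab cd 1 in \<open>auto intro!: polyfuns.mult nz_mult\<close>)
    qed
    ultimately show ?thesis by blast
  qed
  ultimately show "uniformizer V P (fr a b)" unfolding uniformizer_def using lr by blast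
qed

lemma ord_at_fr:
  assumes ab: "a \<in> R" "b \<in> R" "nz a" "nz b"
  shows "ord_at V P (fr a b) = w a - w b"
  unfolding ord_at_def
proof (rule the_equality)
  obtain s t where st: "s \<in> R" "t \<in> R" "nz s" "nz t" "w s - w t = 1" using w_unif by blast
  let ?k = "w a - w b"
  \<comment> \<open>\<open>sk / tk\<close> is the \<open>k\<close>-th power of the uniformizer \<open>s / t\<close>, for \<open>k\<close> of either sign.\<close>
  define sk where "sk p = s p ^ nat ?k * t p ^ nat (- ?k)" for p
  define tk where "tk p = t p ^ nat ?k * s p ^ nat (- ?k)" for p
  have stk: "sk \<in> R" "tk \<in> R" "nz sk" "nz tk"
    using st unfolding sk_def[abs_def] tk_def[abs_def] by (auto intro!: polyfuns.mult nz_mult R_power nz_power)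
  have "w sk - w tk = int (nat ?k) * (w s - w t) - int (nat (- ?k)) * (w s - w t)"
    unfolding sk_def[abs_def] tk_def[abs_def] using st by (simp add: w_mult w_power R_power nz_power algebra_simps)
  hence wk: "w sk - w tk = ?k" using st by simp
  show "\<exists>t u. uniformizer V P t \<and> u \<in> local_ring V P - local_max_ideal V P \<and>
          fr a b = (t [^]\<^bsub>FF\<^esub> ?k) \<otimes>\<^bsub>FF\<^esub> u"
  proof (intro exI conjI)
    show "uniformizer V P (fr s t)" using st by (simp add: uniformizer_iff)
    show "fr (\<lambda>p. a p * tk p) (\<lambda>p. b p * sk p) \<in> local_ring V P - local_max_ideal V P"
      using ab stk wk by (auto simp: local_ring local_max_ideal polyfuns.mult nz_mult w_mult)
    have "fr s t [^]\<^bsub>FF\<^esub> ?k = fr sk tk" using st by (simp add: fr_int_pow sk_def[abs_def] tk_def[abs_def])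
    thus "fr a b = (fr s t [^]\<^bsub>FF\<^esub> ?k) \<otimes>\<^bsub>FF\<^esub> fr (\<lambda>p. a p * tk p) (\<lambda>p. b p * sk p)"
    proof -
      have 1: "(\<lambda>p. a p * tk p) \<in> R" "(\<lambda>p. b p * sk p) \<in> R" "nz (\<lambda>p. b p * sk p)"
        using ab stk by (auto intro!: polyfuns.mult nz_mult)
      assume eq: "fr s t [^]\<^bsub>FF\<^esub> ?k = fr sk tk"
      show ?thesis unfolding eq fr_mult[OF stk(1,2) 1(1,2) stk(4) 1(3)]
        by (rule fr_eqI) (use ab stk 1 in \<open>auto intro!: polyfuns.mult nz_mult\<close>)
    qed
  qed
next
  fix k :: int assume "\<exists>t u. uniformizer V P t \<and> u \<in> local_ring V P - local_max_ideal V P \<and>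
          fr a b = (t [^]\<^bsub>FF\<^esub> k) \<otimes>\<^bsub>FF\<^esub> u"
  then obtain t0 u where tu: "uniformizer V P t0" "u \<in> local_ring V P" "u \<notin> local_max_ideal V P"
      "fr a b = (t0 [^]\<^bsub>FF\<^esub> k) \<otimes>\<^bsub>FF\<^esub> u" by blast
  obtain s t where st: "s \<in> R" "t \<in> R" "nz t" "t0 = fr s t"
  proof -
    have "t0 \<in> carrier FF" using tu(1) by (auto simp: uniformizer_def intro: in_local_ring_carrier)
    from carrier_fr[OF this] show ?thesis using that by blast
  qed
  have st': "nz s" "w s - w t = 1" using tu(1) st uniformizer_iff by auto
  obtain c d where cd: "c \<in> R" "d \<in> R" "nz d" "u = fr c d"
    using carrier_fr[OF in_local_ring_carrier[OF tu(2)]] by blast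
  have c: "nz c" "w c = w d" using tu(2,3) cd by (auto simp: local_ring local_max_ideal)
  define sk where "sk p = s p ^ nat k * t p ^ nat (- k)" for p
  define tk where "tk p = t p ^ nat k * s p ^ nat (- k)" for p
  have stk: "sk \<in> R" "tk \<in> R" "nz sk" "nz tk"
    using st st' unfolding sk_def[abs_def] tk_def[abs_def] by (auto intro!: polyfuns.mult nz_mult R_power nz_power)
  have "w sk - w tk = int (nat k) * (w s - w t) - int (nat (- k)) * (w s - w t)"
    unfolding sk_def[abs_def] tk_def[abs_def] using st st' by (simp add: w_mult w_power R_power nz_power algebra_simps)
  hence wk: "w sk - w tk = k" using st' by simp
  have "fr a b = fr sk tk \<otimes>\<^bsub>FF\<^esub> fr c d"
    using tu(4) st st' cd by (simp add: fr_int_pow sk_def[abs_def] tk_def[abs_def])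
  hence eq: "fr a b = fr (\<lambda>p. sk p * c p) (\<lambda>p. tk p * d p)" using stk cd by (simp add: fr_mult)
  have m: "(\<lambda>p. sk p * c p) \<in> R" "(\<lambda>p. tk p * d p) \<in> R" "nz (\<lambda>p. tk p * d p)"
    using stk cd by (auto intro!: polyfuns.mult nz_mult)
  have "w a - w b = w (\<lambda>p. sk p * c p) - w (\<lambda>p. tk p * d p)"
    by (rule w_eq(2)[OF ab(1,2) m(1,2) ab(3,4) m(3) eq])
  thus "k = w a - w b" using stk cd c wk by (simp add: w_mult)
qed

end

section \<open>Valuations at the affine points\<close>

context gk_curve
begin

lemma R_diff: "f \<in> R \<Longrightarrow> g \<in> R \<Longrightarrow> (\<lambda>p. f p - g p) \<in> R"
  by (rule polyfuns_diff) auto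

lemma R_sum: "(\<And>i. i \<in> I \<Longrightarrow> f i \<in> R) \<Longrightarrow> (\<lambda>p. \<Sum>i\<in>I. f i p) \<in> R"
  by (rule polyfuns_sum) auto

lemmas R_intros = polyfuns.add polyfuns.mult R_diff R_sum R_power R_const polyfuns.X polyfuns.Y polyfuns.Z

lemma z_minus_nz: "nz (\<lambda>p. zc p - c)"
proof -
  have "card {P \<in> C. zc P = c + 1} > 0" using q2 by (simp add: fibre_card)
  then obtain P where "P \<in> C" "zc P = c + 1" by (auto simp: card_gt_0_iff)
  hence "zc P - c \<noteq> 0" by simp
  thus ?thesis unfolding nz_def using \<open>P \<in> C\<close> by blast
qed

text \<open>
  \<open>f\<close> lies in the ideal of the local ring at \<open>P\<close> generated by \<open>z - z(P)\<close>.
\<close>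

definition z_divides :: "'k point \<Rightarrow> 'k point_fun \<Rightarrow> bool" where
  "z_divides P f \<longleftrightarrow> (\<exists>u\<in>R. \<exists>v\<in>R. v P \<noteq> 0 \<and> (\<forall>Q\<in>C. f Q * v Q = (zc Q - zc P) * u Q))"

lemma z_dividesI:
  assumes "u \<in> R" "v \<in> R" "v P \<noteq> 0" "\<And>Q. Q \<in> C \<Longrightarrow> f Q * v Q = (zc Q - zc P) * u Q"
  shows "z_divides P f"
  using assms unfolding z_divides_def by blast

text \<open>
  By additivity of the Frobenius map, with \<open>d = y - y(P)\<close>, \<open>d (d\<^bsup>q\<^sup>2 - 1\<^esup> - 1) = z\<^sup>M - z(P)\<^sup>M\<close>, and the second factor
  on the left is a unit at \<open>P\<close>. For \<open>x\<close> the same is done with \<open>y\<^sup>q\<^sup>+\<^sup>1\<close> on the right.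
\<close>

lemma z_divides_y:
  assumes "P \<in> C" shows "z_divides P (\<lambda>Q. yc Q - yc P)"
proof (rule z_dividesI)
  let ?v = "\<lambda>Q. (yc Q - yc P) ^ (q\<^sup>2 - 1) - 1"
  let ?u = "\<lambda>Q. \<Sum>i<M. zc P ^ (M - Suc i) * zc Q ^ i"
  have qq: "q\<^sup>2 > 1" using q2 one_less_power[of q 2] by simp
  show "?u \<in> R" "?v \<in> R" by (intro R_intros)+
  show "?v P \<noteq> 0" using qq by (simp add: zero_power)
  fix Q assume Q: "Q \<in> C"
  let ?y = "yc Q" and ?yP = "yc P"
  have "Suc (q\<^sup>2 - 1) = q\<^sup>2" using qq by simp
  hence "(?y - ?yP) * (?y - ?yP) ^ (q\<^sup>2 - 1) = (?y - ?yP) ^ (q\<^sup>2)" by (metis power_Suc)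
  hence "(?y - ?yP) * ?v Q = (?y - ?yP) ^ (q\<^sup>2) - (?y - ?yP)"
    by (simp only: right_diff_distrib mult_1_right)
  also have "\<dots> = (?y ^ (q\<^sup>2) - ?y) - (?yP ^ (q\<^sup>2) - ?yP)" by (simp add: frob2_diff)
  also have "\<dots> = zc Q ^ M - zc P ^ M" using Q assms by (auto simp: C_def)
  also have "\<dots> = (zc Q - zc P) * ?u Q" by (rule power_diff_sumr2)
  finally show "(?y - ?yP) * ?v Q = (zc Q - zc P) * ?u Q" .
qed

lemma z_divides_x:
  assumes "P \<in> C" shows "z_divides P (\<lambda>Q. fst Q - fst P)"
proof -
  obtain u v where uv: "u \<in> R" "v \<in> R" "v P \<noteq> 0"
     "\<And>Q. Q \<in> C \<Longrightarrow> (yc Q - yc P) * v Q = (zc Q - zc P) * u Q"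
    using z_divides_y[OF assms] unfolding z_divides_def by blast
  let ?v = "\<lambda>Q. (fst Q - fst P) ^ (q - 1) + 1"
  let ?u = "\<lambda>Q. \<Sum>i<q+1. yc P ^ (q + 1 - Suc i) * yc Q ^ i"
  have v: "?v \<in> R" and u: "?u \<in> R" by (intro R_intros)+
  show ?thesis
  proof (rule z_dividesI)
    show "(\<lambda>Q. u Q * ?u Q) \<in> R" by (rule polyfuns.mult[OF uv(1) u])
    show "(\<lambda>Q. ?v Q * v Q) \<in> R" by (rule polyfuns.mult[OF v uv(2)])
    have "q - 1 > 0" using q2 by simp
    thus "?v P * v P \<noteq> 0" using uv(3) by (simp add: zero_power)
    fix Q assume Q: "Q \<in> C"
    let ?x = "fst Q" and ?xP = "fst P" and ?y = "yc Q" and ?yP = "yc P"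
    have "(?x - ?xP) * ?v Q = (?x - ?xP) ^ q + (?x - ?xP)"
    proof -
      have "(?x - ?xP) * (?x - ?xP) ^ (q - 1) = (?x - ?xP) ^ q"
        using q2 power_Suc[of "?x - ?xP" "q - 1"] by simp
      thus ?thesis by (simp only: distrib_left mult_1_right)
    qed
    also have "\<dots> = (?x ^ q + ?x) - (?xP ^ q + ?xP)" by (simp add: frob_diff)
    also have "\<dots> = ?y ^ (q + 1) - ?yP ^ (q + 1)" using Q assms by (auto simp: C_def)
    also have "\<dots> = (?y - ?yP) * ?u Q" by (rule power_diff_sumr2)
    finally have "(?x - ?xP) * (?v Q * v Q) = ((?y - ?yP) * v Q) * ?u Q" by (simp only: mult_ac)
    thus "(?x - ?xP) * (?v Q * v Q) = (zc Q - zc P) * (u Q * ?u Q)"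
      unfolding uv(4)[OF Q] by (simp only: mult_ac)
  qed
qed

lemma z_divides_add:
  assumes "z_divides P f" "z_divides P g" shows "z_divides P (\<lambda>Q. f Q + g Q)"
proof -
  obtain u v where uv: "u \<in> R" "v \<in> R" "v P \<noteq> 0" "\<And>Q. Q \<in> C \<Longrightarrow> f Q * v Q = (zc Q - zc P) * u Q"
    using assms(1) unfolding z_divides_def by blast
  obtain u' v' where uv': "u' \<in> R" "v' \<in> R" "v' P \<noteq> 0" "\<And>Q. Q \<in> C \<Longrightarrow> g Q * v' Q = (zc Q - zc P) * u' Q"
    using assms(2) unfolding z_divides_def by blast
  show ?thesis
  proof (rule z_dividesI)
    show "(\<lambda>Q. u Q * v' Q + u' Q * v Q) \<in> R" "(\<lambda>Q. v Q * v' Q) \<in> R" using uv uv' by (auto intro!: R_intros)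
    show "v P * v' P \<noteq> 0" using uv uv' by simp
    fix Q assume Q: "Q \<in> C"
    have "(f Q + g Q) * (v Q * v' Q) = (f Q * v Q) * v' Q + (g Q * v' Q) * v Q" by (simp add: algebra_simps)
    thus "(f Q + g Q) * (v Q * v' Q) = (zc Q - zc P) * (u Q * v' Q + u' Q * v Q)"
      unfolding uv(4)[OF Q] uv'(4)[OF Q] by (simp add: algebra_simps)
  qed
qed

lemma z_divides_mult:
  assumes "z_divides P f" "g \<in> R" shows "z_divides P (\<lambda>Q. g Q * f Q)"
proof -
  obtain u v where uv: "u \<in> R" "v \<in> R" "v P \<noteq> 0" "\<And>Q. Q \<in> C \<Longrightarrow> f Q * v Q = (zc Q - zc P) * u Q"
    using assms(1) unfolding z_divides_def by blast
  show ?thesis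
  proof (rule z_dividesI[of "\<lambda>Q. g Q * u Q" v])
    show "(\<lambda>Q. g Q * u Q) \<in> R" using uv assms by (auto intro!: R_intros)
    fix Q assume Q: "Q \<in> C"
    show "g Q * f Q * v Q = (zc Q - zc P) * (g Q * u Q)" using uv(4)[OF Q] by (metis mult.left_commute mult.assoc)
  qed (use uv in auto)
qed

text \<open>
  \<open>z - z(P)\<close> generates the maximal ideal at \<open>P\<close>: the affine curve is etale over the \<open>z\<close>-line.
\<close>

lemma z_divides_diff:
  assumes P: "P \<in> C" and f: "f \<in> R"
  shows "z_divides P (\<lambda>Q. f Q - f P)"
  using f
proof induction
  case (const c)
  show ?case by (rule z_dividesI[of "\<lambda>_. 0" "\<lambda>_. 1"]) (auto intro: R_const)
next
  case X show ?case using z_divides_x[OF P] by simp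
next
  case Y show ?case using z_divides_y[OF P] by simp
next
  case Z show ?case by (rule z_dividesI[of "\<lambda>_. 1" "\<lambda>_. 1"]) (auto intro: R_const)
next
  case (add f g)
  show ?case using z_divides_add[OF add.IH] by (simp add: algebra_simps)
next
  case (mult f g)
  have "z_divides P (\<lambda>Q. g Q * (f Q - f P) + f P * (g Q - g P))"
    using mult by (intro z_divides_add z_divides_mult R_const)
  moreover have "(\<lambda>Q. g Q * (f Q - f P) + f P * (g Q - g P)) = (\<lambda>Q. f Q * g Q - f P * g P)"
    by (auto simp: algebra_simps)
  ultimately show ?case by simp
qed

text \<open>
  \<open>a\<close> is \<open>(z - z(P))\<^sup>k\<close> times a unit \<open>u / v\<close> of the local ring at \<open>P\<close>.
\<close>

definition order_at :: "'k point \<Rightarrow> 'k point_fun \<Rightarrow> nat \<Rightarrow> bool" where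
  "order_at P a k \<longleftrightarrow> (\<exists>u\<in>R. \<exists>v\<in>R. u P \<noteq> 0 \<and> v P \<noteq> 0 \<and> (\<forall>Q\<in>C. a Q * v Q = (zc Q - zc P) ^ k * u Q))"

lemma order_atE:
  assumes "order_at P a k"
  obtains u v where "u \<in> R" "v \<in> R" "u P \<noteq> 0" "v P \<noteq> 0" "\<And>Q. Q \<in> C \<Longrightarrow> a Q * v Q = (zc Q - zc P) ^ k * u Q"
  using assms unfolding order_at_def by blast

lemma order_atI:
  assumes "u \<in> R" "v \<in> R" "u P \<noteq> 0" "v P \<noteq> 0" "\<And>Q. Q \<in> C \<Longrightarrow> a Q * v Q = (zc Q - zc P) ^ k * u Q"
  shows "order_at P a k"
  using assms unfolding order_at_def by blast

lemma z_power_cancel: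
  assumes P: "P \<in> C" and R: "f \<in> R" "g \<in> R"
    and eq: "\<And>Q. Q \<in> C \<Longrightarrow> (zc Q - zc P) ^ k * f Q = (zc Q - zc P) ^ l * g Q" and f: "f P \<noteq> 0"
  shows "l \<le> k"
proof (rule ccontr)
  assume "\<not> l \<le> k"
  then obtain j where j: "l = k + Suc j" by (metis add_Suc_right less_imp_Suc_add not_le)
  have "f P = (zc P - zc P) ^ Suc j * g P"
  proof (rule nz_cancel[where h = "\<lambda>Q. (zc Q - zc P) ^ k" and f = f and g = "\<lambda>Q. (zc Q - zc P) ^ Suc j * g Q", OF R(1) _ _ _ _ P])
    show "(\<lambda>Q. (zc Q - zc P) ^ Suc j * g Q) \<in> R" "(\<lambda>Q. (zc Q - zc P) ^ k) \<in> R"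
      using R by (auto intro!: R_intros simp del: power_Suc)
    show "nz (\<lambda>Q. (zc Q - zc P) ^ k)" by (intro nz_power z_minus_nz R_intros)
    show "(zc Q - zc P) ^ k * f Q = (zc Q - zc P) ^ k * ((zc Q - zc P) ^ Suc j * g Q)" if "Q \<in> C" for Q
      using eq[OF that] by (simp only: j power_add mult.assoc)
  qed
  thus False using f by simp
qed

lemma order_at_le:
  assumes P: "P \<in> C" and "order_at P a k" "order_at P a l" shows "l \<le> k"
proof -
  obtain u v where uv: "u \<in> R" "v \<in> R" "u P \<noteq> 0" "v P \<noteq> 0" "\<And>Q. Q \<in> C \<Longrightarrow> a Q * v Q = (zc Q - zc P) ^ k * u Q"
    using order_atE[OF assms(2)] by blast
  obtain u' v' where uv': "u' \<in> R" "v' \<in> R" "u' P \<noteq> 0" "v' P \<noteq> 0" "\<And>Q. Q \<in> C \<Longrightarrow> a Q * v' Q = (zc Q - zc P) ^ l * u' Q"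
    using order_atE[OF assms(3)] by blast
  show ?thesis
  proof (rule z_power_cancel[OF P, where f = "\<lambda>Q. u Q * v' Q" and g = "\<lambda>Q. u' Q * v Q"])
    fix Q assume Q: "Q \<in> C"
    have "(a Q * v Q) * v' Q = (a Q * v' Q) * v Q" by simp
    thus "(zc Q - zc P) ^ k * (u Q * v' Q) = (zc Q - zc P) ^ l * (u' Q * v Q)"
      unfolding uv(5)[OF Q] uv'(5)[OF Q] by (simp only: mult.assoc)
  qed (use uv uv' in \<open>auto intro: polyfuns.mult\<close>)
qed

lemma order_at_unique: "P \<in> C \<Longrightarrow> order_at P a k \<Longrightarrow> order_at P a l \<Longrightarrow> k = l"
  using order_at_le by (metis le_antisym)

lemma order_at_mult:
  assumes "order_at P a k" "order_at P b l" shows "order_at P (\<lambda>Q. a Q * b Q) (k + l)"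
proof -
  obtain u v where uv: "u \<in> R" "v \<in> R" "u P \<noteq> 0" "v P \<noteq> 0" "\<And>Q. Q \<in> C \<Longrightarrow> a Q * v Q = (zc Q - zc P) ^ k * u Q"
    using order_atE[OF assms(1)] by blast
  obtain u' v' where uv': "u' \<in> R" "v' \<in> R" "u' P \<noteq> 0" "v' P \<noteq> 0" "\<And>Q. Q \<in> C \<Longrightarrow> b Q * v' Q = (zc Q - zc P) ^ l * u' Q"
    using order_atE[OF assms(2)] by blast
  show ?thesis
  proof (rule order_atI)
    show "(\<lambda>Q. u Q * u' Q) \<in> R" "(\<lambda>Q. v Q * v' Q) \<in> R" using uv uv' by (auto intro: polyfuns.mult)
    fix Q assume Q: "Q \<in> C"
    have "a Q * b Q * (v Q * v' Q) = (a Q * v Q) * (b Q * v' Q)" by simp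
    thus "a Q * b Q * (v Q * v' Q) = (zc Q - zc P) ^ (k + l) * (u Q * u' Q)"
      unfolding uv(5)[OF Q] uv'(5)[OF Q] by (simp only: power_add mult_ac)
  qed (use uv uv' in auto)
qed

lemma order_at_unit: "a \<in> R \<Longrightarrow> a P \<noteq> 0 \<Longrightarrow> order_at P a 0"
  by (rule order_atI[of a "\<lambda>_. 1"]) (auto intro: R_const)

lemma order_at_z: "order_at P (\<lambda>Q. zc Q - zc P) 1"
  by (rule order_atI[of "\<lambda>_. 1" "\<lambda>_. 1"]) (auto intro: R_const)

lemma order_at_cong: "order_at P a k \<Longrightarrow> (\<And>Q. Q \<in> C \<Longrightarrow> b Q = a Q) \<Longrightarrow> order_at P b k"
  unfolding order_at_def by simp

text \<open>
  A multiple of \<open>a\<close> is a nonzero polynomial in \<open>z\<close>, and the order of its root \<open>z(P)\<close> bounds the powers of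
  \<open>z - z(P)\<close> that divide \<open>a\<close> locally. For the largest one the cofactor cannot vanish at \<open>P\<close>.
\<close>

lemma order_at_exists:
  assumes P: "P \<in> C" and a: "a \<in> R" "nz a"
  shows "\<exists>k. order_at P a k"
proof -
  obtain b p where b: "b \<in> R" "p \<noteq> 0" "\<And>Q. Q \<in> C \<Longrightarrow> a Q * b Q = poly p (zc Q)"
    using norm_multiple[OF a] by blast
  define e where "e = order (zc P) p"
  obtain r where r: "p = [:- zc P, 1:] ^ e * r" "\<not> [:- zc P, 1:] dvd r"
    using order_decomp[OF b(2), of "zc P"] unfolding e_def by blast
  hence rP: "poly r (zc P) \<noteq> 0" by (simp add: poly_eq_0_iff_dvd)
  \<comment> \<open>The exponents \<open>k\<close> for which \<open>(z - z(P))\<^sup>k\<close> divides \<open>a\<close> in the local ring.\<close>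
  define S where "S = {k. \<exists>u\<in>R. \<exists>v\<in>R. v P \<noteq> 0 \<and> (\<forall>Q\<in>C. a Q * v Q = (zc Q - zc P) ^ k * u Q)}"
  have bound: "k \<le> e" if k: "k \<in> S" for k
  proof -
    obtain u v where uv: "u \<in> R" "v \<in> R" "v P \<noteq> 0" "\<And>Q. Q \<in> C \<Longrightarrow> a Q * v Q = (zc Q - zc P) ^ k * u Q"
      using k unfolding S_def by blast
    show ?thesis
    proof (rule z_power_cancel[OF P, where f = "\<lambda>Q. poly r (zc Q) * v Q" and g = "\<lambda>Q. u Q * b Q"])
      fix Q assume Q: "Q \<in> C"
      have "(a Q * b Q) * v Q = (a Q * v Q) * b Q" by simp
      thus "(zc Q - zc P) ^ e * (poly r (zc Q) * v Q) = (zc Q - zc P) ^ k * (u Q * b Q)"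
        unfolding b(3)[OF Q] uv(4)[OF Q] r(1) by (simp add: mult.assoc)
    qed (use uv rP b(1) in \<open>auto intro!: polyfuns.mult polyfuns_poly\<close>)
  qed
  have "0 \<in> S" unfolding S_def 
    using a(1) by (intro CollectI bexI[of _ a] bexI[of _ "\<lambda>_. 1"]) (auto intro: R_const)
  moreover have finS: "finite S" using bound by (auto intro: finite_subset[of _ "{..e}"])
  ultimately have "Max S \<in> S" by (intro Max_in) auto
  then obtain u v where uv: "u \<in> R" "v \<in> R" "v P \<noteq> 0" "\<And>Q. Q \<in> C \<Longrightarrow> a Q * v Q = (zc Q - zc P) ^ Max S * u Q"
    unfolding S_def by blast
  have "u P \<noteq> 0"
  proof
    assume "u P = 0"
    hence "z_divides P u" using z_divides_diff[OF P uv(1)] by simp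
    then obtain u' v' where uv': "u' \<in> R" "v' \<in> R" "v' P \<noteq> 0" "\<And>Q. Q \<in> C \<Longrightarrow> u Q * v' Q = (zc Q - zc P) * u' Q"
      unfolding z_divides_def by blast
    have "a Q * (v Q * v' Q) = (zc Q - zc P) ^ Suc (Max S) * u' Q" if Q: "Q \<in> C" for Q
    proof -
      have "a Q * (v Q * v' Q) = (zc Q - zc P) ^ Max S * (u Q * v' Q)"
        using uv(4)[OF Q] by (simp only: mult.assoc[symmetric])
      thus ?thesis unfolding uv'(4)[OF Q] by (simp add: mult_ac)
    qed
    moreover have "(\<lambda>Q. v Q * v' Q) \<in> R" "v P * v' P \<noteq> 0" using uv uv' by (auto intro: polyfuns.mult)
    ultimately have "\<exists>u\<in>R. \<exists>v\<in>R. v P \<noteq> 0 \<and> (\<forall>Q\<in>C. a Q * v Q = (zc Q - zc P) ^ Suc (Max S) * u Q)"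
      using uv'(1) by (intro bexI[of _ u'] bexI[of _ "\<lambda>Q. v Q * v' Q"]) auto
    hence "Suc (Max S) \<in> S" by (subst S_def) (rule CollectI)
    hence "Suc (Max S) \<le> Max S" using finS by (intro Max_ge)
    thus False by simp
  qed
  thus ?thesis using uv order_atI by blast
qed

definition mult_at :: "'k point \<Rightarrow> 'k point_fun \<Rightarrow> nat" where
  "mult_at P a = (THE k. order_at P a k)"

lemma mult_at_eq: "P \<in> C \<Longrightarrow> order_at P a k \<Longrightarrow> mult_at P a = k"
  unfolding mult_at_def using order_at_unique by blast

lemma order_at_mult_at: "P \<in> C \<Longrightarrow> a \<in> R \<Longrightarrow> nz a \<Longrightarrow> order_at P a (mult_at P a)"
  using order_at_exists mult_at_eq by blast

lemma nz_at: "P \<in> C \<Longrightarrow> a P \<noteq> 0 \<Longrightarrow> nz a"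
  unfolding nz_def by blast

lemma mult_at_mult: "P \<in> C \<Longrightarrow> a \<in> R \<Longrightarrow> b \<in> R \<Longrightarrow> nz a \<Longrightarrow> nz b \<Longrightarrow> mult_at P (\<lambda>Q. a Q * b Q) = mult_at P a + mult_at P b"
  using order_at_mult order_at_mult_at mult_at_eq by blast

lemma mult_at_cong: "P \<in> C \<Longrightarrow> a \<in> R \<Longrightarrow> nz a \<Longrightarrow> (\<And>Q. Q \<in> C \<Longrightarrow> b Q = a Q) \<Longrightarrow> mult_at P b = mult_at P a"
  by (intro mult_at_eq order_at_cong[OF order_at_mult_at])

lemma mult_at_unit: "P \<in> C \<Longrightarrow> a \<in> R \<Longrightarrow> a P \<noteq> 0 \<Longrightarrow> mult_at P a = 0"
  by (intro mult_at_eq order_at_unit)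

text \<open>
  A representation of \<open>a / b\<close> that shows its regularity, or its vanishing, at \<open>P\<close>.
\<close>

lemma fr_quotient:
  assumes "P \<in> C" "a \<in> R" "b \<in> R" "nz a" "nz b" "mult_at P b \<le> mult_at P a"
  shows "\<exists>c\<in>R. \<exists>d\<in>R. d P \<noteq> 0 \<and> (\<forall>Q\<in>C. a Q * d Q = c Q * b Q) \<and> (mult_at P b < mult_at P a \<longrightarrow> c P = 0)"
proof -
  define k l where "k = mult_at P a" and "l = mult_at P b"
  obtain u v where uv: "u \<in> R" "v \<in> R" "u P \<noteq> 0" "v P \<noteq> 0" "\<And>Q. Q \<in> C \<Longrightarrow> a Q * v Q = (zc Q - zc P) ^ k * u Q"
    using order_atE[OF order_at_mult_at[OF assms(1,2,4)]] unfolding k_def by blast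
  obtain u' v' where uv': "u' \<in> R" "v' \<in> R" "u' P \<noteq> 0" "v' P \<noteq> 0" "\<And>Q. Q \<in> C \<Longrightarrow> b Q * v' Q = (zc Q - zc P) ^ l * u' Q"
    using order_atE[OF order_at_mult_at[OF assms(1,3,5)]] unfolding l_def by blast
  obtain j where j: "k = j + l" using assms(6) le_Suc_ex k_def l_def by (metis add.commute)
  define c d where "c = (\<lambda>Q. (zc Q - zc P) ^ j * (u Q * v' Q))" and "d = (\<lambda>Q. u' Q * v Q)"
  have "c \<in> R" "d \<in> R" unfolding c_def d_def using uv uv' by (auto intro!: R_intros)
  moreover have "d P \<noteq> 0" using uv uv' by (simp add: d_def)
  moreover have "a Q * d Q = c Q * b Q" if Q: "Q \<in> C" for Q
  proof -
    have "a Q * (u' Q * v Q) = (a Q * v Q) * u' Q" by simp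
    also have "\<dots> = (zc Q - zc P) ^ j * u Q * ((zc Q - zc P) ^ l * u' Q)"
      unfolding uv(5)[OF Q] j power_add by (simp only: mult_ac)
    also have "\<dots> = (zc Q - zc P) ^ j * (u Q * v' Q) * b Q"
      unfolding uv'(5)[OF Q, symmetric] by (simp only: mult_ac)
    finally show ?thesis by (simp only: c_def d_def)
  qed
  moreover have "c P = 0" if "mult_at P b < mult_at P a"
  proof -
    have "j > 0" using j that by (simp add: k_def l_def)
    thus ?thesis by (simp add: c_def)
  qed
  ultimately show ?thesis by blast
qed

lemma local_ring_aff:
  assumes P: "P \<in> C" and ab: "a \<in> R" "b \<in> R" "nz b"
  shows "fr a b \<in> local_ring V (aff P) \<longleftrightarrow> (nz a \<longrightarrow> mult_at P b \<le> mult_at P a)"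
    and "fr a b \<in> local_max_ideal V (aff P) \<longleftrightarrow> (nz a \<longrightarrow> mult_at P b < mult_at P a)"
proof -
  have 1: "fr a b \<in> local_ring V (aff P) \<longleftrightarrow> (\<exists>c\<in>R. \<exists>d\<in>R. d P \<noteq> 0 \<and> (\<forall>Q\<in>C. a Q * d Q = c Q * b Q))" (is "_ \<longleftrightarrow> ?E1")
   and 2: "fr a b \<in> local_max_ideal V (aff P) \<longleftrightarrow> (\<exists>c\<in>R. \<exists>d\<in>R. d P \<noteq> 0 \<and> c P = 0 \<and> (\<forall>Q\<in>C. a Q * d Q = c Q * b Q))" (is "_ \<longleftrightarrow> ?E2")
  proof -
    have to: "\<exists>c\<in>R. \<exists>d\<in>R. d P \<noteq> 0 \<and> (vanishes_at A (aff P) \<longrightarrow> c P = 0) \<and> (\<forall>Q\<in>C. a Q * d Q = c Q * b Q)"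
      if AB: "(A, B) \<in> fr a b" "\<not> vanishes_at B (aff P)" for A B
    proof -
      obtain d where "homogeneous d A" "homogeneous d B" using AB(1) unfolding fr_def fractions_iff by blast
      thus ?thesis using AB ev_R
        by (intro bexI[of _ "ev A"] bexI[of _ "ev B"]) (auto simp: vanishes_at_aff fr_def)
    qed
    have from_: "\<exists>(A, B)\<in>fr a b. \<not> vanishes_at B (aff P) \<and> (c P = 0 \<longrightarrow> vanishes_at A (aff P))"
      if cd: "c \<in> R" "d \<in> R" "d P \<noteq> 0" "\<forall>Q\<in>C. a Q * d Q = c Q * b Q" for c d
    proof -
      obtain A B where AB: "(A, B) \<in> fractions V" "ev A = c" "ev B = d"
        using fr_rep'[OF cd(1,2)] nz_at[where a = d, OF P cd(3)] by blast
      obtain e where e: "homogeneous e A" "homogeneous e B" using AB(1) unfolding fractions_iff by blast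
      have "(A, B) \<in> fr a b" using AB cd(4) by (auto simp: fr_def)
      moreover have "\<not> vanishes_at B (aff P)" "c P = 0 \<longrightarrow> vanishes_at A (aff P)"
        using vanishes_at_aff[OF e(1)] vanishes_at_aff[OF e(2)] AB cd(3) by auto
      ultimately show ?thesis by blast
    qed
    have car: "fr a b \<in> carrier FF" by (rule fr_carrier[OF ab])
    show "fr a b \<in> local_ring V (aff P) \<longleftrightarrow> ?E1"
    proof
      assume "fr a b \<in> local_ring V (aff P)"
      then obtain A B where "(A, B) \<in> fr a b" "\<not> vanishes_at B (aff P)" unfolding local_ring_def by blast
      from to[OF this] show ?E1 by blast
    next
      assume ?E1
      then obtain c d where "c \<in> R" "d \<in> R" "d P \<noteq> 0" "\<forall>Q\<in>C. a Q * d Q = c Q * b Q" by blast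
      from from_[OF this] car show "fr a b \<in> local_ring V (aff P)" unfolding local_ring_def by blast
    qed
    show "fr a b \<in> local_max_ideal V (aff P) \<longleftrightarrow> ?E2"
    proof
      assume "fr a b \<in> local_max_ideal V (aff P)"
      then obtain A B where "(A, B) \<in> fr a b" "\<not> vanishes_at B (aff P)" "vanishes_at A (aff P)" unfolding local_max_ideal_def by blast
      from to[OF this(1,2)] this(3) show ?E2 by blast
    next
      assume ?E2
      then obtain c d where "c \<in> R" "d \<in> R" "d P \<noteq> 0" "\<forall>Q\<in>C. a Q * d Q = c Q * b Q" "c P = 0" by blast
      from from_[OF this(1-4)] this(5) car show "fr a b \<in> local_max_ideal V (aff P)" unfolding local_max_ideal_def by blast
    qed
  qed
  have mul: "nz c \<and> mult_at P a = mult_at P c + mult_at P b"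
    if "nz a" "c \<in> R" "d \<in> R" "d P \<noteq> 0" "\<forall>Q\<in>C. a Q * d Q = c Q * b Q" for c d
  proof -
    have nzd: "nz d" using P that(4) by (rule nz_at)
    have "nz (\<lambda>Q. a Q * d Q)" using nz_mult[OF ab(1) that(3,1) nzd] .
    hence "nz (\<lambda>Q. c Q * b Q)" using that(5) by (auto simp: nz_def)
    hence c: "nz c" by (auto simp: nz_def)
    have "mult_at P (\<lambda>Q. a Q * d Q) = mult_at P (\<lambda>Q. c Q * b Q)"
      using that(2,5) \<open>nz (\<lambda>Q. c Q * b Q)\<close> ab by (intro mult_at_cong P polyfuns.mult) auto
    thus ?thesis using c mult_at_mult[OF P ab(1) that(3,1) nzd] mult_at_mult[OF P that(2) ab(2) c ab(3)]
      mult_at_unit[OF P that(3,4)] by simp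
  qed
  have zero: "\<exists>c\<in>R. \<exists>d\<in>R. d P \<noteq> 0 \<and> c P = 0 \<and> (\<forall>Q\<in>C. a Q * d Q = c Q * b Q)" if "\<not> nz a"
    using that by (intro bexI[of _ "\<lambda>_. 0"] bexI[of _ "\<lambda>_. 1"]) (auto simp: nz_def R_const)
  show "fr a b \<in> local_ring V (aff P) \<longleftrightarrow> (nz a \<longrightarrow> mult_at P b \<le> mult_at P a)"
  proof (cases "nz a")
    case True
    show ?thesis unfolding 1 using mul[OF True] fr_quotient[OF P ab(1,2) True ab(3)] True
      by (metis le_add2)
  next
    case False
    thus ?thesis unfolding 1 using zero by blast
  qed
  show "fr a b \<in> local_max_ideal V (aff P) \<longleftrightarrow> (nz a \<longrightarrow> mult_at P b < mult_at P a)"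
  proof (cases "nz a")
    case True
    have "mult_at P b < mult_at P a"
      if cd: "c \<in> R" "d \<in> R" "d P \<noteq> 0" "c P = 0" "\<forall>Q\<in>C. a Q * d Q = c Q * b Q" for c d
    proof -
      have c: "nz c" "mult_at P a = mult_at P c + mult_at P b" using mul[OF True cd(1-3,5)] by auto
      have "mult_at P c \<noteq> 0"
      proof
        assume "mult_at P c = 0"
        hence "order_at P c 0" using order_at_mult_at[OF P cd(1) c(1)] by simp
        thus False using order_atE[of P c 0] P cd(4) by (metis mult_zero_left mult_1_left power_0)
      qed
      thus ?thesis using c by simp
    qed
    thus ?thesis unfolding 2 using fr_quotient[OF P ab(1,2) True ab(3)] True
      by (meson less_imp_le)
  next
    case False
    thus ?thesis unfolding 2 using zero by blast
  qed
qed

lemma valuation_aff: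
  assumes P: "P \<in> C"
  shows "gk_valuation q (aff P) (\<lambda>a. int (mult_at P a))"
proof
  show "\<exists>s\<in>R. \<exists>t\<in>R. nz s \<and> nz t \<and> int (mult_at P s) - int (mult_at P t) = 1"
  proof (intro bexI conjI)
    show "int (mult_at P (\<lambda>Q. zc Q - zc P)) - int (mult_at P (\<lambda>_. 1)) = 1"
      using mult_at_eq[OF P order_at_z] mult_at_unit[OF P R_const, of 1] by simp
  qed (auto intro!: R_intros z_minus_nz nz_1)
  fix a b assume ab: "a \<in> R" "b \<in> R" "nz b"
  show "fr a b \<in> local_ring V (aff P) \<longleftrightarrow> (nz a \<longrightarrow> int (mult_at P b) \<le> int (mult_at P a))"
    "fr a b \<in> local_max_ideal V (aff P) \<longleftrightarrow> (nz a \<longrightarrow> int (mult_at P b) < int (mult_at P a))"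
    using local_ring_aff[OF P ab] by auto
next
  fix a b assume "a \<in> R" "b \<in> R" "nz a" "nz b"
  thus "int (mult_at P (\<lambda>p. a p * b p)) = int (mult_at P a) + int (mult_at P b)" using mult_at_mult[OF P] by simp
next
  fix a b assume "a \<in> R" "b \<in> R" "nz a" "\<And>p. p \<in> C \<Longrightarrow> a p = b p"
  thus "int (mult_at P a) = int (mult_at P b)" using mult_at_cong[OF P, of a b] by simp
qed


section \<open>The point at infinity\<close>

lemma qM_less: "q * M < q ^ 3 + 1"
  using M_factor M_pos by (simp add: algebra_simps)

lemma wt_less_degree:
  assumes "j + k + l > 0" shows "wt (i, j, k) < (i + j + k + l) * (q ^ 3 + 1)"
proof (cases "j + k = 0")
  case True
  hence "wt (i, j, k) = i * (q ^ 3 + 1)" by (simp add: wt_def)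
  also have "\<dots> < (i + j + k + l) * (q ^ 3 + 1)" using assms True by (intro mult_strict_right_mono) auto
  finally show ?thesis .
next
  case False
  have "j * (q * M) \<le> j * (q ^ 3 + 1)" "j > 0 \<Longrightarrow> j * (q * M) < j * (q ^ 3 + 1)"
    using qM_less by (auto intro!: mult_le_mono2 mult_strict_left_mono simp del: mult_Suc_right)
  moreover have "k * q ^ 3 \<le> k * (q ^ 3 + 1)" "k > 0 \<Longrightarrow> k * q ^ 3 < k * (q ^ 3 + 1)" by auto
  ultimately have "j * (q * M) + k * q ^ 3 < j * (q ^ 3 + 1) + k * (q ^ 3 + 1)"
    using False by (cases "j > 0") (auto simp del: mult_Suc_right intro: add_less_le_mono add_le_less_mono)
  thus ?thesis by (simp add: wt_def add_mult_distrib)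
qed

lemma lead_mon: "lead (mon e) (wt e)"
proof -
  obtain e0 where "e0 \<in> Reduced" "wt e0 = wt e" "(\<lambda>p. mon e p - mon e0 p) \<in> Filt (wt e)" using mon_reduce by blast
  thus ?thesis unfolding lead_def by (intro exI[of _ 1] exI[of _ e0]) auto
qed

lemma lead_scale: "c \<noteq> 0 \<Longrightarrow> lead f w \<Longrightarrow> lead (\<lambda>p. c * f p) w"
proof -
  assume c: "c \<noteq> 0" and "lead f w"
  then obtain a e where a: "a \<noteq> 0" "e \<in> Reduced" "wt e = w" "(\<lambda>p. f p - a * mon e p) \<in> Filt w"
    unfolding lead_def by blast
  have "(\<lambda>p. c * f p - (c * a) * mon e p) \<in> Filt w"
    using Filt_scale[OF a(4), of c] by (simp add: right_diff_distrib mult.assoc)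
  thus ?thesis unfolding lead_def using a c by (intro exI[of _ "c * a"] exI[of _ e]) auto
qed

lemma lead_add_lower: "lead f w \<Longrightarrow> g \<in> Filt w \<Longrightarrow> lead (\<lambda>p. f p + g p) w"
proof -
  assume "lead f w" and g: "g \<in> Filt w"
  then obtain a e where a: "a \<noteq> 0" "e \<in> Reduced" "wt e = w" "(\<lambda>p. f p - a * mon e p) \<in> Filt w"
    unfolding lead_def by blast
  have "(\<lambda>p. f p + g p - a * mon e p) \<in> Filt w"
    using Filt_add[OF a(4) g] by (simp add: algebra_simps)
  thus ?thesis unfolding lead_def using a by blast
qed

text \<open>
  Per degree, \<open>x\<close> has a larger weight than the other homogeneous coordinates. So the leading term of a
  form of degree \<open>d\<close> comes from the coefficient of the \<open>d\<close>-th power of the first coordinate, which is its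
  value at \<open>P\<^sub>\<infinity>\<close>.
\<close>

lemma form_weight:
  assumes A: "homogeneous d A"
  shows "(\<lambda>p. ev A p - mpol_eval A (axis 1 1) * mon (d, 0, 0) p) \<in> Filt (d * (q ^ 3 + 1))"
proof -
  \<comment> \<open>Dehomogenisation drops the exponent of the fourth coordinate.\<close>
  define E where "E e = (Poly_Mapping.lookup e (1::4), Poly_Mapping.lookup e 2, Poly_Mapping.lookup e 3)"
    for e :: "4 \<Rightarrow>\<^sub>0 nat"
  have "(\<lambda>p. \<Sum>e\<in>Poly_Mapping.keys A. Poly_Mapping.lookup A e *
      (mon (E e) p - monv e (axis 1 1) * mon (d, 0, 0) p)) \<in> Filt (d * (q ^ 3 + 1))"
  proof (intro Filt_sum Filt_scale)
    fix e assume e: "e \<in> Poly_Mapping.keys A"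
    have "(\<Sum>i\<in>UNIV. Poly_Mapping.lookup e i) = d" using A e by (auto simp: homogeneous_def)
    hence d: "Poly_Mapping.lookup e 1 + Poly_Mapping.lookup e 2 + Poly_Mapping.lookup e 3 + Poly_Mapping.lookup e 4 = d"
      by (simp add: sum_4)
    have mv: "monv e (axis 1 1 :: 'k ^ 4) = 0 ^ Poly_Mapping.lookup e 2 * 0 ^ Poly_Mapping.lookup e 3 * 0 ^ Poly_Mapping.lookup e 4"
      by (simp add: monv_def prod_UNIV_4 axis_def)
    show "(\<lambda>p. mon (E e) p - monv e (axis 1 1) * mon (d, 0, 0) p) \<in> Filt (d * (q ^ 3 + 1))"
    proof (cases "Poly_Mapping.lookup e 2 + Poly_Mapping.lookup e 3 + Poly_Mapping.lookup e 4 = 0")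
      case True
      thus ?thesis using d mv Filt_0 by (simp add: E_def)
    next
      case False
      hence "monv e (axis 1 1 :: 'k ^ 4) = 0" unfolding mv by auto
      moreover have "wt (E e) < d * (q ^ 3 + 1)"
        unfolding E_def d[symmetric] using False by (intro wt_less_degree) simp
      ultimately show ?thesis using mon_Filt by simp
    qed
  qed
  thus ?thesis
  proof (rule Filt_cong)
    fix p
    have "ev A p = (\<Sum>e\<in>Poly_Mapping.keys A. Poly_Mapping.lookup A e * mon (E e) p)"
      by (simp add: mpol_eval_def prod_UNIV_4 E_def mon_altdef)
    moreover have "mpol_eval A (axis 1 1) = (\<Sum>e\<in>Poly_Mapping.keys A. Poly_Mapping.lookup A e * monv e (axis 1 1))"
      by (simp add: mpol_eval_def monv_def)
    ultimately show "ev A p - mpol_eval A (axis 1 1) * mon (d, 0, 0) p = (\<Sum>e\<in>Poly_Mapping.keys A. Poly_Mapping.lookup A e *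
      (mon (E e) p - monv e (axis 1 1) * mon (d, 0, 0) p))"
      by (simp add: sum_subtractf sum_distrib_right right_diff_distrib mult.assoc)
  qed
qed

lemma wt_x: "wt (d, 0, 0) = d * (q ^ 3 + 1)"
  by (simp add: wt_def)

lemma form_lead:
  assumes "homogeneous d A" "mpol_eval A (axis 1 1) \<noteq> 0" shows "lead (ev A) (d * (q ^ 3 + 1))"
proof -
  have "lead (\<lambda>p. mpol_eval A (axis 1 1) * mon (d, 0, 0) p) (d * (q ^ 3 + 1))"
    using lead_scale[OF assms(2) lead_mon[of "(d,0,0)"]] by (simp add: wt_x del: mult_Suc_right)
  from lead_add_lower[OF this form_weight[OF assms(1)]] show ?thesis by simp
qed

lemma form_Filt_vanish: "homogeneous d A \<Longrightarrow> mpol_eval A (axis 1 1) = 0 \<Longrightarrow> ev A \<in> Filt (d * (q ^ 3 + 1))"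
  using form_weight[of d A] by simp

lemma form_Filt: "homogeneous d A \<Longrightarrow> ev A \<in> Filt (d * (q ^ 3 + 1) + 1)"
  using form_Filt_vanish[of d A] form_lead[of d A] lead_in_Filt Filt_mono[of "d * (q ^ 3 + 1)" "d * (q ^ 3 + 1) + 1"]
  by (cases "mpol_eval A (axis 1 1) = 0") (auto simp del: mult_Suc_right)

text \<open>
  A bound on the weight becomes a bound on the degree when \<open>y\<close> and \<open>z\<close> are reduced with \<open>j \<le> q\<close> and
  \<open>k < M\<close>: the weight falls short of degree times \<open>q\<^sup>3 + 1\<close> by \<open>j M + k\<close>, which is less than
  \<open>(q + 1) M = q\<^sup>3 + 1\<close>.
\<close>

lemma reduced_degree:
  assumes "j \<le> q" "k < M" "wt (i, j, k) \<le> d * (q ^ 3 + 1)" shows "i + j + k \<le> d"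
proof (rule ccontr)
  assume "\<not> i + j + k \<le> d"
  hence "(d + 1) * (q ^ 3 + 1) \<le> (i + j + k) * (q ^ 3 + 1)" by (intro mult_right_mono) auto
  also have "\<dots> = wt (i, j, k) + j * M + k"
  proof -
    have "j * (q ^ 3 + 1) = j * (q * M) + j * M" unfolding M_factor[symmetric] by (simp add: algebra_simps)
    thus ?thesis by (simp add: wt_def add_mult_distrib)
  qed
  also have "\<dots> \<le> d * (q ^ 3 + 1) + q * M + k" using assms(1,3) by (intro add_mono mult_right_mono) auto
  also have "\<dots> < d * (q ^ 3 + 1) + q * M + M" using assms(2) by simp
  also have "\<dots> = (d + 1) * (q ^ 3 + 1)" unfolding M_factor[symmetric] by (simp add: algebra_simps)
  finally show False by simp
qed

text \<open>
  A second reduction, opposite to the one for \<open>mon_reduce\<close>: it replaces \<open>z\<^sup>M\<close> by \<open>y\<^bsup>q\<^sup>2\<^esup> - y\<close> and \<open>y\<^sup>q\<^sup>+\<^sup>1\<close> by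
  \<open>x\<^sup>q + x\<close>, never raising the weight, until degree and weight are comparable.
\<close>

lemma mon_form:
  "wt (i, j, k) \<le> d * (q ^ 3 + 1) \<Longrightarrow> \<exists>A. homogeneous d A \<and> (\<forall>p\<in>C. ev A p = mon (i, j, k) p)"
proof (induction k arbitrary: i j rule: less_induct)
  case (less k)
  note IHk = less.IH and wk = less.prems
  show ?case
  proof (cases "k < M")
    case False
    then obtain k' where k: "k = k' + M" using le_Suc_ex by (metis add.commute not_less)
    have qq: "q\<^sup>2 > 1" using q2 one_less_power[of q 2] by simp
    have w1: "wt (i, j + q\<^sup>2, k') = wt (i, j, k)"
      by (simp add: wt_def k algebra_simps power2_eq_square power3_eq_cube)
    have w2: "wt (i, j + 1, k') \<le> wt (i, j + q\<^sup>2, k')"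
    proof -
      have "(j + 1) * (q * M) \<le> (j + q\<^sup>2) * (q * M)" using qq by (intro mult_right_mono) auto
      thus ?thesis by (simp add: wt_def del: mult_Suc)
    qed
    have k': "k' < k" using k M_pos by simp
    obtain A where A: "homogeneous d A" "\<forall>p\<in>C. ev A p = mon (i, j + q\<^sup>2, k') p"
      using IHk[OF k', of i "j + q\<^sup>2"] wk w1 by auto
    obtain B where B: "homogeneous d B" "\<forall>p\<in>C. ev B p = mon (i, j + 1, k') p"
      using IHk[OF k', of i "j + 1"] wk w1 w2 by auto
    show ?thesis
    proof (intro exI conjI ballI)
      show "homogeneous d (A - B)" using A B by (intro homogeneous_diff)
      fix p :: "'k point" assume p: "p \<in> C"
      obtain x y z where xyz: "p = (x,y,z)" by (cases p)
      have "z ^ M = y ^ (q\<^sup>2) - y" using p xyz by (simp add: C_def)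
      hence "x ^ i * y ^ j * z ^ k' * z ^ M = x ^ i * y ^ j * z ^ k' * (y ^ (q\<^sup>2) - y)" by simp
      thus "ev (A - B) p = mon (i, j, k) p"
        using A(2) B(2) p by (simp add: mpol_eval_diff xyz k power_add algebra_simps)
    qed
  next
    case kM: True
    show ?thesis using wk
    proof (induction j arbitrary: i rule: less_induct)
      case (less j)
      note IHj = less.IH and wj = less.prems
      show ?case
      proof (cases "j \<le> q")
        case False
        then obtain j' where j: "j = j' + (q + 1)" using le_Suc_ex
          by (metis add.commute not_less_eq_eq Suc_eq_plus1)
        have w1: "wt (i + q, j', k) = wt (i, j, k)"
        proof -
          have "(q + 1) * (q * M) = q * (q ^ 3 + 1)" by (simp only: M_factor[symmetric] mult_ac)
          thus ?thesis by (simp only: wt_def j add_mult_distrib fst_conv snd_conv)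
        qed
        have w2: "wt (i + 1, j', k) \<le> wt (i + q, j', k)"
        proof -
          have "(i + 1) * (q ^ 3 + 1) \<le> (i + q) * (q ^ 3 + 1)" using q2 by (intro mult_right_mono) auto
          thus ?thesis by (simp add: wt_def del: mult_Suc)
        qed
        have j': "j' < j" using j by simp
        obtain A where A: "homogeneous d A" "\<forall>p\<in>C. ev A p = mon (i + q, j', k) p"
          using IHj[OF j', of "i + q"] wj w1 by auto
        obtain B where B: "homogeneous d B" "\<forall>p\<in>C. ev B p = mon (i + 1, j', k) p"
          using IHj[OF j', of "i + 1"] wj w1 w2 by auto
        show ?thesis
        proof (intro exI conjI ballI)
          show "homogeneous d (A + B)" using A B by (intro homogeneous_add)
          fix p :: "'k point" assume p: "p \<in> C"
          obtain x y z where xyz: "p = (x,y,z)" by (cases p)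
          have "y ^ (q + 1) = x ^ q + x" using p xyz by (simp add: C_def)
          hence "x ^ i * y ^ j' * y ^ (q + 1) * z ^ k = x ^ i * y ^ j' * (x ^ q + x) * z ^ k" by simp
          thus "ev (A + B) p = mon (i, j, k) p"
            using A(2) B(2) p by (simp add: mpol_eval_add xyz j power_add algebra_simps)
        qed
      next
        case True
        have le: "i + j + k \<le> d" by (rule reduced_degree[OF True kM wj])
        let ?A = "mvar 1 ^ i * mvar 2 ^ j * mvar 3 ^ k * mvar 4 ^ (d - (i + j + k)) :: ('k, 4) mpol"
        have "homogeneous (i + j + k + (d - (i + j + k))) ?A"
          by (intro homogeneous_mult homogeneous_mvar_power)
        moreover have "ev ?A p = mon (i, j, k) p" for p by (simp add: mpol_eval_simps mon_altdef)
        ultimately show ?thesis using le by auto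
      qed
    qed
  qed
qed

text \<open>
  A function of weight at most \<open>d (q\<^sup>3 + 1)\<close> is the dehomogenisation of a form of degree \<open>d\<close>. This is
  where the smoothness of the curve at \<open>P\<^sub>\<infinity>\<close> enters.
\<close>

lemma Filt_form:
  assumes "f \<in> Filt (d * (q ^ 3 + 1) + 1)"
  shows "\<exists>A. homogeneous d A \<and> (\<forall>p\<in>C. ev A p = f p)"
proof -
  let ?T = "d * (q ^ 3 + 1) + 1"
  obtain c where c: "\<And>p. p \<in> C \<Longrightarrow> f p = (\<Sum>e\<in>Red_below ?T. c e * mon e p)"
    using assms unfolding Filt_def by blast
  have "\<exists>A. homogeneous d A \<and> (\<forall>p\<in>C. ev A p = mon e p)" if "e \<in> Red_below ?T" for e
  proof -
    obtain i j k where e: "e = (i,j,k)" by (cases e)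
    have "wt (i,j,k) \<le> d * (q ^ 3 + 1)" using that unfolding Red_below_def e by simp
    thus ?thesis unfolding e by (rule mon_form)
  qed
  then obtain A where A: "\<And>e. e \<in> Red_below ?T \<Longrightarrow> homogeneous d (A e) \<and> (\<forall>p\<in>C. ev (A e) p = mon e p)" by metis
  let ?A = "\<Sum>e\<in>Red_below ?T. Poly_Mapping.single 0 (c e) * A e"
  have "homogeneous d ?A"
  proof (rule homogeneous_sum)
    fix e assume "e \<in> Red_below ?T"
    hence "homogeneous (0 + d) (Poly_Mapping.single 0 (c e) * A e)" using A by (intro homogeneous_mult homogeneous_const) auto
    thus "homogeneous d (Poly_Mapping.single 0 (c e) * A e)" by simp
  qed
  moreover have "ev ?A p = f p" if p: "p \<in> C" for p
    unfolding c[OF p] mpol_eval_sum using A p by (intro sum.cong) (auto simp: mpol_eval_mult mpol_eval_const)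
  ultimately show ?thesis by blast
qed

definition rho :: "'k point_fun \<Rightarrow> nat" where "rho f = (THE w. lead f w)"

lemma rho_eq: "lead f w \<Longrightarrow> rho f = w"
  unfolding rho_def using lead_unique by blast

lemma lead_rho: "f \<in> R \<Longrightarrow> nz f \<Longrightarrow> lead f (rho f)"
  using nz_lead rho_eq by blast

lemma rho_mult: "f \<in> R \<Longrightarrow> g \<in> R \<Longrightarrow> nz f \<Longrightarrow> nz g \<Longrightarrow> rho (\<lambda>p. f p * g p) = rho f + rho g"
  by (intro rho_eq lead_mult lead_rho)

lemma rho_cong: "f \<in> R \<Longrightarrow> nz f \<Longrightarrow> (\<And>p. p \<in> C \<Longrightarrow> g p = f p) \<Longrightarrow> rho g = rho f"
  by (intro rho_eq lead_cong[OF lead_rho])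

lemma rho_1: "rho (\<lambda>_. 1) = 0"
  using rho_mult[OF R_const R_const nz_1 nz_1] by simp

lemma rho_power: "f \<in> R \<Longrightarrow> nz f \<Longrightarrow> rho (\<lambda>p. f p ^ n) = n * rho f"
  by (induction n) (auto simp: rho_1 rho_mult R_power nz_power)

lemma vanishes_at_pinf: "homogeneous d A \<Longrightarrow> vanishes_at A pinf \<longleftrightarrow> mpol_eval A (axis 1 1) = 0"
  unfolding pinf_def by (rule vanishes_at_proj_point)

lemma local_ring_pinf_to:
  assumes ab: "a \<in> R" "b \<in> R" "nz b" "nz a" and AB: "(A, B) \<in> fr a b" "\<not> vanishes_at B pinf"
  shows "rho a \<le> rho b" and "vanishes_at A pinf \<Longrightarrow> rho a < rho b"
proof -
  obtain d where d: "homogeneous d A" "homogeneous d B" using AB(1) unfolding fr_def fractions_iff by blast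
  have cross: "ev A p * b p = a p * ev B p" if "p \<in> C" for p using AB(1) that by (auto simp: fr_def)
  have leadB: "lead (ev B) (d * (q ^ 3 + 1))"
    using AB(2) by (intro form_lead d) (simp add: vanishes_at_pinf[OF d(2)])
  have nzB: "nz (ev B)" using leadB by (rule lead_nz)
  have nzp: "nz (\<lambda>p. a p * ev B p)" using ab nzB by (intro nz_mult ev_R)
  hence "nz (\<lambda>p. ev A p * b p)" using cross by (auto simp: nz_def)
  hence nzA: "nz (ev A)" by (auto simp: nz_def)
  have leadA: "lead (ev A) (rho (ev A))" using nzA by (intro lead_rho ev_R)
  have "rho (\<lambda>p. ev A p * b p) = rho (\<lambda>p. a p * ev B p)"
    using ab cross nzp by (intro rho_cong polyfuns.mult ev_R) auto
  hence eq: "rho (ev A) + rho b = rho a + d * (q ^ 3 + 1)"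
    using ab nzA nzB rho_eq[OF leadB] by (simp add: rho_mult ev_R del: mult_Suc_right)
  have "rho (ev A) < d * (q ^ 3 + 1) + 1" using lead_Filt_iff[OF leadA] form_Filt[OF d(1)] by blast
  thus "rho a \<le> rho b" using eq by linarith
  assume "vanishes_at A pinf"
  hence "ev A \<in> Filt (d * (q ^ 3 + 1))" using d(1) by (intro form_Filt_vanish) (auto simp: vanishes_at_pinf)
  hence "rho (ev A) < d * (q ^ 3 + 1)" using lead_Filt_iff[OF leadA] by blast
  thus "rho a < rho b" using eq by linarith
qed

text \<open>
  After multiplication of numerator and denominator by \<open>b\<^bsup>q\<^sup>3\<^esup>\<close> the denominator has the weight
  \<open>rho b * (q\<^sup>3 + 1)\<close>, so both are forms of degree \<open>rho b\<close>, and the denominator does not vanish at \<open>P\<^sub>\<infinity>\<close>.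
\<close>

lemma local_ring_pinf_from:
  assumes ab: "a \<in> R" "b \<in> R" "nz b" and le: "nz a \<Longrightarrow> rho a \<le> rho b"
  shows "\<exists>(A, B)\<in>fr a b. \<not> vanishes_at B pinf \<and> ((nz a \<longrightarrow> rho a < rho b) \<longrightarrow> vanishes_at A pinf)"
proof -
  define b' where "b' = (\<lambda>p. b p ^ (q ^ 3) * b p)"
  define a' where "a' = (\<lambda>p. b p ^ (q ^ 3) * a p)"
  have R: "a' \<in> R" "b' \<in> R" unfolding a'_def b'_def using ab by (auto intro!: R_intros)
  have nzb': "nz b'" unfolding b'_def using ab by (intro nz_mult nz_power R_power)
  have rb: "rho b' = rho b * (q ^ 3 + 1)"
    unfolding b'_def using ab by (simp add: rho_mult rho_power R_power nz_power)
  have ra: "rho a' = rho b * q ^ 3 + rho a" if "nz a"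
    unfolding a'_def using ab that by (simp add: rho_mult rho_power R_power nz_power)
  have nza': "nz a" if "nz a'" using that by (auto simp: a'_def nz_def)
  have nza: "nz a'" if "nz a" unfolding a'_def using that ab by (intro nz_mult nz_power R_power)
  have "b' \<in> Filt (rho b * (q ^ 3 + 1) + 1)" using lead_in_Filt[OF lead_rho[OF R(2) nzb']] rb by simp
  then obtain B where B: "homogeneous (rho b) B" "\<And>p. p \<in> C \<Longrightarrow> ev B p = b' p" using Filt_form by blast
  have "a' \<in> Filt (rho b * (q ^ 3 + 1) + 1)"
  proof (cases "nz a")
    case True
    thus ?thesis using lead_in_Filt[OF lead_rho[OF R(1) nza]] ra le by simp
  next
    case False
    show ?thesis by (rule Filt_cong[OF Filt_0]) (use False in \<open>auto simp: nz_def a'_def\<close>)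
  qed
  then obtain A where A: "homogeneous (rho b) A" "\<And>p. p \<in> C \<Longrightarrow> ev A p = a' p" using Filt_form by blast
  have leadB: "lead (ev B) (rho b * (q ^ 3 + 1))"
    using lead_cong[OF lead_rho[OF R(2) nzb'] B(2)] rb by simp
  have "\<not> vanishes_at B pinf"
  proof
    assume "vanishes_at B pinf"
    hence "ev B \<in> Filt (rho b * (q ^ 3 + 1))" using form_Filt_vanish[OF B(1)] vanishes_at_pinf[OF B(1)] by blast
    thus False using lead_notin_Filt[OF leadB] by blast
  qed
  moreover have "vanishes_at A pinf" if lt: "nz a \<longrightarrow> rho a < rho b"
  proof (rule ccontr)
    assume "\<not> vanishes_at A pinf"
    hence leadA: "lead (ev A) (rho b * (q ^ 3 + 1))"
      using form_lead[OF A(1)] vanishes_at_pinf[OF A(1)] by blast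
    hence leadA': "lead a' (rho b * (q ^ 3 + 1))" by (rule lead_cong) (simp add: A(2))
    hence "nz a" using lead_nz nza' by blast
    thus False using rho_eq[OF leadA'] ra lt by simp
  qed
  moreover have "(A, B) \<in> fr a b"
  proof -
    have "(A, B) \<in> fractions V" unfolding fractions_iff using A(1) B(1) lead_nz[OF leadB] by blast
    moreover have "ev A p * b p = a p * ev B p" if "p \<in> C" for p
      unfolding A(2)[OF that] B(2)[OF that] by (simp add: a'_def b'_def)
    ultimately show ?thesis by (simp add: fr_def)
  qed
  ultimately show ?thesis by blast
qed

text \<open>
  The quotient \<open>z / x\<close> has value \<open>(q\<^sup>3 + 1) - q\<^sup>3 = 1\<close>.
\<close>

lemma valuation_pinf: "gk_valuation q pinf (\<lambda>a. - int (rho a))"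
proof
  show "\<exists>s\<in>R. \<exists>t\<in>R. nz s \<and> nz t \<and> - int (rho s) - - int (rho t) = 1"
  proof (intro bexI conjI)
    have "lead (mon (0,0,1)) (wt (0,0,1))" "lead (mon (1,0,0)) (wt (1,0,0))" by (rule lead_mon)+
    thus "nz (mon (0,0,1))" "nz (mon (1,0,0))" "- int (rho (mon (0,0,1))) - - int (rho (mon (1,0,0))) = 1"
      by (auto simp: rho_eq wt_def intro: lead_nz)
  qed (auto intro!: polyfuns_mon)
  fix a b assume ab: "a \<in> R" "b \<in> R" "nz b"
  have car: "fr a b \<in> carrier FF" by (rule fr_carrier[OF ab])
  show "fr a b \<in> local_ring V pinf \<longleftrightarrow> (nz a \<longrightarrow> - int (rho b) \<le> - int (rho a))"
  proof
    assume "fr a b \<in> local_ring V pinf"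
    then obtain A B where "(A, B) \<in> fr a b" "\<not> vanishes_at B pinf" unfolding local_ring_def by blast
    thus "nz a \<longrightarrow> - int (rho b) \<le> - int (rho a)" using local_ring_pinf_to(1)[OF ab] by auto
  next
    assume "nz a \<longrightarrow> - int (rho b) \<le> - int (rho a)"
    thus "fr a b \<in> local_ring V pinf" using local_ring_pinf_from[OF ab] car unfolding local_ring_def by auto
  qed
  show "fr a b \<in> local_max_ideal V pinf \<longleftrightarrow> (nz a \<longrightarrow> - int (rho b) < - int (rho a))"
  proof
    assume "fr a b \<in> local_max_ideal V pinf"
    then obtain A B where "(A, B) \<in> fr a b" "\<not> vanishes_at B pinf" "vanishes_at A pinf" unfolding local_max_ideal_def by blast
    thus "nz a \<longrightarrow> - int (rho b) < - int (rho a)" using local_ring_pinf_to(2)[OF ab] by auto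
  next
    assume "nz a \<longrightarrow> - int (rho b) < - int (rho a)"
    thus "fr a b \<in> local_max_ideal V pinf" using local_ring_pinf_from[OF ab] car unfolding local_max_ideal_def by fastforce
  qed
next
  fix a b assume "a \<in> R" "b \<in> R" "nz a" "nz b"
  thus "- int (rho (\<lambda>p. a p * b p)) = - int (rho a) + - int (rho b)" using rho_mult by simp
next
  fix a b assume "a \<in> R" "b \<in> R" "nz a" "\<And>p. p \<in> C \<Longrightarrow> a p = b p"
  thus "- int (rho a) = - int (rho b)" using rho_cong[of a b] by simp
qed

lemma proj_point_scale: "a \<noteq> 0 \<Longrightarrow> proj_point (a *s v) = proj_point v"
proof -
  assume a: "a \<noteq> 0"
  have "(\<exists>b. w = b *s (a *s v) \<and> b \<noteq> 0) \<longleftrightarrow> (\<exists>b. w = b *s v \<and> b \<noteq> 0)" for w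
  proof
    assume "\<exists>b. w = b *s (a *s v) \<and> b \<noteq> 0"
    thus "\<exists>b. w = b *s v \<and> b \<noteq> 0" using a by (metis vector_smult_assoc mult_eq_0_iff)
  next
    assume "\<exists>b. w = b *s v \<and> b \<noteq> 0"
    then obtain b where "w = b *s v" "b \<noteq> 0" by blast
    thus "\<exists>b. w = b *s (a *s v) \<and> b \<noteq> 0" using a
      by (intro exI[of _ "b / a"]) (simp add: vector_smult_assoc)
  qed
  thus ?thesis by (simp add: proj_point_def)
qed

text \<open>
  A form that does not vanish at \<open>P\<^sub>\<infinity>\<close> has a leading weight on the affine curve, so it does not vanish
  there identically.
\<close>

lemma pinf_in_V: "pinf \<in> V"
proof -
  have "(axis 1 1 :: 'k ^ 4) \<noteq> 0" by (simp add: axis_eq_0_iff)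
  hence "pinf \<in> (proj_space :: ('k, 4) ppoint set)" by (simp add: pinf_def proj_space_def)
  moreover have "vanishes_at A (pinf :: ('k, 4) ppoint)" if "homogeneous d A" "vanishes_on A (GK_affine q)" for d A
  proof (rule ccontr)
    assume "\<not> vanishes_at A (pinf :: ('k, 4) ppoint)"
    hence "nz (ev A)" using form_lead[OF that(1)] vanishes_at_pinf[OF that(1)] lead_nz by blast
    thus False using that(2) vanishes_at_aff[OF that(1)] unfolding nz_def vanishes_on_def GK_affine_eq by blast
  qed
  ultimately show ?thesis by (auto simp: V_def GK_curve_def zariski_closure_def)
qed

text \<open>
  At infinity the first curve equation forces \<open>Y = 0\<close>. The homogenised second equation does not force
  \<open>Z = 0\<close>; for this its \<open>(q + 1)\<close>-st power is used, where \<open>y\<close> can be eliminated: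
  \<open>z\<^bsup>q\<^sup>3 + 1\<^esup> = s (s\<^sup>q\<^sup>-\<^sup>1 - 1)\<^sup>q\<^sup>+\<^sup>1\<close> with \<open>s = y\<^sup>q\<^sup>+\<^sup>1 = x\<^sup>q + x\<close>. The right hand side has degree \<open>q\<^sup>3\<close> in \<open>x\<close>, so its
  homogenisation to degree \<open>q\<^sup>3 + 1\<close> is divisible by the last coordinate.
\<close>

lemma V_eq: "V = insert pinf (aff ` C)"
proof (intro equalityI subsetI)
  fix P assume "P \<in> insert pinf (aff ` C)"
  thus "P \<in> V" using pinf_in_V aff_in_V by auto
next
  fix P assume P: "P \<in> V"
  hence "P \<in> proj_space" by (simp add: V_def GK_curve_def zariski_closure_def)
  then obtain v :: "'k ^ 4" where v: "P = proj_point v" "v \<noteq> 0" by (auto simp: proj_space_def)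
  have van: "mpol_eval A v = 0" if "homogeneous d A" "\<And>p. p \<in> C \<Longrightarrow> ev A p = 0" for d A
  proof -
    have "vanishes_on A V" using that vanishes_on_V by blast
    thus ?thesis using P vanishes_at_proj_point[OF that(1), of v] v(1) unfolding vanishes_on_def by blast
  qed
  have qM: "M \<le> q\<^sup>2" using M_plus_q q2 by simp
  have qq: "q\<^sup>2 > 1" using q2 one_less_power[of q 2] by simp
  define mX mY mZ mT where "mX = (mvar 1 :: ('k, 4) mpol)" and "mY = (mvar 2 :: ('k, 4) mpol)"
    and "mZ = (mvar 3 :: ('k, 4) mpol)" and "mT = (mvar 4 :: ('k, 4) mpol)"
  note XYZT = mX_def mY_def mZ_def mT_def
  have hp: "homogeneous n (mX ^ n)" "homogeneous n (mY ^ n)" "homogeneous n (mZ ^ n)" "homogeneous n (mT ^ n)" for n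
    unfolding XYZT by (rule homogeneous_mvar_power)+
  have hp1: "homogeneous 1 mX" "homogeneous 1 mY" "homogeneous 1 mZ" "homogeneous 1 mT"
    unfolding XYZT by (rule homogeneous_mvar)+
  have S1: "homogeneous (q + 1) (mX ^ q * mT + mX * mT ^ q)"
    using homogeneous_mult[OF hp(1) hp1(4), of q] homogeneous_mult[OF hp1(1) hp(4), of q]
    by (intro homogeneous_add) (simp_all add: add.commute)
  have E1: "v $ 1 ^ q * v $ 4 + v $ 1 * v $ 4 ^ q - v $ 2 ^ (q + 1) = 0"
  proof -
    have "homogeneous (q + 1) (mX ^ q * mT + mX * mT ^ q - mY ^ (q + 1))" using S1 hp by (intro homogeneous_diff)
    moreover have "ev (mX ^ q * mT + mX * mT ^ q - mY ^ (q + 1)) p = 0" if "p \<in> C" for p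
      using that unfolding XYZT mpol_eval_simps pt_nth by (auto simp: C_def)
    ultimately have "mpol_eval (mX ^ q * mT + mX * mT ^ q - mY ^ (q + 1)) v = 0" by (rule van)
    thus ?thesis unfolding XYZT mpol_eval_simps .
  qed
  have E2: "v $ 3 ^ M * v $ 4 ^ (q\<^sup>2 - M) - v $ 2 ^ (q\<^sup>2) + v $ 2 * v $ 4 ^ (q\<^sup>2 - 1) = 0"
  proof -
    have "homogeneous (q\<^sup>2) (mZ ^ M * mT ^ (q\<^sup>2 - M) - mY ^ (q\<^sup>2) + mY * mT ^ (q\<^sup>2 - 1))"
    proof (intro homogeneous_add homogeneous_diff hp)
      have "homogeneous (M + (q\<^sup>2 - M)) (mZ ^ M * mT ^ (q\<^sup>2 - M))"
        "homogeneous (1 + (q\<^sup>2 - 1)) (mY * mT ^ (q\<^sup>2 - 1))"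
        by (rule homogeneous_mult[OF hp(3) hp(4)], rule homogeneous_mult[OF hp1(2) hp(4)])
      moreover have "M + (q\<^sup>2 - M) = q\<^sup>2" "1 + (q\<^sup>2 - 1) = q\<^sup>2" using qM qq by auto
      ultimately show "homogeneous (q\<^sup>2) (mZ ^ M * mT ^ (q\<^sup>2 - M))"
        "homogeneous (q\<^sup>2) (mY * mT ^ (q\<^sup>2 - 1))" by simp_all
    qed
    moreover have "ev (mZ ^ M * mT ^ (q\<^sup>2 - M) - mY ^ (q\<^sup>2) + mY * mT ^ (q\<^sup>2 - 1)) p = 0" if "p \<in> C" for p
      using that unfolding XYZT mpol_eval_simps pt_nth by (auto simp: C_def)
    ultimately have "mpol_eval (mZ ^ M * mT ^ (q\<^sup>2 - M) - mY ^ (q\<^sup>2) + mY * mT ^ (q\<^sup>2 - 1)) v = 0" by (rule van)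
    thus ?thesis unfolding XYZT mpol_eval_simps .
  qed
  have E3: "v $ 3 ^ (q ^ 3 + 1) - (v $ 1 ^ q * v $ 4 + v $ 1 * v $ 4 ^ q) *
      ((v $ 1 ^ q + v $ 1 * v $ 4 ^ (q - 1)) ^ (q - 1) - v $ 4 ^ ((q - 1) * q)) ^ (q + 1) = 0"
  proof -
    let ?A = "mZ ^ (q ^ 3 + 1) - (mX ^ q * mT + mX * mT ^ q) * ((mX ^ q + mX * mT ^ (q - 1)) ^ (q - 1) - mT ^ ((q - 1) * q)) ^ (q + 1)"
    have "homogeneous (1 + (q - 1)) (mX * mT ^ (q - 1))" by (rule homogeneous_mult[OF hp1(1) hp(4)])
    hence "homogeneous q (mX * mT ^ (q - 1))" using q2 by simp
    hence "homogeneous q (mX ^ q + mX * mT ^ (q - 1))" using hp by (intro homogeneous_add)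
    hence "homogeneous ((q - 1) * q) ((mX ^ q + mX * mT ^ (q - 1)) ^ (q - 1) - mT ^ ((q - 1) * q))"
      using hp by (intro homogeneous_diff homogeneous_power)
    hence h: "homogeneous (q + 1 + (q + 1) * ((q - 1) * q)) ((mX ^ q * mT + mX * mT ^ q) * ((mX ^ q + mX * mT ^ (q - 1)) ^ (q - 1) - mT ^ ((q - 1) * q)) ^ (q + 1))"
      by (rule homogeneous_mult[OF S1 homogeneous_power])
    have "q + 1 + (q + 1) * ((q - 1) * q) = (q + 1) * M" 
      by (simp add: M_def power2_eq_square diff_mult_distrib algebra_simps)
    hence h': "homogeneous (q ^ 3 + 1) ((mX ^ q * mT + mX * mT ^ q) * ((mX ^ q + mX * mT ^ (q - 1)) ^ (q - 1) - mT ^ ((q - 1) * q)) ^ (q + 1))"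
      using h by (simp only: M_factor)
    hence "homogeneous (q ^ 3 + 1) ?A" by (rule homogeneous_diff[OF hp(3)])
    moreover have "ev ?A p = 0" if p: "p \<in> C" for p
    proof -
      obtain x y z where xyz: "p = (x,y,z)" by (cases p)
      have 1: "x ^ q + x = y ^ (q + 1)" "z ^ M = y ^ (q\<^sup>2) - y" using p by (auto simp: xyz C_def)
      have "(q + 1) * (q - 1) + 1 = q\<^sup>2" using q2 by (simp add: power2_eq_square diff_mult_distrib2 algebra_simps)
      hence 2: "y ^ (q\<^sup>2) = y * (y ^ (q + 1)) ^ (q - 1)"
        by (metis Suc_eq_plus1 power_Suc power_mult)
      have "z ^ (q ^ 3 + 1) = (z ^ M) ^ (q + 1)" by (metis M_factor mult.commute power_mult)
      also have "z ^ M = y * ((y ^ (q + 1)) ^ (q - 1) - 1)" unfolding 1(2) 2 by (simp add: right_diff_distrib)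
      finally have "z ^ (q ^ 3 + 1) = y ^ (q + 1) * ((y ^ (q + 1)) ^ (q - 1) - 1) ^ (q + 1)"
        by (simp only: power_mult_distrib)
      thus ?thesis unfolding XYZT mpol_eval_simps pt_nth using 1(1) by (simp add: xyz)
    qed
    ultimately have "mpol_eval ?A v = 0" by (rule van)
    thus ?thesis unfolding XYZT mpol_eval_simps .
  qed
  show "P \<in> insert pinf (aff ` C)"
  proof (cases "v $ 4 = 0")
    case True
    have v2: "v $ 2 = 0" using E1 True q2 by (simp add: zero_power)
    have v3: "v $ 3 = 0" using E3 True q2 by (simp add: zero_power)
    have veq: "v = v $ 1 *s axis 1 1" using True v2 v3 by (simp add: vec_eq_iff forall_4 axis_def)
    hence "v $ 1 \<noteq> 0" using v(2) by auto
    hence "P = pinf" unfolding v(1) pinf_def using proj_point_scale veq by metis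
    thus ?thesis by simp
  next
    case False
    define p where "p = (v $ 1 / v $ 4, v $ 2 / v $ 4, v $ 3 / v $ 4)"
    have veq: "v = v $ 4 *s pt p" using False by (simp add: vec_eq_iff forall_4 p_def)
    hence P: "P = aff p" unfolding v(1) aff_def using proj_point_scale[OF False] by metis
    have sc: "ev A p = 0" if "homogeneous d A" "mpol_eval A v = 0" for d A
      using that False mpol_eval_scale[OF that(1), of "v $ 4" "pt p"] veq by auto
    let ?x = "v $ 1" and ?y = "v $ 2" and ?z = "v $ 3" and ?t = "v $ 4"
    have "(?y / ?t) ^ (q + 1) = (?x / ?t) ^ q + ?x / ?t"
      using E1 False by (simp add: power_divide field_simps)
    moreover have "(?z / ?t) ^ M = (?y / ?t) ^ (q\<^sup>2) - ?y / ?t"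
    proof -
      have t1: "?t ^ (q\<^sup>2) = ?t ^ M * ?t ^ (q\<^sup>2 - M)" using qM by (simp flip: power_add)
      have t2: "?t ^ (q\<^sup>2) = ?t * ?t ^ (q\<^sup>2 - 1)" using qq by (metis Suc_diff_1 less_trans zero_less_one power_Suc)
      have "?z ^ M * ?t ^ (q\<^sup>2 - M) = ?y ^ (q\<^sup>2) - ?y * ?t ^ (q\<^sup>2 - 1)" using E2 by (simp add: algebra_simps)
      hence "?z ^ M * ?t ^ (q\<^sup>2 - M) / ?t ^ (q\<^sup>2) = ?y ^ (q\<^sup>2) / ?t ^ (q\<^sup>2) - ?y * ?t ^ (q\<^sup>2 - 1) / ?t ^ (q\<^sup>2)"
        by (simp add: diff_divide_distrib)
      moreover have "?z ^ M * ?t ^ (q\<^sup>2 - M) / ?t ^ (q\<^sup>2) = (?z / ?t) ^ M" unfolding t1 using False by (simp add: power_divide)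
      moreover have "?y * ?t ^ (q\<^sup>2 - 1) / ?t ^ (q\<^sup>2) = ?y / ?t" unfolding t2 using False by simp
      ultimately show ?thesis by (simp add: power_divide)
    qed
    ultimately have "p \<in> C" by (simp add: C_def p_def)
    thus ?thesis using P by simp
  qed
qed

end

section \<open>The field with q^6 elements inside its algebraic closure\<close>

text \<open>
  Translation by 1 permutes the field, so it does not change the sum of all elements.
\<close>

lemma of_nat_CARD_eq_0: "of_nat CARD('a) = (0 :: 'a::{field,finite})"
proof -
  have "(\<Sum>x\<in>(UNIV::'a set). x) = (\<Sum>x\<in>(UNIV::'a set). x + 1)"
    by (rule sum.reindex_bij_witness[of _ "\<lambda>x. x + 1" "\<lambda>x. x - 1"]) auto
  thus ?thesis by (simp add: sum.distrib)
qed

text \<open>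
  Multiplication by \<open>x \<noteq> 0\<close> permutes the nonzero elements, so it does not change their product.
\<close>

lemma power_CARD_eq: "(x :: 'a::{field,finite}) ^ CARD('a) = x"
proof (cases "x = 0")
  case False
  have "(\<Prod>y\<in>UNIV-{0}. y) = (\<Prod>y\<in>UNIV-{0}. x * y)"
    by (rule prod.reindex_bij_witness[of _ "\<lambda>y. x * y" "\<lambda>y. y / x"]) (use False in auto)
  also have "\<dots> = x ^ (CARD('a) - 1) * (\<Prod>y\<in>UNIV-{0}. y)"
    by (simp add: prod.distrib)
  finally have "x ^ (CARD('a) - 1) = 1" by simp
  hence "x * x ^ (CARD('a) - 1) = x" by simp
  moreover have "Suc (CARD('a) - 1) = CARD('a)" by (simp add: card_gt_0_iff)
  ultimately show ?thesis by (metis power_Suc)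
qed (simp add: card_gt_0_iff)

lemma gk_curve_alg_closure:
  assumes q: "primepow q" and card: "CARD('a::{field,finite}) = q ^ 6"
  shows "gk_curve TYPE('a alg_closure) q"
proof
  obtain p n where p: "prime p" "n > 0" "q = p ^ n" using q by (auto simp: primepow_def)
  show "q \<ge> 2" using primepow_gt_Suc_0[OF q] by simp
  have "of_nat q ^ 6 = (0 :: 'a)" using of_nat_CARD_eq_0[where ?'a = 'a] card by simp
  hence q0: "of_nat q = (0 :: 'a)" by simp
  have "to_ac (of_nat q :: 'a) = 0" by (simp only: q0 to_ac_0)
  thus "of_nat q = (0 :: 'a alg_closure)" by simp
  have "CHAR('a) > 0" by (rule finite_imp_CHAR_pos) simp
  hence prime: "prime CHAR('a)" by (rule prime_CHAR_semidom)
  have "CHAR('a) dvd q" using q0 of_nat_eq_0_iff_char_dvd by blast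
  hence "CHAR('a) dvd p ^ n" by (simp only: p(3))
  hence "CHAR('a) = p" using prime p(1) prime_dvd_power primes_dvd_imp_eq by blast
  hence "prime CHAR('a alg_closure)" "q = CHAR('a alg_closure) ^ n" using prime p by auto
  thus "(x + y) ^ q = x ^ q + y ^ q" for x y :: "'a alg_closure" by (rule freshmans_dream')
qed

locale gk_rational = gk_curve q K for q and K :: "'a::{field,finite} alg_closure itself" +
  assumes card_a: "CARD('a) = q ^ 6"
begin

definition Fq6 :: "'a alg_closure set" where "Fq6 = range to_ac"

lemma Fq6_iff: "x \<in> Fq6 \<longleftrightarrow> x ^ (q ^ 6) = x"
proof -
  let ?p = "monom 1 (q ^ 6) - monom 1 1 :: 'a alg_closure poly"
  have "q ^ 6 > 1" using q2 one_less_power[of q 6] by simp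
  hence deg: "degree ?p = q ^ 6"
    by (intro antisym degree_le le_degree) auto
  hence p0: "?p \<noteq> 0" using \<open>q ^ 6 > 1\<close> by (metis degree_0 not_less_zero)
  have roots: "{x. poly ?p x = 0} = {x. x ^ (q ^ 6) = x}" by (simp add: poly_monom)
  have fin: "finite {x :: 'a alg_closure. x ^ (q ^ 6) = x}" using poly_roots_finite[OF p0] roots by simp
  have "Fq6 = {x. x ^ (q ^ 6) = x}"
  proof (rule card_subset_eq[OF fin])
    show sub: "Fq6 \<subseteq> {x. x ^ (q ^ 6) = x}"
      using power_CARD_eq[where ?'a = 'a] by (auto simp: Fq6_def card_a simp flip: to_ac_power)
    have "card Fq6 = q ^ 6" unfolding Fq6_def using card_a by (simp add: card_image inj_to_ac)
    moreover have "card {x :: 'a alg_closure. x ^ (q ^ 6) = x} \<le> q ^ 6"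
      using card_poly_roots_bound[OF p0] roots deg by simp
    ultimately show "card Fq6 = card {x :: 'a alg_closure. x ^ (q ^ 6) = x}" using card_mono[OF fin sub] by simp
  qed
  thus ?thesis by auto
qed

lemma subring_Fq6: "subring_set Fq6"
  unfolding subring_set_def Fq6_def
proof (intro conjI ballI)
  show "0 \<in> range to_ac" "1 \<in> range to_ac" "-1 \<in> range to_ac"
    by (metis rangeI to_ac_0, metis rangeI to_ac_1, metis rangeI to_ac_1 to_ac_minus)
  fix a b :: "'a alg_closure" assume "a \<in> range to_ac" "b \<in> range to_ac"
  then obtain a' b' where "a = to_ac a'" "b = to_ac b'" by auto
  thus "a + b \<in> range to_ac" "a * b \<in> range to_ac" by (auto simp flip: to_ac_add to_ac_mult)
qed

lemma frob_iterate: "x ^ (q ^ Suc n) = (x ^ (q ^ n)) ^ q" for x :: "'a alg_closure"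
  by (simp add: mult.commute flip: power_mult)

lemma frob_n: "(x + y) ^ (q ^ n) = x ^ (q ^ n) + y ^ (q ^ n)" for x y :: "'a alg_closure"
  by (induction n) (simp_all only: frob_iterate frob power_0 power_one_right)

lemma frob_n_diff: "(x - y) ^ (q ^ n) = x ^ (q ^ n) - y ^ (q ^ n)" for x y :: "'a alg_closure"
  using frob_n[of "x - y" y n] by (simp add: algebra_simps)

lemma frob_n_sum: "(\<Sum>i\<in>I. f i) ^ (q ^ n) = (\<Sum>i\<in>I. f i ^ (q ^ n) :: 'a alg_closure)"
proof (induction I rule: infinite_finite_induct)
  case (insert x F) thus ?case by (simp add: frob_n)
qed (use q2 in auto)

lemma frob_n_inj: "x ^ (q ^ n) = y ^ (q ^ n) \<Longrightarrow> x = y" for x y :: "'a alg_closure"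
  using frob_n_diff[of x y n] q2 by simp

section \<open>The rational points of the GK curve\<close>

text \<open>
  The set \<open>\<Gamma>\<close>, formed in the algebraic closure.
\<close>

definition GammaK :: "'a alg_closure set" where
  "GammaK = {c. c ^ ((q ^ 3 + 1) * (q\<^sup>2 - 1)) + c ^ ((q ^ 3 + 1) * (q\<^sup>2 - q)) + 1 = 0}"

lemma q_sizes: "q\<^sup>2 > q" "q > 0" "q\<^sup>2 > 1"
  using q2 one_less_power[of q 2] by (auto simp: power2_eq_square)

text \<open>
  In characteristic \<open>p\<close> the derivative of the defining polynomial is a monomial with nonzero coefficient, and 0 is not a root.
\<close>

lemma card_GammaK: "card GammaK = (q ^ 3 + 1) * (q\<^sup>2 - 1)"
proof -
  let ?n = "(q ^ 3 + 1) * (q\<^sup>2 - 1)" and ?l = "(q ^ 3 + 1) * (q\<^sup>2 - q)"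
  let ?p = "monom 1 ?n + monom 1 ?l + 1 :: 'a alg_closure poly"
  have nl: "?l < ?n" using q_sizes q2 by (intro mult_strict_left_mono) auto
  have l0: "?l > 0" using q_sizes by simp
  have deg: "degree ?p = ?n"
    using nl by (intro antisym degree_le le_degree) (auto simp: coeff_1)
  have cn: "of_nat ?n = (-1 :: 'a alg_closure)" "of_nat ?l = (0 :: 'a alg_closure)"
  proof -
    have "of_nat (q\<^sup>2 - 1) = (of_nat q ^ 2 - 1 :: 'a alg_closure)" "of_nat (q\<^sup>2 - q) = (of_nat q ^ 2 - of_nat q :: 'a alg_closure)"
      using q_sizes by (simp_all add: of_nat_diff)
    thus "of_nat ?n = (-1 :: 'a alg_closure)" "of_nat ?l = (0 :: 'a alg_closure)"
      unfolding of_nat_mult of_nat_add of_nat_power by (simp_all add: char_q)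
  qed
  have "card {x. poly ?p x = 0} = degree ?p"
  proof (rule card_roots_separable)
    show "?p \<noteq> 0" using deg nl by (metis degree_0 not_less_zero)
    fix a assume a: "poly ?p a = 0"
    have "poly (pderiv ?p) a = of_nat ?n * a ^ (?n - 1) + of_nat ?l * a ^ (?l - 1)"
      by (simp only: pderiv_add pderiv_monom pderiv_1 poly_add poly_monom mult_1_right add_0_right)
    hence "poly (pderiv ?p) a = - (a ^ (?n - 1))" unfolding cn by simp
    moreover have "a \<noteq> 0" using a l0 nl by (auto simp: poly_monom zero_power)
    ultimately show "poly (pderiv ?p) a \<noteq> 0" by simp
  qed
  thus ?thesis unfolding deg GammaK_def by (simp add: poly_monom)
qed

lemma GammaK_nonzero: "c \<in> GammaK \<Longrightarrow> c \<noteq> 0"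
  using q_sizes by (auto simp: GammaK_def zero_power)

text \<open>
  With \<open>v = 1 / u\<close> the equation says \<open>v + v\<^sup>q + v\<^bsup>q\<^sup>2\<^esup> = 0\<close>. Subtracting it from its \<open>q\<close>-th power gives
  \<open>v\<^bsup>q\<^sup>3\<^esup> = v\<close>.
\<close>

lemma GammaK_norm:
  assumes c: "c \<in> GammaK"
  defines "u \<equiv> c ^ (q ^ 3 + 1)"
  shows "u ^ (q\<^sup>2 - 1) + u ^ (q\<^sup>2 - q) + 1 = 0" "u \<noteq> 0" "u ^ (q ^ 3) = u"
proof -
  show eq: "u ^ (q\<^sup>2 - 1) + u ^ (q\<^sup>2 - q) + 1 = 0" using c unfolding GammaK_def u_def power_mult by simp
  show u0: "u \<noteq> 0" using GammaK_nonzero[OF c] by (simp add: u_def)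
  define v where "v = inverse u"
  have v0: "v \<noteq> 0" using u0 by (simp add: v_def)
  have "u ^ (q\<^sup>2 - 1) * v ^ (q\<^sup>2) = v" "u ^ (q\<^sup>2 - q) * v ^ (q\<^sup>2) = v ^ q"
  proof -
    have split: "v ^ (q\<^sup>2) = v ^ (q\<^sup>2 - 1) * v" "v ^ (q\<^sup>2) = v ^ (q\<^sup>2 - q) * v ^ q"
      using q_sizes by (simp_all flip: power_add power_Suc2)
    show "u ^ (q\<^sup>2 - 1) * v ^ (q\<^sup>2) = v" unfolding split(1) using u0 by (simp add: v_def power_inverse)
    show "u ^ (q\<^sup>2 - q) * v ^ (q\<^sup>2) = v ^ q" unfolding split(2) using u0 by (simp add: v_def power_inverse)
  qed
  moreover have "(u ^ (q\<^sup>2 - 1) + u ^ (q\<^sup>2 - q) + 1) * v ^ (q\<^sup>2) = 0" using eq by simp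
  ultimately have tr: "v + v ^ q + v ^ (q\<^sup>2) = 0" by (simp add: distrib_right)
  have "v ^ q + v ^ (q\<^sup>2) + v ^ (q ^ 3) = (v + v ^ q + v ^ (q\<^sup>2)) ^ q"
    by (simp add: frob power2_eq_square power3_eq_cube flip: power_mult)
  hence "v ^ q + v ^ (q\<^sup>2) + v ^ (q ^ 3) = 0" using tr q2 by simp
  hence "v ^ (q ^ 3) = v" using tr by (metis add.assoc add.commute add_left_cancel)
  thus "u ^ (q ^ 3) = u" using v_def by (metis inverse_inverse_eq power_inverse)
qed

lemma GammaK_Fq6: "GammaK \<subseteq> Fq6"
proof
  fix c assume c: "c \<in> GammaK"
  define u where "u = c ^ (q ^ 3 + 1)"
  have u: "u ^ (q ^ 3) = u" using GammaK_norm(3)[OF c] by (simp add: u_def)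
  have "(c ^ (q ^ 3)) ^ (q ^ 3) = c ^ (q ^ 6)" by (simp flip: power_mult power_add)
  hence "u ^ (q ^ 3) = c ^ (q ^ 6) * c ^ (q ^ 3)"
    by (simp add: u_def power_mult_distrib)
  moreover have "u = c * c ^ (q ^ 3)" by (simp add: u_def)
  ultimately have "c ^ (q ^ 6) = c" using u GammaK_nonzero[OF c] by simp
  thus "c \<in> Fq6" by (simp add: Fq6_iff)
qed

text \<open>
  Write \<open>b = c\<^sup>M\<close> and \<open>b\<^sub>n\<close>, \<open>y\<^sub>n\<close>, \<open>x\<^sub>n\<close> for the \<open>q\<^sup>n\<close>-th powers of \<open>b\<close>, \<open>y\<close>, \<open>x\<close>. The curve equations are the
  recursions \<open>y\<^sub>n\<^sub>+\<^sub>2 = y\<^sub>n + b\<^sub>n\<close> and \<open>x\<^sub>n\<^sub>+\<^sub>1 = y\<^sub>n y\<^sub>n\<^sub>+\<^sub>1 - x\<^sub>n\<close>. Following them up to \<open>n = 6\<close> shows that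
  \<open>y\<^sub>6 = y\<close> amounts to \<open>b\<^sub>0 + b\<^sub>2 + b\<^sub>4 = 0\<close> and then \<open>x\<^sub>6 = x\<close> to \<open>b\<^sub>0 b\<^sub>1 + b\<^sub>0 b\<^sub>3 + b\<^sub>2 b\<^sub>3 = 0\<close>. The second
  equation is the one that defines \<open>\<Gamma>\<close>, multiplied by \<open>u = b\<^sub>0 b\<^sub>1\<close>, and the first one follows from
  its \<open>q\<close>-th power, because \<open>b\<^sub>3 b\<^sub>4 = u\<^bsup>q\<^sup>3\<^esup> = u\<close>.
\<close>

lemma fibre_rational:
  assumes p: "(x, y, c) \<in> C" and c: "c \<in> insert 0 GammaK"
  shows "x \<in> Fq6" "y \<in> Fq6"
proof -
  have x: "x ^ q + x = y ^ (q + 1)" and y: "y ^ (q\<^sup>2) = y + c ^ M" using p by (auto simp: C_def)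
  define b where "b = c ^ M"
  define bs where "bs n = b ^ (q ^ n)" for n
  define ys where "ys n = y ^ (q ^ n)" for n
  define xs where "xs n = x ^ (q ^ n)" for n
  have BS: "bs (Suc n) = bs n ^ q" and YS: "ys (Suc n) = ys n ^ q" and XS: "xs (Suc n) = xs n ^ q" for n
    by (simp_all only: bs_def ys_def xs_def frob_iterate)
  have Y2: "ys (Suc (Suc n)) = ys n + bs n" for n
  proof (induction n)
    case 0 show ?case using y by (simp add: ys_def bs_def b_def power2_eq_square)
  next
    case (Suc n) thus ?case using YS BS frob by metis
  qed
  have X1: "xs (Suc n) = ys n * ys (Suc n) - xs n" for n
  proof (induction n)
    case 0 show ?case using x by (simp add: xs_def ys_def algebra_simps)
  next
    case (Suc n)
    have "xs (Suc (Suc n)) = (ys n * ys (Suc n) - xs n) ^ q" using Suc XS by metis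
    thus ?case by (simp only: frob_diff power_mult_distrib YS XS)
  qed
  have key: "bs 0 + bs 2 + bs 4 = 0 \<and> bs 0 * bs 1 + bs 0 * bs 3 + bs 2 * bs 3 = 0"
  proof (cases "c = 0")
    case True
    hence "b = 0" using M_pos by (simp add: b_def zero_power)
    hence "bs n = 0" for n using q2 by (simp add: bs_def zero_power)
    thus ?thesis by simp
  next
    case False
    hence cG: "c \<in> GammaK" using c by simp
    define u where "u = c ^ (q ^ 3 + 1)"
    have uu: "u ^ (q\<^sup>2 - 1) + u ^ (q\<^sup>2 - q) + 1 = 0" "u \<noteq> 0" "u ^ (q ^ 3) = u"
      using GammaK_norm[OF cG] by (simp_all add: u_def)
    have ub: "u = b ^ (q + 1)" unfolding u_def b_def by (metis M_factor mult.commute power_mult)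
    have Bb: "bs n = b ^ (q ^ n)" for n by (simp add: bs_def)
    have u1: "u = bs 0 * bs 1" by (simp add: ub Bb)
    \<comment> \<open>The three terms of the equation for \<open>u\<close>, multiplied by \<open>u\<close>, in terms of the conjugates of \<open>b\<close>.\<close>
    have u2: "u ^ (q\<^sup>2) = bs 2 * bs 3"
      unfolding ub Bb by (simp add: power_mult_distrib power2_eq_square power3_eq_cube mult_ac flip: power_mult)
    have u3: "u ^ (q\<^sup>2 - q + 1) = bs 0 * bs 3"
    proof -
      have "u ^ (q\<^sup>2 - q + 1) = b ^ ((q + 1) * M)" unfolding ub M_def by (simp only: power_mult)
      thus ?thesis unfolding M_factor Bb by (simp add: power_add)
    qed
    have "u * (u ^ (q\<^sup>2 - 1) + u ^ (q\<^sup>2 - q) + 1) = u ^ (q\<^sup>2) + u ^ (q\<^sup>2 - q + 1) + u"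
    proof -
      have "u * u ^ (q\<^sup>2 - 1) = u ^ (q\<^sup>2)" using q_sizes power_Suc[of u "q\<^sup>2 - 1"] by simp
      thus ?thesis by (simp add: distrib_left)
    qed
    hence "u ^ (q\<^sup>2) + u ^ (q\<^sup>2 - q + 1) + u = 0" unfolding uu(1) by simp
    hence "bs 2 * bs 3 + bs 0 * bs 3 + u = 0" by (simp only: u2 u3)
    hence I: "bs 0 * bs 1 + bs 0 * bs 3 + bs 2 * bs 3 = 0" unfolding u1 by (simp add: add_ac)
    have "(bs 0 * bs 1 + bs 0 * bs 3 + bs 2 * bs 3) ^ q = bs 1 * bs 2 + bs 1 * bs 4 + bs 3 * bs 4"
      by (simp add: frob power_mult_distrib BS[symmetric] eval_nat_numeral)
    hence I': "bs 1 * bs 2 + bs 1 * bs 4 + bs 3 * bs 4 = 0" unfolding I using q2 by (simp add: zero_power)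
    have u4: "u ^ (q ^ 3) = bs 3 * bs 4"
      unfolding ub Bb by (simp add: power_mult_distrib eval_nat_numeral flip: power_mult)
    have b1: "bs 1 \<noteq> 0" using u1 uu(2) by auto
    have "bs 3 * bs 4 = bs 0 * bs 1" using u4 u1 uu(3) by simp
    hence "bs 1 * (bs 0 + bs 2 + bs 4) = 0" using I' by (simp add: algebra_simps)
    thus ?thesis using I b1 by simp
  qed
  have Ys: "ys 2 = ys 0 + bs 0" "ys 3 = ys 1 + bs 1" "ys 4 = ys 0 + bs 0 + bs 2" "ys 5 = ys 1 + bs 1 + bs 3" "ys 6 = ys 0 + bs 0 + bs 2 + bs 4"
    using Y2[of 0] Y2[of 1] Y2[of 2] Y2[of 3] Y2[of 4] by (simp_all add: eval_nat_numeral)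
  have Y6: "ys 6 = ys 0" using Ys key by (simp add: add.assoc)
  thus "y \<in> Fq6" by (simp add: Fq6_iff ys_def)
  have Xs: "xs 1 = ys 0 * ys 1 - xs 0" "xs 2 = ys 1 * ys 2 - xs 1" "xs 3 = ys 2 * ys 3 - xs 2" "xs 4 = ys 3 * ys 4 - xs 3"
      "xs 5 = ys 4 * ys 5 - xs 4" "xs 6 = ys 5 * ys 6 - xs 5"
    using X1[of 0] X1[of 1] X1[of 2] X1[of 3] X1[of 4] X1[of 5] by (simp_all add: eval_nat_numeral)
  have "xs 6 = xs 0 - (ys 0 * ys 1 - ys 1 * ys 2 + ys 2 * ys 3 - ys 3 * ys 4 + ys 4 * ys 5 - ys 5 * ys 0)"
    unfolding Xs Y6 by (simp add: algebra_simps)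
  also have "ys 0 * ys 1 - ys 1 * ys 2 + ys 2 * ys 3 - ys 3 * ys 4 + ys 4 * ys 5 - ys 5 * ys 0 = bs 0 * bs 1 + bs 0 * bs 3 + bs 2 * bs 3"
    unfolding Ys by (simp add: algebra_simps)
  finally have "xs 6 = xs 0" using key by simp
  thus "x \<in> Fq6" by (simp add: Fq6_iff xs_def)
qed

lemma to_ac_Gamma: "to_ac ` (Gamma q :: 'a set) = GammaK"
proof -
  have "to_ac x \<in> GammaK \<longleftrightarrow> x \<in> Gamma q" for x :: 'a
  proof -
    have "to_ac x \<in> GammaK \<longleftrightarrow> to_ac (x ^ ((q ^ 3 + 1) * (q\<^sup>2 - 1)) + x ^ ((q ^ 3 + 1) * (q\<^sup>2 - q)) + 1) = 0"
      unfolding GammaK_def mem_Collect_eq to_ac_add to_ac_power to_ac_1 ..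
    thus ?thesis by (simp only: to_ac_eq_0_iff Gamma_def mem_Collect_eq)
  qed
  thus ?thesis using GammaK_Fq6 unfolding Fq6_def by auto
qed

lemma card_Gamma0: "card (Gamma0 q :: 'a set) = (q ^ 3 + 1) * (q\<^sup>2 - 1) + 1"
proof -
  have "card (Gamma q :: 'a set) = card GammaK"
    using to_ac_Gamma card_image[of to_ac "Gamma q :: 'a set"] inj_to_ac by (metis inj_on_subset subset_UNIV)
  moreover have "(0 :: 'a) \<notin> Gamma q" using GammaK_nonzero to_ac_Gamma by (metis imageI to_ac_0)
  ultimately show ?thesis by (simp add: Gamma0_def card_GammaK)
qed

lemma card_fibres:
  assumes "A \<subseteq> (Gamma0 q :: 'a set)"
  defines "S \<equiv> {p \<in> C. zc p \<in> to_ac ` A}"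
  shows "finite S" "card S = q ^ 3 * card A" "\<And>x y z. (x, y, z) \<in> S \<Longrightarrow> x \<in> Fq6 \<and> y \<in> Fq6 \<and> z \<in> Fq6"
proof -
  have S: "S = (\<Union>c\<in>A. {p \<in> C. zc p = to_ac c})" by (auto simp: S_def)
  have finA: "finite A" by simp
  show "finite S" unfolding S using finA fibre_finite by blast
  have "card S = (\<Sum>c\<in>A. card {p \<in> C. zc p = to_ac c})"
    unfolding S by (rule card_UN_disjoint) (use finA fibre_finite in auto)
  thus "card S = q ^ 3 * card A" by (simp add: fibre_card)
  fix x y z assume p: "(x, y, z) \<in> S"
  then obtain c where c: "c \<in> A" "z = to_ac c" by (auto simp: S_def)
  hence "z \<in> insert 0 GammaK" using assms(1) to_ac_Gamma by (auto simp: Gamma0_def)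
  thus "x \<in> Fq6 \<and> y \<in> Fq6 \<and> z \<in> Fq6" using fibre_rational[of x y z] p c by (auto simp: S_def Fq6_def)
qed

end

section \<open>The code\<close>

lemma code_dim_eq_card:
  fixes w :: "'e \<Rightarrow> 'i \<Rightarrow> 'a::field"
  assumes fin: "finite S"
    and indep: "\<And>\<alpha>. (\<And>P. (\<Sum>e\<in>S. \<alpha> e * w e P) = 0) \<Longrightarrow> \<forall>e\<in>S. \<alpha> e = 0"
  shows "code_dim {\<lambda>P. \<Sum>e\<in>S. \<alpha> e * w e P | \<alpha>. True} = card S"
proof -
  interpret vs: vector_space "\<lambda>(a::'a) (f :: 'i \<Rightarrow> 'a) i. a * f i"
    by standard (auto simp: fun_eq_iff algebra_simps)
  have sum_fun: "(\<Sum>v\<in>T. (\<lambda>i. u v * v i)) = (\<lambda>P. \<Sum>v\<in>T. u v * v P)" if "finite T" for u :: "('i \<Rightarrow> 'a) \<Rightarrow> 'a" and T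
    using that by (induction T rule: finite_induct) (auto simp: fun_eq_iff)
  have inj: "inj_on w S"
  proof (rule inj_onI, rule ccontr)
    fix e e' assume e: "e \<in> S" "e' \<in> S" "w e = w e'" "e \<noteq> e'"
    define \<alpha> where "\<alpha> = (\<lambda>x. if x = e then 1 else if x = e' then -1 else (0::'a))"
    have "(\<Sum>x\<in>S. \<alpha> x * w x P) = 0" for P
    proof -
      have "(\<Sum>x\<in>S. \<alpha> x * w x P) = (\<Sum>x\<in>{e, e'}. \<alpha> x * w x P)"
        using fin e by (intro sum.mono_neutral_right) (auto simp: \<alpha>_def)
      thus ?thesis using e by (simp add: \<alpha>_def)
    qed
    hence "\<alpha> e = 0" using indep e(1) by blast
    thus False by (simp add: \<alpha>_def)
  qed
  have re: "(\<Sum>v\<in>w ` S. u v * v P) = (\<Sum>e\<in>S. u (w e) * w e P)" for u P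
    by (rule sum.reindex[OF inj, unfolded o_def])
  have ind: "vs.independent (w ` S)"
  proof (rule vs.independent_if_scalars_zero)
    show "finite (w ` S)" using fin by simp
    fix u v assume u: "(\<Sum>x\<in>w ` S. (\<lambda>i. u x * x i)) = 0" and v: "v \<in> w ` S"
    have "(\<Sum>e\<in>S. u (w e) * w e P) = 0" for P
      using fun_cong[OF u, of P] re[of u P] sum_fun[of "w ` S" u] fin by simp
    hence "\<forall>e\<in>S. u (w e) = 0" using indep[of "\<lambda>e. u (w e)"] by blast
    thus "u v = 0" using v by auto
  qed
  have "vs.span (w ` S) = {\<lambda>P. \<Sum>e\<in>S. \<alpha> e * w e P | \<alpha>. True}"
  proof -
    have "vs.span (w ` S) = range (\<lambda>u. \<Sum>v\<in>w ` S. (\<lambda>i. u v * v i))"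
      using fin by (intro vs.span_finite) simp
    also have "\<dots> = range (\<lambda>u. \<lambda>P. \<Sum>e\<in>S. u (w e) * w e P)"
      using sum_fun[of "w ` S"] fin re by simp
    also have "\<dots> = {\<lambda>P. \<Sum>e\<in>S. \<alpha> e * w e P | \<alpha>. True}"
    proof (intro equalityI subsetI)
      fix f assume "f \<in> {\<lambda>P. \<Sum>e\<in>S. \<alpha> e * w e P | \<alpha>. True}"
      then obtain \<alpha> where \<alpha>: "f = (\<lambda>P. \<Sum>e\<in>S. \<alpha> e * w e P)" by blast
      have "f = (\<lambda>P. \<Sum>e\<in>S. \<alpha> (the_inv_into S w (w e)) * w e P)"
        unfolding \<alpha> using the_inv_into_f_f[OF inj] by (intro ext sum.cong) auto
      thus "f \<in> range (\<lambda>u. \<lambda>P. \<Sum>e\<in>S. u (w e) * w e P)"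
        by (intro image_eqI[of _ _ "\<lambda>v. \<alpha> (the_inv_into S w v)"]) auto
    qed auto
    finally show ?thesis .
  qed
  moreover have "vs.dim (vs.span (w ` S)) = card S"
    using vs.dim_span_eq_card_independent[OF ind] card_image[OF inj] by simp
  ultimately show ?thesis by (simp add: code_dim_def)
qed

lemma lookup_sum_divisor: "finite S \<Longrightarrow> Poly_Mapping.lookup (sum_divisor m S) P = (if P \<in> S then int m else 0)"
  by (simp add: sum_divisor_def lookup_sum lookup_single when_def)

text \<open>
  The code given by the planes \<open>Z = c\<^sub>i\<close>. The function \<open>denom\<close> is \<open>h\<^sup>m\<close> with \<open>h = \<Prod> (z - c\<^sub>i)\<close>, and
  \<open>pole_bound\<close> is the degree of the divisor.
\<close>

locale gk_code = gk_rational q K for q and K :: "'a::{field,finite} alg_closure itself" +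
  fixes c :: "nat \<Rightarrow> 'a" and s m :: nat
  assumes c_inj: "inj_on c {0..s}"
begin

definition plane_prod :: "'a alg_closure point \<Rightarrow> 'a alg_closure" where
  "plane_prod p = (\<Prod>i\<in>{0..s}. zc p - to_ac (c i))"

definition denom :: "'a alg_closure point \<Rightarrow> 'a alg_closure" where
  "denom p = plane_prod p ^ m"

definition pole_bound :: nat where "pole_bound = m * (1 + (s + 1) * q ^ 3)"

definition pole_points :: "('a alg_closure, 4) ppoint set" where
  "pole_points = (\<Union>i\<in>{0..s}. V \<inter> zeta_plane (c i))"

definition on_planes :: "'a alg_closure point \<Rightarrow> bool" where
  "on_planes p \<longleftrightarrow> (\<exists>i\<in>{0..s}. zc p = to_ac (c i))"

lemma plane_prod_eq_0: "plane_prod p = 0 \<longleftrightarrow> on_planes p"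
  by (auto simp: plane_prod_def on_planes_def)

lemma plane_prod_Fq6: "plane_prod \<in> polyfuns Fq6"
proof -
  have "to_ac x \<in> Fq6" "1 \<in> Fq6" "-1 \<in> Fq6" for x using subring_Fq6 by (auto simp: Fq6_def subring_set_def)
  thus ?thesis unfolding plane_prod_def[abs_def] by (intro polyfuns_prod polyfuns_diff polyfuns.Z polyfuns.const) auto
qed

lemma denom_Fq6: "denom \<in> polyfuns Fq6"
  unfolding denom_def[abs_def] using subring_Fq6 by (intro polyfuns_power plane_prod_Fq6) (simp add: subring_set_def)

lemma polyfuns_mono: "S \<subseteq> S' \<Longrightarrow> f \<in> polyfuns S \<Longrightarrow> f \<in> polyfuns S'" for S S' :: "'a alg_closure set"
proof -
  assume S: "S \<subseteq> S'" and "f \<in> polyfuns S"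
  from this(2) show ?thesis by induction (use S in \<open>auto intro: polyfuns.intros\<close>)
qed

lemma Fq6_R: "f \<in> polyfuns Fq6 \<Longrightarrow> f \<in> R"
  by (rule polyfuns_mono) auto

lemma z_lead: "lead (\<lambda>p. zc p - a) (q ^ 3)"
proof -
  have "lead (mon (0,0,1)) (q ^ 3)" using lead_mon[of "(0,0,1)"] by (simp add: wt_def)
  moreover have "(\<lambda>p. (-a) * mon (0,0,0) p) \<in> Filt (q ^ 3)"
    using q2 by (intro Filt_scale mon_Filt) (simp add: wt_def)
  ultimately have "lead (\<lambda>p. mon (0,0,1) p + (-a) * mon (0,0,0) p) (q ^ 3)" by (rule lead_add_lower)
  thus ?thesis by (simp add: mon_altdef)
qed

lemma plane_prod_lead: "lead plane_prod ((s + 1) * q ^ 3)"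
proof -
  have "lead (\<lambda>p. \<Prod>i\<in>I. zc p - to_ac (c i)) (card I * q ^ 3)" if "finite I" for I
    using that
  proof (induction I rule: finite_induct)
    case empty
    have "lead (mon (0,0,0)) (wt (0,0,0))" by (rule lead_mon)
    moreover have "wt (0,0,0) = 0" by (simp add: wt_def)
    ultimately have "lead (mon (0,0,0)) 0" by simp
    hence "lead (\<lambda>p. 1) 0" by (rule lead_cong) (simp add: mon_altdef)
    thus ?case by simp
  next
    case (insert i I)
    have "lead (\<lambda>p. (zc p - to_ac (c i)) * (\<Prod>i\<in>I. zc p - to_ac (c i))) (q ^ 3 + card I * q ^ 3)"
      by (rule lead_mult[OF z_lead insert.IH])
    thus ?case using insert.hyps by simp
  qed
  from this[of "{0..s}"] show ?thesis unfolding plane_prod_def[abs_def] by simp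
qed

lemma nz_plane_prod: "nz plane_prod" using plane_prod_lead by (rule lead_nz)

lemma nz_denom: "nz denom" unfolding denom_def[abs_def] by (intro nz_power nz_plane_prod Fq6_R plane_prod_Fq6)

lemma denom_R: "denom \<in> R" by (rule Fq6_R[OF denom_Fq6])

lemma rho_denom: "rho denom = m * ((s + 1) * q ^ 3)"
  unfolding denom_def[abs_def] using rho_power[OF Fq6_R[OF plane_prod_Fq6] nz_plane_prod] rho_eq[OF plane_prod_lead] by simp

text \<open>
  As the \<open>c\<^sub>i\<close> are distinct, only one factor of \<open>h\<close> vanishes at a point on one of the planes.
\<close>

lemma mult_at_denom:
  assumes P: "P \<in> C" shows "mult_at P denom = (if on_planes P then m else 0)"
proof (cases "on_planes P")
  case False
  hence "denom P \<noteq> 0" using plane_prod_eq_0 by (simp add: denom_def)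
  thus ?thesis using mult_at_unit[OF P denom_R] False by simp
next
  case True
  then obtain i where i: "i \<in> {0..s}" "zc P = to_ac (c i)" by (auto simp: on_planes_def)
  define g where "g p = (\<Prod>j\<in>{0..s} - {i}. zc p - to_ac (c j))" for p
  have g: "g \<in> R" unfolding g_def[abs_def] by (intro polyfuns_prod R_intros) auto
  have gP: "g P \<noteq> 0"
  proof -
    have "to_ac (c i) \<noteq> to_ac (c j)" if "j \<in> {0..s} - {i}" for j
      using c_inj that i(1) by (auto simp: inj_on_def)
    thus ?thesis by (auto simp: g_def i(2))
  qed
  have "plane_prod = (\<lambda>p. (zc p - zc P) * g p)"
  proof
    fix p show "plane_prod p = (zc p - zc P) * g p"
      unfolding plane_prod_def g_def i(2) using i(1) by (intro prod.remove) auto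
  qed
  hence "order_at P plane_prod (1 + 0)" using order_at_mult[OF order_at_z order_at_unit[of g, OF g gP]] by simp
  hence h1: "order_at P plane_prod 1" by simp
  have "order_at P (\<lambda>p. plane_prod p ^ n) n" for n
  proof (induction n)
    case 0 show ?case using order_at_unit[of "\<lambda>_. 1" P] by (simp add: R_const)
  next
    case (Suc n) show ?case using order_at_mult[OF h1 Suc] by simp
  qed
  from mult_at_eq[OF P this[of m]] True show ?thesis unfolding denom_def[abs_def] by simp
qed

lemma aff_in_zeta_plane: "aff p \<in> zeta_plane (d :: 'a) \<longleftrightarrow> zc p = to_ac d"
proof
  assume "aff p \<in> zeta_plane d"
  then obtain v :: "'a alg_closure ^ 4" where v: "aff p = proj_point v" "v $ 3 = to_ac d * v $ 4" by (auto simp: zeta_plane_def)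
  have "1 *s v \<in> proj_point v" unfolding proj_point_def by (intro CollectI exI[of _ 1]) auto
  hence "v \<in> aff p" using v(1) by simp
  then obtain a where a: "v = a *s pt p" "a \<noteq> 0" by (auto simp: aff_def proj_point_def)
  have "a * zc p = to_ac d * a" using v(2) by (simp add: a(1))
  thus "zc p = to_ac d" using a(2) by simp
next
  assume "zc p = to_ac d"
  moreover have "pt p \<noteq> 0" by (metis pt_nth(4) zero_index zero_neq_one)
  ultimately show "aff p \<in> zeta_plane d" unfolding zeta_plane_def aff_def by (intro CollectI exI[of _ "pt p"]) auto
qed

lemma pinf_in_zeta_plane: "pinf \<in> zeta_plane (d :: 'a)"
proof -
  have "(axis 1 1 :: 'a alg_closure ^ 4) \<noteq> 0" by (simp add: axis_eq_0_iff)
  moreover have "(axis 1 1 :: 'a alg_closure ^ 4) $ 3 = 0" "(axis 1 1 :: 'a alg_closure ^ 4) $ 4 = 0"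
    by (simp_all add: axis_def)
  ultimately show ?thesis unfolding zeta_plane_def pinf_def
    by (intro CollectI exI[of _ "axis 1 1 :: 'a alg_closure ^ 4"]) simp
qed

lemma aff_in_pole_points: "p \<in> C \<Longrightarrow> aff p \<in> pole_points \<longleftrightarrow> on_planes p"
  using aff_in_V by (auto simp: pole_points_def on_planes_def aff_in_zeta_plane)

lemma pinf_in_pole_points: "pinf \<in> pole_points"
  using pinf_in_V pinf_in_zeta_plane unfolding pole_points_def by (intro UN_I[of 0]) auto

lemma finite_pole_points: "finite pole_points"
proof -
  have "pole_points \<subseteq> insert pinf (\<Union>i\<in>{0..s}. aff ` {p \<in> C. zc p = to_ac (c i)})"
    using V_eq by (auto simp: pole_points_def aff_in_zeta_plane)
  thus ?thesis by (rule finite_subset) (auto intro: fibre_finite)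
qed

lemma ord_aff: "P \<in> C \<Longrightarrow> a \<in> R \<Longrightarrow> b \<in> R \<Longrightarrow> nz a \<Longrightarrow> nz b \<Longrightarrow>
    ord_at V (aff P) (fr a b) = int (mult_at P a) - int (mult_at P b)"
  using gk_valuation.ord_at_fr[OF valuation_aff] by blast

lemma ord_pinf: "a \<in> R \<Longrightarrow> b \<in> R \<Longrightarrow> nz a \<Longrightarrow> nz b \<Longrightarrow>
    ord_at V pinf (fr a b) = int (rho b) - int (rho a)"
  using gk_valuation.ord_at_fr[OF valuation_pinf, of a b] by simp

definition comb :: "(nat \<times> nat \<times> nat \<Rightarrow> 'a) \<Rightarrow> 'a alg_closure point \<Rightarrow> 'a alg_closure" where
  "comb \<alpha> p = (\<Sum>e\<in>Red_below (pole_bound + 1). to_ac (\<alpha> e) * mon e p)"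

lemma comb_Fq6: "comb \<alpha> \<in> polyfuns Fq6"
proof -
  have "to_ac x \<in> Fq6" "1 \<in> Fq6" "0 \<in> Fq6" for x using subring_Fq6 by (auto simp: Fq6_def subring_set_def)
  thus ?thesis unfolding comb_def[abs_def]
    by (intro polyfuns_sum polyfuns.mult polyfuns.const polyfuns_mon) auto
qed

lemma comb_R: "comb \<alpha> \<in> R" by (rule Fq6_R[OF comb_Fq6])

lemma comb_Filt: "comb \<alpha> \<in> Filt (pole_bound + 1)"
  unfolding comb_def[abs_def] by (intro Filt_sum Filt_scale mon_Filt_Red)

lemma comb_rho: "nz (comb \<alpha>) \<Longrightarrow> rho (comb \<alpha>) \<le> pole_bound"
  using lead_Filt_iff[OF lead_rho[OF comb_R[of \<alpha>]], of "pole_bound + 1"] comb_Filt[of \<alpha>] by simp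

definition pole_divisor :: "('a alg_closure, 4) pdivisor" where "pole_divisor = sum_divisor m pole_points"

lemma rational_mpol_iff: "rational_mpol A \<longleftrightarrow> coefs_in Fq6 A"
  by (simp add: rational_mpol_def coefs_in_def Fq6_def)

text \<open>
  The poles of \<open>1 / denom\<close> at the affine points are those allowed by the divisor, and at \<open>P\<^sub>\<infinity>\<close> the bound
  on the weight of \<open>comb \<alpha>\<close> is \<open>rho denom + m\<close>.
\<close>

lemma comb_in_riemann_roch: "fr (comb \<alpha>) denom \<in> riemann_roch_space V pole_divisor"
proof (cases "nz (comb \<alpha>)")
  case False
  hence "fr (comb \<alpha>) denom = \<zero>\<^bsub>FF\<^esub>" using fr_eq_zero_iff[OF comb_R denom_R nz_denom] by simp
  thus ?thesis by (simp add: riemann_roch_space_def)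
next
  case True
  obtain A B where AB: "(A, B) \<in> fractions V" "coefs_in Fq6 A" "coefs_in Fq6 B" "ev A = comb \<alpha>" "ev B = denom"
    using fr_rep[OF subring_Fq6 comb_Fq6 denom_Fq6 nz_denom] by blast
  have "(A, B) \<in> fr (comb \<alpha>) denom" using fr_self[OF AB(1)] AB by simp
  hence "fr (comb \<alpha>) denom \<in> rational_functions V"
    using fr_carrier[OF comb_R denom_R nz_denom] AB unfolding rational_functions_def rational_mpol_iff by blast
  moreover have "fr (comb \<alpha>) denom \<noteq> \<zero>\<^bsub>FF\<^esub>" using fr_eq_zero_iff[OF comb_R denom_R nz_denom] True by simp
  moreover have "ord_at V P (fr (comb \<alpha>) denom) + Poly_Mapping.lookup pole_divisor P \<ge> 0" if P: "P \<in> V" for P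
  proof -
    consider "P = pinf" | p where "p \<in> C" "P = aff p" using P V_eq by auto
    thus ?thesis
    proof cases
      case 1
      have "rho (comb \<alpha>) \<le> rho denom + m" using comb_rho[OF True] by (simp add: pole_bound_def rho_denom algebra_simps)
      thus ?thesis unfolding 1 using ord_pinf[OF comb_R denom_R True nz_denom] pinf_in_pole_points
        by (simp add: pole_divisor_def lookup_sum_divisor[OF finite_pole_points])
    next
      case 2
      thus ?thesis using ord_aff[OF 2(1) comb_R denom_R True nz_denom] mult_at_denom[OF 2(1)] aff_in_pole_points[OF 2(1)]
        by (simp add: pole_divisor_def lookup_sum_divisor[OF finite_pole_points])
    qed
  qed
  ultimately show ?thesis by (simp add: riemann_roch_space_def)
qed

text \<open>
  The \<open>q\<^sup>6\<close>-power map permutes the points of the curve and commutes with polynomial functions that have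
  coefficients in the base field; on a general function it acts through the coefficients.
\<close>

definition Frob :: "'a alg_closure point \<Rightarrow> 'a alg_closure point" where
  "Frob p = (fst p ^ (q ^ 6), yc p ^ (q ^ 6), zc p ^ (q ^ 6))"

lemma Frob_polyfun: "f \<in> polyfuns Fq6 \<Longrightarrow> f (Frob p) = f p ^ (q ^ 6)"
  by (induction rule: polyfuns.induct) (auto simp: Frob_def Fq6_iff frob_n power_mult_distrib)

lemma Frob_mon: "mon e (Frob p) = (mon e p :: 'a alg_closure) ^ (q ^ 6)"
  by (simp add: mon_altdef Frob_def power_mult_distrib mult.commute flip: power_mult)

lemma Frob_surj: "p \<in> C \<Longrightarrow> \<exists>p'\<in>C. Frob p' = p"
proof -
  assume p: "p \<in> C"
  have q6: "q ^ 6 > 0" using q2 by simp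
  obtain x y z where xyz: "x ^ (q ^ 6) = fst p" "y ^ (q ^ 6) = yc p" "z ^ (q ^ 6) = zc p"
    using nth_root_exists[OF q6] by metis
  have "(y ^ (q + 1)) ^ (q ^ 6) = (y ^ (q ^ 6)) ^ (q + 1)" "(z ^ M) ^ (q ^ 6) = (z ^ (q ^ 6)) ^ M"
    "(x ^ q) ^ (q ^ 6) = (x ^ (q ^ 6)) ^ q" "(y ^ (q\<^sup>2)) ^ (q ^ 6) = (y ^ (q ^ 6)) ^ (q\<^sup>2)"
    by (simp_all only: power_mult[symmetric] mult.commute[of _ "q ^ 6"])
  hence "(y ^ (q + 1)) ^ (q ^ 6) = (x ^ q + x) ^ (q ^ 6)" "(z ^ M) ^ (q ^ 6) = (y ^ (q\<^sup>2) - y) ^ (q ^ 6)"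
    using p xyz by (auto simp: frob_n frob_n_diff C_def)
  hence "(x, y, z) \<in> C" by (auto simp: C_def dest: frob_n_inj)
  moreover have "Frob (x, y, z) = p" using xyz by (simp add: Frob_def)
  ultimately show ?thesis by blast
qed

lemma Red_below_subset: "Red_below T \<subseteq> Reduced"
  by (auto simp: Red_below_def)

text \<open>
  Conjugating \<open>a = F b\<close> by Frobenius replaces \<open>F\<close> by the function with the conjugate coefficients. As
  \<open>b\<close> can be cancelled, the two functions agree on the curve, hence so do their coefficients.
\<close>

lemma rational_coefficients:
  assumes F: "\<And>p. p \<in> C \<Longrightarrow> F p = (\<Sum>e\<in>Red_below T. \<beta> e * mon e p)"
    and ab: "a \<in> polyfuns Fq6" "b \<in> polyfuns Fq6" "nz b"
    and eq: "\<And>p. p \<in> C \<Longrightarrow> a p = F p * b p" and e: "e \<in> Red_below T"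
  shows "\<beta> e \<in> Fq6"
proof -
  let ?F = "\<lambda>p. \<Sum>e\<in>Red_below T. \<beta> e * mon e p" and ?G = "\<lambda>p. \<Sum>e\<in>Red_below T. \<beta> e ^ (q ^ 6) * mon e p"
  have R: "?F \<in> R" "?G \<in> R" by (auto intro!: R_intros polyfuns_mon)
  have "?F p = ?G p" if "p \<in> C" for p
  proof (rule nz_cancel[where h = b, OF R _ ab(3) _ that])
    show "b \<in> R" by (rule Fq6_R[OF ab(2)])
    fix p assume p: "p \<in> C"
    obtain p' where p': "p' \<in> C" "Frob p' = p" using Frob_surj[OF p] by blast
    have "b p * ?F p = a p" using eq[OF p] F[OF p] by (simp add: mult.commute)
    also have "\<dots> = a p' ^ (q ^ 6)" using Frob_polyfun[OF ab(1), of p'] p'(2) by simp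
    also have "\<dots> = (F p') ^ (q ^ 6) * b p' ^ (q ^ 6)" by (simp add: eq[OF p'(1)] power_mult_distrib)
    also have "b p' ^ (q ^ 6) = b p" using Frob_polyfun[OF ab(2), of p'] p'(2) by simp
    also have "F p' ^ (q ^ 6) = ?G p"
      unfolding F[OF p'(1)] frob_n_sum using Frob_mon[of _ p'] p'(2) by (simp add: power_mult_distrib)
    finally show "b p * ?F p = b p * ?G p" by (simp add: mult.commute)
  qed
  hence "(\<Sum>e\<in>Red_below T. (\<beta> e - \<beta> e ^ (q ^ 6)) * mon e p) = 0" if "p \<in> C" for p
    using that by (simp add: left_diff_distrib sum_subtractf)
  hence "\<beta> e - \<beta> e ^ (q ^ 6) = 0"
    by (rule mon_independent[where c = "\<lambda>e. \<beta> e - \<beta> e ^ (q ^ 6)", OF finite_Red_below Red_below_subset _ e])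
  thus ?thesis by (simp add: Fq6_iff)
qed

text \<open>
  Multiplication by \<open>denom\<close> removes all affine poles, and the condition at \<open>P\<^sub>\<infinity>\<close> bounds the weight of the
  resulting polynomial function.
\<close>

lemma riemann_roch_imp_comb:
  assumes "f \<in> riemann_roch_space V pole_divisor" shows "\<exists>\<alpha>. f = fr (comb \<alpha>) denom"
proof (cases "f = \<zero>\<^bsub>FF\<^esub>")
  case True
  have "comb (\<lambda>_. 0) = (\<lambda>_. 0)" by (simp add: comb_def fun_eq_iff)
  hence "fr (comb (\<lambda>_. 0)) denom = \<zero>\<^bsub>FF\<^esub>" using fr_eq_zero_iff[OF comb_R denom_R nz_denom, of "\<lambda>_. 0"] by (simp add: nz_def)
  thus ?thesis using True by metis
next
  case False
  hence f: "f \<in> rational_functions V" and ord: "\<And>P. P \<in> V \<Longrightarrow> ord_at V P f + Poly_Mapping.lookup pole_divisor P \<ge> 0"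
    using assms by (auto simp: riemann_roch_space_def)
  then obtain A B where AB: "f \<in> carrier FF" "(A, B) \<in> f" "coefs_in Fq6 A" "coefs_in Fq6 B"
    unfolding rational_functions_def rational_mpol_iff by blast
  define a b where "a = ev A" and "b = ev B"
  have fab: "f = fr a b" and fra: "(A, B) \<in> fractions V" using carrierE[OF AB(1,2)] by (auto simp: a_def b_def)
  have Fq6ab: "a \<in> polyfuns Fq6" "b \<in> polyfuns Fq6" unfolding a_def b_def using ev_polyfuns[OF subring_Fq6] AB by auto
  have R: "a \<in> R" "b \<in> R" using Fq6ab Fq6_R by auto
  have nzb: "nz b" using fra by (simp add: b_def fractions_iff)
  have nza: "nz a" using False fab fr_eq_zero_iff[OF R nzb] by simp
  define aH where "aH = (\<lambda>p. a p * denom p)"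
  have Fq6aH: "aH \<in> polyfuns Fq6" unfolding aH_def using Fq6ab denom_Fq6 by (rule_tac polyfuns.mult)
  have RaH: "aH \<in> R" by (rule Fq6_R[OF Fq6aH])
  have nzaH: "nz aH" unfolding aH_def by (rule nz_mult[OF R(1) denom_R nza nz_denom])
  have "\<exists>F\<in>R. \<forall>Q\<in>C. aH Q = F Q * b Q"
  proof (rule regular_everywhere[OF RaH R(2) nzb])
    fix P assume P: "P \<in> C"
    have "ord_at V (aff P) f + Poly_Mapping.lookup pole_divisor (aff P) \<ge> 0" using ord aff_in_V[OF P] by blast
    hence "mult_at P b \<le> mult_at P a + mult_at P denom"
      using ord_aff[OF P R nza nzb] mult_at_denom[OF P] aff_in_pole_points[OF P]
      by (simp add: fab pole_divisor_def lookup_sum_divisor[OF finite_pole_points] split: if_splits)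
    hence "mult_at P b \<le> mult_at P aH" using mult_at_mult[OF P R(1) denom_R nza nz_denom] by (simp add: aH_def)
    from fr_quotient[OF P RaH R(2) nzaH nzb this]
    show "\<exists>u\<in>R. \<exists>v\<in>R. v P \<noteq> 0 \<and> (\<forall>Q\<in>C. aH Q * v Q = u Q * b Q)" by blast
  qed
  then obtain F where F: "F \<in> R" "\<And>Q. Q \<in> C \<Longrightarrow> aH Q = F Q * b Q" by blast
  have nzF: "nz F" using nzaH F(2) by (auto simp: nz_def)
  have "rho aH = rho (\<lambda>p. F p * b p)" using F(2) by (intro rho_cong polyfuns.mult F R nz_mult nzF nzb)
  hence rF: "rho F + rho b = rho a + rho denom"
    using rho_mult[OF F(1) R(2) nzF nzb] rho_mult[OF R(1) denom_R nza nz_denom] by (simp add: aH_def)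
  have "ord_at V pinf f + Poly_Mapping.lookup pole_divisor pinf \<ge> 0" using ord pinf_in_V by blast
  hence "rho a \<le> rho b + m"
    using ord_pinf[OF R nza nzb] pinf_in_pole_points by (simp add: fab pole_divisor_def lookup_sum_divisor[OF finite_pole_points])
  hence "rho F \<le> pole_bound" using rF rho_denom by (simp add: pole_bound_def algebra_simps)
  hence "F \<in> Filt (pole_bound + 1)" using lead_Filt_iff[OF lead_rho[OF F(1) nzF]] by simp
  then obtain \<beta> where \<beta>: "\<And>p. p \<in> C \<Longrightarrow> F p = (\<Sum>e\<in>Red_below (pole_bound + 1). \<beta> e * mon e p)" unfolding Filt_def by blast
  have "\<beta> e \<in> Fq6" if "e \<in> Red_below (pole_bound + 1)" for e
    using rational_coefficients[OF \<beta> Fq6aH Fq6ab(2) nzb F(2) that] .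
  hence "to_ac (of_ac (\<beta> e)) = \<beta> e" if "e \<in> Red_below (pole_bound + 1)" for e
    using that unfolding Fq6_def by (intro to_ac_of_ac) blast
  hence Fc: "F p = comb (\<lambda>e. of_ac (\<beta> e)) p" if "p \<in> C" for p using \<beta>[OF that] by (simp add: comb_def)
  have "f = fr (comb (\<lambda>e. of_ac (\<beta> e))) denom" unfolding fab
  proof (rule fr_eqI[OF R comb_R denom_R nzb nz_denom])
    fix p assume "p \<in> C"
    from F(2)[OF this] Fc[OF this] show "a p * denom p = comb (\<lambda>e. of_ac (\<beta> e)) p * b p" by (simp add: aH_def)
  qed
  thus ?thesis by blast
qed

lemma riemann_roch_space_eq: "riemann_roch_space V pole_divisor = {fr (comb \<alpha>) denom | \<alpha>. True}"
  using riemann_roch_imp_comb comb_in_riemann_roch by blast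

definition eval_points :: "('a alg_closure, 4) ppoint set" where
  "eval_points = rational_points V - pole_points"

lemma eval_points_eq: "eval_points = aff ` {p \<in> C. \<not> on_planes p \<and> fst p \<in> Fq6 \<and> yc p \<in> Fq6 \<and> zc p \<in> Fq6}"
proof (intro equalityI subsetI)
  fix P assume P: "P \<in> eval_points"
  hence PV: "P \<in> V" "P \<notin> pole_points" by (auto simp: eval_points_def rational_points_def)
  obtain v :: "'a alg_closure ^ 4" where v: "v \<in> P" "\<And>i. v $ i \<in> Fq6" using P by (auto simp: eval_points_def rational_points_def Fq6_def)
  obtain p where p: "p \<in> C" "P = aff p" using PV V_eq pinf_in_pole_points by auto
  obtain a where a: "v = a *s pt p" "a \<noteq> 0" using v(1) by (auto simp: p(2) aff_def proj_point_def)
  have aRF: "a \<in> Fq6" using v(2)[of 4] by (simp add: a(1))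
  have div: "x \<in> Fq6" if ax: "a * x \<in> Fq6" for x
  proof -
    obtain a' where "a = to_ac a'" using aRF unfolding Fq6_def by blast
    moreover obtain b' where "a * x = to_ac b'" using ax unfolding Fq6_def by blast
    ultimately have "x = to_ac (b' / a')" using a(2) by (auto simp: field_simps)
    thus ?thesis unfolding Fq6_def by (rule range_eqI)
  qed
  have "fst p \<in> Fq6" "yc p \<in> Fq6" "zc p \<in> Fq6"
    using v(2)[of 1] v(2)[of 2] v(2)[of 3] by (auto simp: a(1) intro: div)
  thus "P \<in> aff ` {p \<in> C. \<not> on_planes p \<and> fst p \<in> Fq6 \<and> yc p \<in> Fq6 \<and> zc p \<in> Fq6}"
    using p PV(2) aff_in_pole_points by blast
next
  fix P assume "P \<in> aff ` {p \<in> C. \<not> on_planes p \<and> fst p \<in> Fq6 \<and> yc p \<in> Fq6 \<and> zc p \<in> Fq6}"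
  then obtain p where p: "P = aff p" "p \<in> C" "\<not> on_planes p" "fst p \<in> Fq6" "yc p \<in> Fq6" "zc p \<in> Fq6" by blast
  have "1 *s pt p \<in> aff p" unfolding aff_def proj_point_def by (intro CollectI exI[of _ 1]) auto
  hence "pt p \<in> P" using p(1) by simp
  moreover have "\<forall>i. pt p $ i \<in> range to_ac"
    using p subring_Fq6 unfolding forall_4 by (simp add: Fq6_def subring_set_def)
  ultimately show "P \<in> eval_points" using p aff_in_V aff_in_pole_points by (auto simp: eval_points_def rational_points_def)
qed

lemma finite_eval_points: "finite eval_points"
proof -
  have "finite (Fq6 \<times> Fq6 \<times> Fq6)" by (simp add: Fq6_def)
  hence "finite {p \<in> C. \<not> on_planes p \<and> fst p \<in> Fq6 \<and> yc p \<in> Fq6 \<and> zc p \<in> Fq6}"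
    by (rule finite_subset[rotated]) auto
  thus ?thesis unfolding eval_points_eq by (rule finite_imageI)
qed

lemma keys_eval_points: "Poly_Mapping.keys (sum_divisor 1 eval_points) = eval_points"
  using lookup_sum_divisor[OF finite_eval_points, of 1] by (auto simp: in_keys_iff split: if_splits)

lemma value_at_comb:
  assumes p: "p \<in> C" "\<not> on_planes p"
  shows "value_at (fr (comb \<alpha>) denom) (aff p) = of_ac (comb \<alpha> p / denom p)"
proof -
  have Hp: "denom p \<noteq> 0" using p plane_prod_eq_0 by (simp add: denom_def)
  have val: "mpol_eval A v / mpol_eval B v = comb \<alpha> p / denom p"
    if AB: "(A, B) \<in> fr (comb \<alpha>) denom" and v: "v \<in> aff p" "mpol_eval B v \<noteq> 0" for A B v
  proof -
    obtain d where d: "homogeneous d A" "homogeneous d B" using AB unfolding fr_def fractions_iff by blast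
    obtain a where a: "v = a *s pt p" "a \<noteq> 0" using v(1) by (auto simp: aff_def proj_point_def)
    have cr: "ev A p * denom p = comb \<alpha> p * ev B p" using AB p(1) by (auto simp: fr_def)
    have Bp: "ev B p \<noteq> 0" using v(2) by (auto simp: a(1) mpol_eval_scale[OF d(2)])
    show ?thesis using cr Bp Hp a(2)
      by (simp add: a(1) mpol_eval_scale[OF d(1)] mpol_eval_scale[OF d(2)] frac_eq_eq)
  qed
  obtain A B where AB: "(A, B) \<in> fractions V" "ev A = comb \<alpha>" "ev B = denom" by (rule fr_rep'[OF comb_R denom_R nz_denom])
  have in_fr: "(A, B) \<in> fr (comb \<alpha>) denom" using fr_self[OF AB(1)] AB by simp
  have "1 *s pt p \<in> aff p" unfolding aff_def proj_point_def by (intro CollectI exI[of _ 1]) auto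
  hence ptp: "pt p \<in> aff p" by simp
  have "(THE b. \<exists>(A, B)\<in>fr (comb \<alpha>) denom. \<exists>v\<in>aff p. mpol_eval B v \<noteq> 0 \<and> b = mpol_eval A v / mpol_eval B v) = comb \<alpha> p / denom p"
  proof (rule the_equality)
    show "\<exists>(A, B)\<in>fr (comb \<alpha>) denom. \<exists>v\<in>aff p. mpol_eval B v \<noteq> 0 \<and> comb \<alpha> p / denom p = mpol_eval A v / mpol_eval B v"
    proof -
      have "ev A p = comb \<alpha> p" "ev B p = denom p" using fun_cong[OF AB(2), of p] fun_cong[OF AB(3), of p] by simp_all
      thus ?thesis using in_fr ptp Hp by (intro bexI[of _ "(A, B)"]) (auto intro!: bexI[of _ "pt p"])
    qed
  next
    fix b assume "\<exists>(A, B)\<in>fr (comb \<alpha>) denom. \<exists>v\<in>aff p. mpol_eval B v \<noteq> 0 \<and> b = mpol_eval A v / mpol_eval B v"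
    thus "b = comb \<alpha> p / denom p" using val by auto
  qed
  thus ?thesis by (simp add: value_at_def)
qed

definition basis_word :: "nat \<times> nat \<times> nat \<Rightarrow> ('a alg_closure, 4) ppoint \<Rightarrow> 'a" where
  "basis_word e P = (if P \<in> eval_points then value_at (fr (comb (\<lambda>e'. if e' = e then 1 else 0)) denom) P else 0)"

lemma polyfun_Fq6_value:
  assumes "f \<in> polyfuns Fq6" "fst p \<in> Fq6" "yc p \<in> Fq6" "zc p \<in> Fq6"
  shows "f p \<in> Fq6"
  using assms(1) by induction (use assms subring_Fq6 in \<open>auto simp: subring_set_def\<close>)

lemma value_at_basis_words:
  assumes "P \<in> eval_points"
  shows "value_at (fr (comb \<alpha>) denom) P = (\<Sum>e\<in>Red_below (pole_bound + 1). \<alpha> e * basis_word e P)"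
proof -
  obtain p where p: "p \<in> C" "\<not> on_planes p" "P = aff p" "fst p \<in> Fq6" "yc p \<in> Fq6" "zc p \<in> Fq6"
    using assms unfolding eval_points_eq by blast
  have quot: "to_ac (of_ac (comb \<beta> p / denom p)) = comb \<beta> p / denom p" for \<beta>
  proof (rule to_ac_of_ac)
    have "comb \<beta> p \<in> Fq6" "denom p \<in> Fq6" using polyfun_Fq6_value[OF comb_Fq6] polyfun_Fq6_value[OF denom_Fq6] p by auto
    thus "comb \<beta> p / denom p \<in> range to_ac" by (auto simp: Fq6_def simp flip: to_ac_divide)
  qed
  have one: "comb (\<lambda>e'. if e' = e then 1 else 0) p = mon e p" if "e \<in> Red_below (pole_bound + 1)" for e
  proof -
    have "comb (\<lambda>e'. if e' = e then 1 else 0) p = (\<Sum>e'\<in>Red_below (pole_bound + 1). if e' = e then mon e' p else 0)"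
      unfolding comb_def by (intro sum.cong) auto
    thus ?thesis using that by simp
  qed
  have "to_ac (\<Sum>e\<in>Red_below (pole_bound + 1). \<alpha> e * basis_word e P) = (\<Sum>e\<in>Red_below (pole_bound + 1). to_ac (\<alpha> e) * (mon e p / denom p))"
    unfolding to_ac_sum to_ac_mult
  proof (intro sum.cong refl arg_cong2[where f = "(*)"])
    fix e assume e: "e \<in> Red_below (pole_bound + 1)"
    have "basis_word e P = of_ac (comb (\<lambda>e'. if e' = e then 1 else 0) p / denom p)"
      using assms by (simp add: basis_word_def p(3) value_at_comb[OF p(1,2)])
    hence "to_ac (basis_word e P) = comb (\<lambda>e'. if e' = e then 1 else 0) p / denom p" by (simp only: quot)
    thus "to_ac (basis_word e P) = mon e p / denom p" by (simp only: one[OF e])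
  qed
  also have "\<dots> = comb \<alpha> p / denom p" by (simp add: comb_def sum_divide_distrib)
  also have "\<dots> = to_ac (value_at (fr (comb \<alpha>) denom) P)" using quot by (simp add: p(3) value_at_comb[OF p(1,2)])
  finally show ?thesis by simp
qed

lemma code_eq: "functional_code V (sum_divisor 1 eval_points) pole_divisor = {\<lambda>P. \<Sum>e\<in>Red_below (pole_bound + 1). \<alpha> e * basis_word e P | \<alpha>. True}"
proof -
  have eq: "(\<lambda>P. if P \<in> eval_points then value_at (fr (comb \<alpha>) denom) P else 0) = (\<lambda>P. \<Sum>e\<in>Red_below (pole_bound + 1). \<alpha> e * basis_word e P)" for \<alpha>
    using value_at_basis_words by (auto simp: fun_eq_iff basis_word_def)
  show ?thesis unfolding functional_code_def keys_eval_points riemann_roch_space_eq using eq by (auto, metis)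
qed

text \<open>
  A combination whose word is zero vanishes at all points above the elements of \<open>\<Gamma>\<^sub>0\<close> other than
  the \<open>c\<^sub>i\<close>. These are more points than its weight allows for a nonzero function.
\<close>

lemma basis_words_independent:
  assumes upper: "pole_bound < q ^ 3 * ((q ^ 3 + 1) * (q\<^sup>2 - 1) + 1 - (s + 1))"
    and zero: "\<And>P. (\<Sum>e\<in>Red_below (pole_bound + 1). \<alpha> e * basis_word e P) = 0"
  shows "\<forall>e\<in>Red_below (pole_bound + 1). \<alpha> e = 0"
proof -
  define A where "A = (Gamma0 q :: 'a set) - c ` {0..s}"
  define S where "S = {p \<in> C. zc p \<in> to_ac ` A}"
  have S: "finite S" "card S = q ^ 3 * card A" "\<And>x y z. (x, y, z) \<in> S \<Longrightarrow> x \<in> Fq6 \<and> y \<in> Fq6 \<and> z \<in> Fq6"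
    using card_fibres[of A, folded S_def] by (auto simp: A_def)
  have "card (c ` {0..s}) \<le> s + 1" using card_image_le[of "{0..s}" c] by simp
  hence "card A \<ge> (q ^ 3 + 1) * (q\<^sup>2 - 1) + 1 - (s + 1)"
    using diff_card_le_card_Diff[of "c ` {0..s}" "Gamma0 q :: 'a set"] card_Gamma0 unfolding A_def by simp
  hence "card S > pole_bound" using upper S(2) by (metis less_le_trans mult_le_mono2)
  have "comb \<alpha> p = 0" if p: "p \<in> S" for p
  proof -
    have p1: "p \<in> C" "\<not> on_planes p" using p by (auto simp: S_def A_def on_planes_def)
    have rat: "fst p \<in> Fq6" "yc p \<in> Fq6" "zc p \<in> Fq6" using S(3)[of "fst p" "yc p" "zc p"] p by auto
    hence "aff p \<in> eval_points" unfolding eval_points_eq using p1 by blast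
    hence "value_at (fr (comb \<alpha>) denom) (aff p) = 0" using value_at_basis_words zero by simp
    hence "of_ac (comb \<alpha> p / denom p) = 0" using value_at_comb[OF p1] by simp
    moreover have "comb \<alpha> p / denom p \<in> range to_ac"
    proof -
      have "comb \<alpha> p \<in> Fq6" "denom p \<in> Fq6" using polyfun_Fq6_value[OF comb_Fq6] polyfun_Fq6_value[OF denom_Fq6] rat by auto
      thus ?thesis by (auto simp: Fq6_def simp flip: to_ac_divide)
    qed
    ultimately have "comb \<alpha> p / denom p = 0" using to_ac_of_ac by (metis to_ac_0)
    moreover have "denom p \<noteq> 0" using p1 plane_prod_eq_0 by (simp add: denom_def)
    ultimately show ?thesis by simp
  qed
  have "\<not> nz (comb \<alpha>)"
  proof
    assume nz: "nz (comb \<alpha>)"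
    have "card S \<le> rho (comb \<alpha>)"
      using \<open>\<And>p. p \<in> S \<Longrightarrow> comb \<alpha> p = 0\<close> S(1)
      by (intro card_zeros_le[OF lead_rho[OF comb_R nz]]) (auto simp: S_def)
    thus False using comb_rho[OF nz] \<open>card S > pole_bound\<close> by simp
  qed
  hence zeroC: "(\<Sum>e\<in>Red_below (pole_bound + 1). to_ac (\<alpha> e) * mon e p) = 0" if "p \<in> C" for p
    using that by (auto simp: nz_def comb_def)
  show ?thesis
  proof
    fix e assume e: "e \<in> Red_below (pole_bound + 1)"
    have "to_ac (\<alpha> e) = 0"
      using zeroC by (rule mon_independent[where c = "\<lambda>e. to_ac (\<alpha> e)", OF finite_Red_below Red_below_subset _ e])
    thus "\<alpha> e = 0" by simp
  qed
qed

lemma code_dimension: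
  assumes lower: "q ^ 5 + q\<^sup>2 \<le> pole_bound + 1 + 2 * q ^ 3"
    and upper: "pole_bound < q ^ 3 * ((q ^ 3 + 1) * (q\<^sup>2 - 1) + 1 - (s + 1))"
  shows "2 * code_dim (functional_code V (sum_divisor 1 eval_points) pole_divisor) + q ^ 5 + q\<^sup>2 = 2 * (pole_bound + 1) + 2 * q ^ 3"
proof -
  have "code_dim (functional_code V (sum_divisor 1 eval_points) pole_divisor) = card (Red_below (pole_bound + 1))"
    unfolding code_eq by (rule code_dim_eq_card) (use basis_words_independent[OF upper] in auto)
  thus ?thesis using card_Red_below[OF lower] by simp
qed

end

theorem proposition4p2:
  fixes q m s k :: nat
    and c :: "nat \<Rightarrow> 'a::{field, finite}"
    and \<X> \<G> \<D> :: "('a alg_closure, 4) ppoint set"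
    and G D :: "('a alg_closure, 4) pdivisor"
  assumes q: "primepow q"
    and card: "CARD('a) = q ^ 6"
    and curve: "\<X> = GK_curve q"
    and m: "m > 0"
    and s: "s > 0"
    and c0: "c 0 = 0"
    and c_distinct: "inj_on c {0..s}"
    and c_Gamma0: "\<forall>i\<in>{0..s}. c i \<in> Gamma0 q"
    and G_points: "\<G> = (\<Union>i\<in>{0..s}. \<X> \<inter> zeta_plane (c i))"
    and D_points: "\<D> = rational_points \<X> - \<G>"
    and G: "G = sum_divisor m \<G>"
    and D: "D = sum_divisor 1 \<D>"
    and k: "k = code_dim (functional_code \<X> D G)"
    and lower: "(real q ^ 5 - 2 * real q ^ 3 + real q ^ 2 - 1) / ((real s + 1) * real q ^ 3 + 1) \<le> real m"
    and upper: "real m \<le> (real q ^ 8 - real q ^ 6 + real q ^ 5 - (real s + 1) * real q ^ 3 - 1)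
                          / ((real s + 1) * real q ^ 3 + 1)"
  shows "real k = real m * (1 + (real s + 1) * real q ^ 3)
                    - 1 / 2 * (real q ^ 5 - 2 * real q ^ 3 + real q ^ 2 - 2)"
proof -
  interpret gk_curve q "TYPE('a alg_closure)" by (rule gk_curve_alg_closure[OF q card])
  interpret gk_code q "TYPE('a alg_closure)" c s m
    by unfold_locales (use card c_distinct in auto)
  have den: "(real s + 1) * real q ^ 3 + 1 > 0" by (intro add_nonneg_pos mult_nonneg_nonneg) auto
  have rN: "real pole_bound = real m * ((real s + 1) * real q ^ 3 + 1)" by (simp add: pole_bound_def algebra_simps)
  have X: "\<X> = V" unfolding curve V_def ..
  have code: "functional_code \<X> D G = functional_code V (sum_divisor 1 eval_points) pole_divisor"
    unfolding D D_points G G_points X eval_points_def pole_divisor_def pole_points_def ..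
  have "real (q ^ 5 + q\<^sup>2) \<le> real (pole_bound + 1 + 2 * q ^ 3)"
    using lower den rN by (simp add: divide_le_eq)
  hence lo: "q ^ 5 + q\<^sup>2 \<le> pole_bound + 1 + 2 * q ^ 3" by (simp only: of_nat_le_iff)
  have up: "pole_bound < q ^ 3 * ((q ^ 3 + 1) * (q\<^sup>2 - 1) + 1 - (s + 1))"
  proof -
    let ?g = "(q ^ 3 + 1) * (q\<^sup>2 - 1)"
    have "real (q\<^sup>2 - 1) = real q ^ 2 - 1" using q_sizes by (simp add: of_nat_diff)
    hence rg: "real ?g = (real q ^ 3 + 1) * (real q ^ 2 - 1)"
      unfolding of_nat_mult by simp
    have "real pole_bound + 1 \<le> real q ^ 8 - real q ^ 6 + real q ^ 5 - (real s + 1) * real q ^ 3"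
      using upper den rN by (simp add: le_divide_eq)
    also have "\<dots> = real q ^ 3 * (real ?g - real s)"
      unfolding rg by (simp add: algebra_simps eval_nat_numeral)
    finally have ineq: "real pole_bound + 1 \<le> real q ^ 3 * (real ?g - real s)" .
    have "s \<le> ?g"
    proof (rule ccontr)
      assume "\<not> s \<le> ?g"
      hence "real ?g - real s \<le> 0" by linarith
      hence "real q ^ 3 * (real ?g - real s) \<le> 0" by (intro mult_nonneg_nonpos) auto
      thus False using ineq by linarith
    qed
    hence "real (?g + 1 - (s + 1)) = real ?g - real s" by (simp add: of_nat_diff)
    hence "real (pole_bound + 1) \<le> real (q ^ 3 * (?g + 1 - (s + 1)))" using ineq by simp
    hence "pole_bound + 1 \<le> q ^ 3 * (?g + 1 - (s + 1))" by (simp only: of_nat_le_iff)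
    thus ?thesis by simp
  qed
  have "real (2 * k + q ^ 5 + q\<^sup>2) = real (2 * (pole_bound + 1) + 2 * q ^ 3)"
    using code_dimension[OF lo up] unfolding k code by (simp only: of_nat_eq_iff)
  hence "2 * real k + real q ^ 5 + real q ^ 2 = 2 * real pole_bound + 2 + 2 * real q ^ 3" by simp
  thus ?thesis unfolding rN by (simp add: algebra_simps)
qed

end
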